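(* Let $(B_0,\mathcal{V},\nabla,S,F^\bullet)$ be a variation of Hodge like filtrations with pairing of weight $3$ which satisfies the CY-condition, $n=\dim B_0$. Choose an opposite filtration $U_\bullet$ and $\lambda_0\in F^3_0\setminus\{0\}$. Choose an adapted basis $v_1,\dots,v_{2n+2}$ (see context) with associated $\nabla$-flat sections $v_1^0,\dots,v_{2n+2}^0$ and $v_1^0(0)=\lambda_0$. Put $a_i=v_i^0$ ($i=1,\dots,n+1$), $b_i=v_{n+i}^0$ ($i=2,\dots,n+1$) and $b_1=-v_{2n+2}^0$. Then $a_1,\dots,a_{n+1},b_1,\dots,b_{n+1}$ are a symplectic basis, and $V_1=\langle a_1,\dots,a_{n+1}\rangle$ is (the flat extension of) $F^2_0$. Let $z_1,\dots,z_{n+1}$ be the special coordinates on $B=F^3\setminus\{\text{zero section}\}$ and $\Psi^{U_1,F^2_0}:=\Psi^{U_1,V_1}$ the prepotential given by this symplectic basis; let $\Psi$, $t_1,\dots,t_{2n+2}$, $\Phi$ be the data of the Frobenius manifold $M^{U,\lambda_0}\supset B_0$ given by $v_1,\dots,v_{2n+2}$. (a) Then $(P^{U_2})^{-1}(\{\lambda_0\}\times B_0)=\{z_1=1\}\subset B$, and $B_0$ is embedded into $B$ as this hyperplane. The flat structure on $B_0$ from the Frobenius manifold coincides with the flat structure which $B_0$ inherits from $(B,\nabla^{U_1})$ by this embedding. (b) The following equalities hold: $t_i=z_i|_{\{z_1=1\}}$ for $i=2,\dots,n+1$, and $\Psi=\Psi^{U_1,F^2_0}|_{\{z_1=1\}}$.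 (c) The potential $\Phi$ of the Frobenius manifold can be changed by adding any element of $\mathbb{C}[t_1,\dots,t_{2n+2}]_{\le2}$ (polynomials of degree $\le2$) without changing the Frobenius manifold. All the prepotentials in the class $\Psi^{U_1,F^2_0}+\mathbb{C}[z_1,\dots,z_{n+1}]_2$ (where the index $2$ means homogeneous of degree $2$) give, via restriction to $\{z_1=1\}$ as in (b) and via $\Phi=\Psi+\frac12t_1^2t_{2n+2}+t_1\sum_{i=2}^{n+1}t_it_{n+i}$, all the Frobenius manifold potentials in the class $\Phi+\mathbb{C}[t_2,\dots,t_{n+1}]_{\le2}$.
   Context: **Variations of Hodge like filtrations.** $B_0$ is a sufficiently small neighborhood of a base point $0$ in a complex manifold of dimension $n$. A variation of Hodge like filtrations with pairing of weight $3$: a holomorphic vector bundle $\mathcal{V}\to B_0$ with flat connection $\nabla$; a $\nabla$-flat antisymmetric nondegenerate pairing $S$; a decreasing filtration $F^\bullet$ by holomorphic subbundles with $\nabla:\mathcal{O}(F^p)\to\mathcal{O}(F^{p-1})\otimes\Omega^1_{B_0}$ and $S(F^p,F^{4-p})=0$. CY-condition: $F^4=0$, $F^0=\mathcal{V}$, $\operatorname{rank}F^3=1$, $\operatorname{rank}F^2/F^3=n=\operatorname{rank}F^1/F^2$, $\operatorname{rank}F^0/F^1=1$, and for any $\lambda\in F^3_0\setminus\{0\}$ the map $T_0B_0\to F^2_0/F^3_0$, $X\mapsto[\nabla_X\lambda]$ (induced Higgs field), is an isomorphism. **Opposite filtration, adapted basis, Frobenius manifold.** An opposite filtration is an increasing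 $\nabla$-flat filtration $U_\bullet$ with $\mathcal{V}=\bigoplus_pF^p\cap U_p$ (equivalently $\mathcal{V}=F^p\oplus U_{p-1}$) and $S(U_p,U_{2-p})=0$; then $\nabla=\nabla^U+C^U$ with $\nabla^U$ a flat connection on each $F^p\cap U_p$ and $C^U$ mapping $F^p\cap U_p$ to $(F^{p-1}\cap U_{p-1})\otimes\Omega^1_{B_0}$. An adapted basis is a $\nabla^U$-flat basis $v_1,\dots,v_{2n+2}$ with $v_1\in F^3$; $v_2,\dots,v_{n+1}\in F^2\cap U_2$; $v_{n+2},\dots,v_{2n+1}\in F^1\cap U_1$; $v_{2n+2}\in U_0$; $S(v_1,v_{2n+2})=-1$, $S(v_k,v_l)=\delta_{k+n,l}$ for $2\le k\le n+1$. $v_\alpha^0$ is the $\nabla$-flat extension of $v_\alpha(0)$. There are unique coordinates $t_2,\dots,t_{n+1}$ on $B_0$ and a unique $\Psi\in\mathcal{O}_{B_0}$ with $\Psi(0)=0$ and $v_1=v_1^0+\sum_it_iv_i^0+\sum_i\frac{\partial\Psi}{\partial t_i}v_{n+i}^0+(\sum_kt_k\frac{\partial}{\partial t_k}-2)(\Psi)v_{2n+2}^0$ (sums over $2,\dots,n+1$). The Frobenius manifold $M^{U,\lambda_0}=\mathbb{C}\times B_0\times\mathbb{C}^{n+1}$ has flat coordinates $t_1$; $t_2,\dots,t_{n+1}$; $t_{n+2},\dots,t_{2n+2}$; metric $g(\partial_1,\partial_{2n+2})=g(\partial_i,\partial_{n+i})=1$ ($2\le i\le n+1$), other pairings zero;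 potential $\Phi=\Psi+\frac12t_1^2t_{2n+2}+t_1\sum_{i=2}^{n+1}t_it_{n+i}$; multiplication $g(X\circ Y,Z)=XYZ(\Phi)$ for flat $X,Y,Z$; $e=\partial_1$; $E=t_1\partial_1-\sum_{a=n+2}^{2n+1}t_a\partial_a-2t_{2n+2}\partial_{2n+2}$. The flat structure on $B_0$ from the Frobenius manifold is the one with flat coordinates $t_2,\dots,t_{n+1}$. **Projective special geometry on $B$.** $p:B=F^3\setminus\{\text{zero section}\}\to B_0$; points of $B$ are pairs $(\delta,b)$, $\delta\in F^3_b\setminus\{0\}$. $\varepsilon$ is the vector field generating the fiberwise $\mathbb{C}^*$-action. $\sigma_{taut}$ is the tautological section of $p^*\mathcal{V}$, $\sigma_{taut}(\delta,b)=\delta$. An opposite subbundle is a $\nabla$-flat subbundle $U_1\subset\mathcal{V}$ of rank $n+1$ with $S(U_1,U_1)=0$ and $F^2\oplus U_1=\mathcal{V}$. Then the map $B\to\mathcal{V}_0/(U_1)_0$, $(\delta,b)\mapsto$ class of the $\nabla$-flat shift of $\delta$ to $\mathcal{V}_0$, is an embedding, locally an isomorphism; $\nabla^{U_1}$ is the flat structure on $B$ induced by the vector space structure of $\mathcal{V}_0/(U_1)_0$. Given a $\nabla$-flat symplectic basis $a_1,\dots,a_{n+1},b_1,\dots,b_{n+1}$ of $\mathcal{V}$ (i.e. $S(a_i,b_j)=\delta_{ij}$, $S(a_i,a_j)=S(b_i,b_j)=0$) with $U_1=\langle b_1,\dots,b_{n+1}\rangle$ opposite and $V_1=\langle a_1,\dots,a_{n+1}\rangle$,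 write $\sigma_{taut}=\sum_iz_ia_i+\sum_iw_ib_i$. Then $z_1,\dots,z_{n+1}$ are ($\nabla^{U_1}$-flat) coordinates on $B$, called special coordinates, and the prepotential $\Psi^{U_1,V_1}\in\mathcal{O}_B$ is the unique function with $\partial\Psi^{U_1,V_1}/\partial z_i=w_i$ for $i=1,\dots,n+1$ and $\varepsilon(\Psi^{U_1,V_1})=2\Psi^{U_1,V_1}$. **The map $P^{U_2}$.** Since $F^3\oplus U_2=\mathcal{V}$, the flat connection on $\mathcal{V}/U_2$ and the isomorphism $F^3\to\mathcal{V}/U_2$ induce a flat connection on $F^3$, hence a trivialization $F^3\cong F^3_0\times B_0$; $P^{U_2}:B\to(F^3_0\setminus\{0\})\times B_0$ is its restriction to $B$. *)

theory Defs
  imports "HOL-Analysis.Analysis"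
begin

section \<open>Holomorphic functions of several variables\<close>

definition holo_on :: "(complex^'k::finite \<Rightarrow> complex) \<Rightarrow> (complex^'k) set \<Rightarrow> bool" where
  "holo_on f S \<longleftrightarrow> (\<forall>x\<in>S. \<exists>a. (f has_derivative (\<lambda>h. \<Sum>i\<in>UNIV. a i * h $ i)) (at x))"

definition vholo_on :: "(complex^'k::finite \<Rightarrow> complex^'l::finite) \<Rightarrow> (complex^'k) set \<Rightarrow> bool" where
  "vholo_on f S \<longleftrightarrow> (\<forall>j. holo_on (\<lambda>x. f x $ j) S)"

definition pd :: "'k::finite \<Rightarrow> (complex^'k \<Rightarrow> complex) \<Rightarrow> complex^'k \<Rightarrow> complex" where
  "pd i f x = deriv (\<lambda>c. f (x + c *s axis i 1)) 0"

definition vpd :: "'k::finite \<Rightarrow> (complex^'k \<Rightarrow> complex^'l::finite) \<Rightarrow> complex^'k \<Rightarrow> complex^'l" where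
  "vpd i f x = (\<chi> j. pd i (\<lambda>y. f y $ j) x)"

definition coordinates_on :: "(complex^'k::finite) set \<Rightarrow> (complex^'k \<Rightarrow> complex^'k) \<Rightarrow> bool" where
  "coordinates_on X \<phi> \<longleftrightarrow> vholo_on \<phi> X \<and> inj_on \<phi> X \<and> open (\<phi> ` X) \<and>
     vholo_on (inv_into X \<phi>) (\<phi> ` X)"

text \<open>The partial derivative \<open>\<partial>f/\<partial>\<phi>\<^sub>i\<close> in a global coordinate system \<open>\<phi>\<close> of a manifold \<open>X\<close>.\<close>

definition coord_deriv ::
  "('p \<Rightarrow> complex^'k::finite) \<Rightarrow> 'p set \<Rightarrow> 'k \<Rightarrow> ('p \<Rightarrow> complex) \<Rightarrow> 'p \<Rightarrow> complex" where
  "coord_deriv \<phi> X i f p = pd i (\<lambda>y. f (inv_into X \<phi> y)) (\<phi> p)"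

definition poly_le2 :: "(complex^'k::finite \<Rightarrow> complex) set" where
  "poly_le2 = {q. \<exists>c l m. q = (\<lambda>x. c + (\<Sum>i\<in>UNIV. l i * x $ i)
                                   + (\<Sum>i\<in>UNIV. \<Sum>j\<in>UNIV. m i j * x $ i * x $ j))}"

definition poly_hom2 :: "(complex^'k::finite \<Rightarrow> complex) set" where
  "poly_hom2 = {q. \<exists>m. q = (\<lambda>x. \<Sum>i\<in>UNIV. \<Sum>j\<in>UNIV. m i j * x $ i * x $ j)}"


section \<open>Variations of Hodge like filtrations with pairing of weight 3\<close>

text \<open>
  Since the base \<open>B\<^sub>0\<close> is a sufficiently small neighbourhood of its base point, it lies in a chart and
  \<open>\<V>\<close> is holomorphically trivial on it.  So \<open>base D\<close> is a domain in \<open>\<complex>\<^sup>n\<close>,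
  \<open>\<V>\<close> is the product bundle with fibre \<open>\<complex>\<^sup>m\<close> (\<open>m = 2n + 2\<close> follows from the CY-condition), and
  the connection is \<open>\<nabla> = d + \<Sum>\<^sub>i A\<^sub>i dx\<^sub>i\<close> with \<open>A\<^sub>i = conn D i\<close> an arbitrary holomorphic matrix function.
  Values of sections, subbundles etc. outside \<open>base D\<close> are irrelevant.
\<close>

record ('n, 'm) vhf =
  base :: "(complex^'n) set"
  bpt  :: "complex^'n"
  conn :: "'n \<Rightarrow> complex^'n \<Rightarrow> complex^'m^'m"
  pair :: "complex^'n \<Rightarrow> complex^'m \<Rightarrow> complex^'m \<Rightarrow> complex"
  fil  :: "int \<Rightarrow> complex^'n \<Rightarrow> (complex^'m) set"

definition cov ::
  "('n::finite, 'm::finite) vhf \<Rightarrow> 'n \<Rightarrow> (complex^'n \<Rightarrow> complex^'m) \<Rightarrow> complex^'n \<Rightarrow> complex^'m" where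
  "cov D i s x = vpd i s x + conn D i x *v s x"

definition flat_connection :: "('n::finite, 'm::finite) vhf \<Rightarrow> bool" where
  "flat_connection D \<longleftrightarrow>
     (\<forall>i k l. holo_on (\<lambda>x. conn D i x $ k $ l) (base D)) \<and>
     (\<forall>x\<in>base D. \<forall>i j.
        (\<chi> k l. pd i (\<lambda>y. conn D j y $ k $ l) x) - (\<chi> k l. pd j (\<lambda>y. conn D i y $ k $ l) x)
        + conn D i x ** conn D j x - conn D j x ** conn D i x = 0)"

definition flat_pairing :: "('n::finite, 'm::finite) vhf \<Rightarrow> bool" where
  "flat_pairing D \<longleftrightarrow>
     (\<forall>k l. holo_on (\<lambda>x. pair D x (axis k 1) (axis l 1)) (base D)) \<and>
     (\<forall>x\<in>base D.
        (\<forall>u. Vector_Spaces.linear (*s) (*) (pair D x u)) \<and>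
        (\<forall>u v. pair D x u v = - pair D x v u) \<and>
        (\<forall>u. (\<forall>v. pair D x u v = 0) \<longrightarrow> u = 0)) \<and>
     (\<forall>N s s' i. open N \<and> N \<subseteq> base D \<and> vholo_on s N \<and> vholo_on s' N \<longrightarrow>
        (\<forall>x\<in>N. pd i (\<lambda>y. pair D y (s y) (s' y)) x
               = pair D x (cov D i s x) (s' x) + pair D x (s x) (cov D i s' x)))"

definition holo_subbundle ::
  "(complex^'n::finite) set \<Rightarrow> (complex^'n \<Rightarrow> (complex^'m::finite) set) \<Rightarrow> bool" where
  "holo_subbundle X E \<longleftrightarrow>
     (\<forall>x\<in>X. \<exists>N r e. open N \<and> x \<in> N \<and> N \<subseteq> X \<and> (\<forall>j<r::nat. vholo_on (e j) N) \<and>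
        (\<forall>y\<in>N. inj_on (\<lambda>j. e j y) {..<r} \<and> vec.independent ((\<lambda>j. e j y) ` {..<r}) \<and>
                vec.span ((\<lambda>j. e j y) ` {..<r}) = E y))"

definition local_section ::
  "('n::finite, 'm::finite) vhf \<Rightarrow> (complex^'n \<Rightarrow> (complex^'m) set) \<Rightarrow> (complex^'n) set
     \<Rightarrow> (complex^'n \<Rightarrow> complex^'m) \<Rightarrow> bool" where
  "local_section D E N s \<longleftrightarrow> open N \<and> N \<subseteq> base D \<and> vholo_on s N \<and> (\<forall>x\<in>N. s x \<in> E x)"

definition flat_subbundle ::
  "('n::finite, 'm::finite) vhf \<Rightarrow> (complex^'n \<Rightarrow> (complex^'m) set) \<Rightarrow> bool" where
  "flat_subbundle D E \<longleftrightarrow> holo_subbundle (base D) E \<and>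
     (\<forall>N s i. local_section D E N s \<longrightarrow> (\<forall>x\<in>N. cov D i s x \<in> E x))"

definition flat_section ::
  "('n::finite, 'm::finite) vhf \<Rightarrow> (complex^'n \<Rightarrow> complex^'m) \<Rightarrow> bool" where
  "flat_section D s \<longleftrightarrow> vholo_on s (base D) \<and> (\<forall>x\<in>base D. \<forall>i. cov D i s x = 0)"

definition variation_hodge_like :: "('n::finite, 'm::finite) vhf \<Rightarrow> bool" where
  "variation_hodge_like D \<longleftrightarrow>
     open (base D) \<and> connected (base D) \<and> bpt D \<in> base D \<and>
     flat_connection D \<and> flat_pairing D \<and>
     (\<forall>p. holo_subbundle (base D) (fil D p)) \<and>
     (\<forall>p. \<forall>x\<in>base D. fil D (p + 1) x \<subseteq> fil D p x) \<and>
     (\<forall>p N s i. local_section D (fil D p) N s \<longrightarrow> (\<forall>x\<in>N. cov D i s x \<in> fil D (p - 1) x)) \<and>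
     (\<forall>p. \<forall>x\<in>base D. \<forall>u\<in>fil D p x. \<forall>v\<in>fil D (4 - p) x. pair D x u v = 0)"

text \<open>
  In the last clause, \<open>s\<close> is a local section of \<open>F\<^sup>3\<close> extending \<open>\<lambda> = s(0)\<close>; bijectivity of
  \<open>X \<mapsto> [\<nabla>\<^sub>X \<lambda>]\<close> onto \<open>F\<^sup>2\<^sub>0 / F\<^sup>3\<^sub>0\<close> is spelled out modulo \<open>F\<^sup>3\<^sub>0\<close>.
\<close>

definition CY_condition :: "('n::finite, 'm::finite) vhf \<Rightarrow> bool" where
  "CY_condition D \<longleftrightarrow>
     (\<forall>x\<in>base D. fil D 4 x = {0} \<and> fil D 0 x = UNIV \<and>
        vec.dim (fil D 3 x) = 1 \<and>
        vec.dim (fil D 2 x) = vec.dim (fil D 3 x) + CARD('n) \<and>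
        vec.dim (fil D 1 x) = vec.dim (fil D 2 x) + CARD('n) \<and>
        vec.dim (fil D 0 x) = vec.dim (fil D 1 x) + 1) \<and>
     (\<forall>N s. local_section D (fil D 3) N s \<and> bpt D \<in> N \<and> s (bpt D) \<noteq> 0 \<longrightarrow>
        (\<forall>X. (\<Sum>i\<in>UNIV. X $ i *s cov D i s (bpt D)) \<in> fil D 3 (bpt D) \<longrightarrow> X = 0) \<and>
        (\<forall>u\<in>fil D 2 (bpt D). \<exists>X. u - (\<Sum>i\<in>UNIV. X $ i *s cov D i s (bpt D)) \<in> fil D 3 (bpt D)))"


section \<open>Opposite filtrations and adapted bases\<close>

text \<open>\<open>d\<close> is the family of components of \<open>u\<close> with respect to \<open>\<V>\<^sub>x = \<Oplus>\<^sub>p F\<^sup>p \<inter> U\<^sub>p\<close>.\<close>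

definition splits ::
  "('n::finite, 'm::finite) vhf \<Rightarrow> (int \<Rightarrow> complex^'n \<Rightarrow> (complex^'m) set) \<Rightarrow> complex^'n
     \<Rightarrow> complex^'m \<Rightarrow> (int \<Rightarrow> complex^'m) \<Rightarrow> bool" where
  "splits D U x u d \<longleftrightarrow> (\<forall>p. d p \<in> fil D p x \<inter> U p x) \<and> finite {p. d p \<noteq> 0} \<and>
     u = (\<Sum>p | d p \<noteq> 0. d p)"

definition opposite_filtration ::
  "('n::finite, 'm::finite) vhf \<Rightarrow> (int \<Rightarrow> complex^'n \<Rightarrow> (complex^'m) set) \<Rightarrow> bool" where
  "opposite_filtration D U \<longleftrightarrow>
     (\<forall>p. flat_subbundle D (U p)) \<and>
     (\<forall>p. \<forall>x\<in>base D. U p x \<subseteq> U (p + 1) x) \<and>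
     (\<forall>x\<in>base D. \<forall>u. \<exists>!d. splits D U x u d) \<and>
     (\<forall>p. \<forall>x\<in>base D. \<forall>u\<in>U p x. \<forall>v\<in>U (2 - p) x. pair D x u v = 0)"

definition proj ::
  "('n::finite, 'm::finite) vhf \<Rightarrow> (int \<Rightarrow> complex^'n \<Rightarrow> (complex^'m) set) \<Rightarrow> int \<Rightarrow> complex^'n
     \<Rightarrow> complex^'m \<Rightarrow> complex^'m" where
  "proj D U p x u = (THE d. splits D U x u d) p"

text \<open>
  In \<open>\<nabla> = \<nabla>\<^sup>U + C\<^sup>U\<close> the part \<open>\<nabla>\<^sup>U\<close> preserves each \<open>F\<^sup>p \<inter> U\<^sub>p\<close> and \<open>C\<^sup>U\<close> lowers \<open>p\<close> by one, so
  \<open>\<nabla>\<^sup>U\<close> is the block diagonal part of \<open>\<nabla>\<close>.  Only \<open>p = 0, \<dots>, 3\<close> contribute because of the CY-condition.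
\<close>

definition covU ::
  "('n::finite, 'm::finite) vhf \<Rightarrow> (int \<Rightarrow> complex^'n \<Rightarrow> (complex^'m) set) \<Rightarrow> 'n
     \<Rightarrow> (complex^'n \<Rightarrow> complex^'m) \<Rightarrow> complex^'n \<Rightarrow> complex^'m" where
  "covU D U i s x = (\<Sum>p\<in>{0..3}. proj D U p x (cov D i (\<lambda>y. proj D U p y (s y)) x))"

text \<open>
  The index set \<open>{1, \<dots>, 2n + 2}\<close>: \<open>I1\<close> is \<open>1\<close>; \<open>Mid i\<close> runs through \<open>2, \<dots>, n + 1\<close>;
  \<open>Dual i\<close> is \<open>n + i\<close>, running through \<open>n + 2, \<dots>, 2n + 1\<close>; \<open>Last\<close> is \<open>2n + 2\<close>.
  The index set \<open>{1, \<dots>, n + 1}\<close> is \<open>'n option\<close>, with \<open>None\<close> for \<open>1\<close>.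
\<close>

datatype 'n idx = I1 | Mid 'n | Dual 'n | Last

instance idx :: (finite) finite
proof
  have "x \<in> insert I1 (insert Last (range Mid \<union> range Dual))" for x :: "'a idx"
    by (cases x) simp_all
  then have "(UNIV :: 'a idx set) \<subseteq> insert I1 (insert Last (range Mid \<union> range Dual))"
    by blast
  moreover have "finite (insert I1 (insert Last (range (Mid :: 'a \<Rightarrow> 'a idx) \<union> range Dual)))"
    by simp
  ultimately show "finite (UNIV :: 'a idx set)"
    by (rule finite_subset)
qed

definition adapted_basis ::
  "('n::finite, 'm::finite) vhf \<Rightarrow> (int \<Rightarrow> complex^'n \<Rightarrow> (complex^'m) set)
     \<Rightarrow> ('n idx \<Rightarrow> complex^'n \<Rightarrow> complex^'m) \<Rightarrow> bool" where
  "adapted_basis D U v \<longleftrightarrow>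
     (\<forall>\<alpha>. vholo_on (v \<alpha>) (base D)) \<and>
     (\<forall>x\<in>base D.
        inj (\<lambda>\<alpha>. v \<alpha> x) \<and> vec.independent (range (\<lambda>\<alpha>. v \<alpha> x)) \<and>
        vec.span (range (\<lambda>\<alpha>. v \<alpha> x)) = UNIV \<and>
        (\<forall>\<alpha> i. covU D U i (v \<alpha>) x = 0) \<and>
        v I1 x \<in> fil D 3 x \<and>
        (\<forall>k. v (Mid k) x \<in> fil D 2 x \<inter> U 2 x) \<and>
        (\<forall>k. v (Dual k) x \<in> fil D 1 x \<inter> U 1 x) \<and>
        v Last x \<in> U 0 x \<and>
        pair D x (v I1 x) (v Last x) = -1 \<and>
        (\<forall>k \<beta>. pair D x (v (Mid k) x) (v \<beta> x) = (if \<beta> = Dual k then 1 else 0)))"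

definition flat_extension ::
  "('n::finite, 'm::finite) vhf \<Rightarrow> ('n idx \<Rightarrow> complex^'n \<Rightarrow> complex^'m)
     \<Rightarrow> ('n idx \<Rightarrow> complex^'n \<Rightarrow> complex^'m) \<Rightarrow> bool" where
  "flat_extension D v v0 \<longleftrightarrow> (\<forall>\<alpha>. flat_section D (v0 \<alpha>) \<and> v0 \<alpha> (bpt D) = v \<alpha> (bpt D))"


section \<open>The Frobenius manifold\<close>

definition frobenius_data ::
  "('n::finite, 'm::finite) vhf \<Rightarrow> ('n idx \<Rightarrow> complex^'n \<Rightarrow> complex^'m)
     \<Rightarrow> ('n idx \<Rightarrow> complex^'n \<Rightarrow> complex^'m)
     \<Rightarrow> (complex^'n \<Rightarrow> complex^'n) \<Rightarrow> (complex^'n \<Rightarrow> complex) \<Rightarrow> bool" where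
  "frobenius_data D v v0 t \<Psi> \<longleftrightarrow>
     coordinates_on (base D) t \<and> holo_on \<Psi> (base D) \<and> \<Psi> (bpt D) = 0 \<and>
     (\<forall>x\<in>base D. v I1 x = v0 I1 x + (\<Sum>i\<in>UNIV. t x $ i *s v0 (Mid i) x)
        + (\<Sum>i\<in>UNIV. coord_deriv t (base D) i \<Psi> x *s v0 (Dual i) x)
        + ((\<Sum>k\<in>UNIV. t x $ k * coord_deriv t (base D) k \<Psi> x) - 2 * \<Psi> x) *s v0 Last x)"

text \<open>
  Points of \<open>M = \<complex> \<times> B\<^sub>0 \<times> \<complex>\<^bsup>n+1\<^esup>\<close> are triples \<open>(c, b, s)\<close>, where \<open>s $ Some i = t\<^bsub>n+i\<^esub>\<close> and
  \<open>s $ None = t\<^bsub>2n+2\<^esub>\<close>.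
\<close>

type_synonym 'n fpoint = "complex \<times> (complex^'n) \<times> (complex^('n option))"

definition frob_space :: "(complex^'n::finite) set \<Rightarrow> 'n fpoint set" where
  "frob_space X = UNIV \<times> X \<times> UNIV"

definition frob_coord :: "(complex^'n::finite \<Rightarrow> complex^'n) \<Rightarrow> 'n fpoint \<Rightarrow> complex^('n idx)" where
  "frob_coord t = (\<lambda>(c, b, s). \<chi> \<alpha>. case \<alpha> of I1 \<Rightarrow> c | Mid i \<Rightarrow> t b $ i
                                       | Dual i \<Rightarrow> s $ Some i | Last \<Rightarrow> s $ None)"

definition frob_potential ::
  "(complex^'n::finite \<Rightarrow> complex^'n) \<Rightarrow> (complex^'n \<Rightarrow> complex) \<Rightarrow> 'n fpoint \<Rightarrow> complex" where
  "frob_potential t \<Psi> = (\<lambda>(c, b, s). \<Psi> b + c\<^sup>2 * s $ None / 2 + c * (\<Sum>i\<in>UNIV. t b $ i * s $ Some i))"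

text \<open>
  Vector fields are given by their components in the flat frame \<open>\<partial>\<^sub>\<alpha>\<close>; flat fields have constant
  components.
\<close>

record ('p, 'k) frobenius =
  fpts   :: "'p set"
  fcoord :: "'p \<Rightarrow> complex^'k"
  fmet   :: "complex^'k \<Rightarrow> complex^'k \<Rightarrow> complex"
  fmult  :: "'p \<Rightarrow> complex^'k \<Rightarrow> complex^'k \<Rightarrow> complex^'k"
  funit  :: "complex^'k"
  feuler :: "'p \<Rightarrow> complex^'k"

definition flat_field ::
  "('p \<Rightarrow> complex^'k::finite) \<Rightarrow> 'p set \<Rightarrow> complex^'k \<Rightarrow> ('p \<Rightarrow> complex) \<Rightarrow> 'p \<Rightarrow> complex" where
  "flat_field \<phi> M X f p = (\<Sum>\<alpha>\<in>UNIV. X $ \<alpha> * coord_deriv \<phi> M \<alpha> f p)"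

definition frob_metric :: "complex^('n::finite idx) \<Rightarrow> complex^('n idx) \<Rightarrow> complex" where
  "frob_metric X Y = X $ I1 * Y $ Last + X $ Last * Y $ I1
     + (\<Sum>i\<in>UNIV. X $ Mid i * Y $ Dual i + X $ Dual i * Y $ Mid i)"

definition frobenius_manifold ::
  "(complex^'n::finite) set \<Rightarrow> (complex^'n \<Rightarrow> complex^'n) \<Rightarrow> ('n fpoint \<Rightarrow> complex)
     \<Rightarrow> ('n fpoint, 'n idx) frobenius" where
  "frobenius_manifold X t \<Phi> =
     (let M = frob_space X; \<tau> = frob_coord t in
      \<lparr> fpts = M, fcoord = \<tau>, fmet = frob_metric,
        fmult = (\<lambda>p Y Z. if p \<in> M
                   then (THE W. \<forall>V. frob_metric W V
                           = flat_field \<tau> M Y (flat_field \<tau> M Z (flat_field \<tau> M V \<Phi>)) p)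
                   else 0),
        funit = axis I1 1,
        feuler = (\<lambda>p. \<chi> \<alpha>. case \<alpha> of I1 \<Rightarrow> \<tau> p $ I1 | Mid i \<Rightarrow> 0
                                | Dual i \<Rightarrow> - \<tau> p $ Dual i | Last \<Rightarrow> - 2 * \<tau> p $ Last) \<rparr>)"

definition frobenius_potential_of ::
  "('p, 'k::finite) frobenius \<Rightarrow> ('p \<Rightarrow> complex) \<Rightarrow> bool" where
  "frobenius_potential_of R \<Phi> \<longleftrightarrow>
     holo_on (\<lambda>y. \<Phi> (inv_into (fpts R) (fcoord R) y)) (fcoord R ` fpts R) \<and>
     (\<forall>p\<in>fpts R. \<forall>X Y Z. fmet R (fmult R p X Y) Z
        = flat_field (fcoord R) (fpts R) X
            (flat_field (fcoord R) (fpts R) Y (flat_field (fcoord R) (fpts R) Z \<Phi>)) p)"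


section \<open>Projective special geometry on \<open>B\<close>\<close>

text \<open>\<open>B = F\<^sup>3\<close> without the zero section; the bundle projection \<open>B \<rightarrow> B\<^sub>0\<close> is \<open>snd\<close>.\<close>

definition coneB :: "('n::finite, 'm::finite) vhf \<Rightarrow> ((complex^'m) \<times> (complex^'n)) set" where
  "coneB D = {(\<delta>, b). b \<in> base D \<and> \<delta> \<in> fil D 3 b \<and> \<delta> \<noteq> 0}"

text \<open>\<open>f \<in> \<O>\<^sub>B\<close>, tested in the local trivialisations \<open>(y, c) \<mapsto> (c s(y), y)\<close> of \<open>B\<close>.\<close>

definition holo_on_B :: "('n::finite, 'm::finite) vhf \<Rightarrow> ((complex^'m) \<times> (complex^'n) \<Rightarrow> complex) \<Rightarrow> bool" where
  "holo_on_B D f \<longleftrightarrow>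
     (\<forall>N s. local_section D (fil D 3) N s \<and> (\<forall>y\<in>N. s y \<noteq> 0) \<longrightarrow>
        holo_on (\<lambda>x :: complex^('n option). f (x $ None *s s (\<chi> i. x $ Some i), \<chi> i. x $ Some i))
          {x. x $ None \<noteq> 0 \<and> (\<chi> i. x $ Some i) \<in> N})"

definition coordinates_on_B ::
  "('n::finite, 'm::finite) vhf \<Rightarrow> ((complex^'m) \<times> (complex^'n) \<Rightarrow> complex^('n option)) \<Rightarrow> bool" where
  "coordinates_on_B D z \<longleftrightarrow>
     (\<forall>i. holo_on_B D (\<lambda>p. z p $ i)) \<and> inj_on z (coneB D) \<and> open (z ` coneB D) \<and>
     vholo_on (\<lambda>y. fst (inv_into (coneB D) z y)) (z ` coneB D) \<and>
     vholo_on (\<lambda>y. snd (inv_into (coneB D) z y)) (z ` coneB D)"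

definition euler_B :: "((complex^'m::finite) \<times> (complex^'n::finite) \<Rightarrow> complex) \<Rightarrow> (complex^'m) \<times> (complex^'n) \<Rightarrow> complex"
  where "euler_B f p = deriv (\<lambda>c. f (c *s fst p, snd p)) 1"

definition opposite_subbundle ::
  "('n::finite, 'm::finite) vhf \<Rightarrow> (complex^'n \<Rightarrow> (complex^'m) set) \<Rightarrow> bool" where
  "opposite_subbundle D E \<longleftrightarrow> flat_subbundle D E \<and>
     (\<forall>x\<in>base D. vec.dim (E x) = CARD('n) + 1 \<and>
        (\<forall>u\<in>E x. \<forall>v\<in>E x. pair D x u v = 0) \<and>
        fil D 2 x \<inter> E x = {0} \<and> (\<forall>u. \<exists>f\<in>fil D 2 x. \<exists>w\<in>E x. u = f + w))"

definition flat_symplectic_basis ::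
  "('n::finite, 'm::finite) vhf \<Rightarrow> ('n option \<Rightarrow> complex^'n \<Rightarrow> complex^'m)
     \<Rightarrow> ('n option \<Rightarrow> complex^'n \<Rightarrow> complex^'m) \<Rightarrow> bool" where
  "flat_symplectic_basis D a b \<longleftrightarrow>
     (\<forall>i. flat_section D (a i)) \<and> (\<forall>i. flat_section D (b i)) \<and>
     (\<forall>x\<in>base D.
        inj (\<lambda>i. a i x) \<and> inj (\<lambda>i. b i x) \<and>
        range (\<lambda>i. a i x) \<inter> range (\<lambda>i. b i x) = {} \<and>
        vec.independent (range (\<lambda>i. a i x) \<union> range (\<lambda>i. b i x)) \<and>
        vec.span (range (\<lambda>i. a i x) \<union> range (\<lambda>i. b i x)) = UNIV \<and>
        (\<forall>i j. pair D x (a i x) (b j x) = (if i = j then 1 else 0) \<and>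
               pair D x (a i x) (a j x) = 0 \<and> pair D x (b i x) (b j x) = 0))"

definition taut_expansion ::
  "('n::finite, 'm::finite) vhf \<Rightarrow> ('n option \<Rightarrow> complex^'n \<Rightarrow> complex^'m)
     \<Rightarrow> ('n option \<Rightarrow> complex^'n \<Rightarrow> complex^'m)
     \<Rightarrow> ((complex^'m) \<times> (complex^'n) \<Rightarrow> complex^('n option))
     \<Rightarrow> ((complex^'m) \<times> (complex^'n) \<Rightarrow> complex^('n option)) \<Rightarrow> bool" where
  "taut_expansion D a b z w \<longleftrightarrow>
     (\<forall>p\<in>coneB D. fst p = (\<Sum>i\<in>UNIV. z p $ i *s a i (snd p)) + (\<Sum>i\<in>UNIV. w p $ i *s b i (snd p)))"

definition prepotential ::
  "('n::finite, 'm::finite) vhf \<Rightarrow> ((complex^'m) \<times> (complex^'n) \<Rightarrow> complex^('n option))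
     \<Rightarrow> ((complex^'m) \<times> (complex^'n) \<Rightarrow> complex^('n option))
     \<Rightarrow> ((complex^'m) \<times> (complex^'n) \<Rightarrow> complex) \<Rightarrow> bool" where
  "prepotential D z w P \<longleftrightarrow> holo_on_B D P \<and>
     (\<forall>p\<in>coneB D. (\<forall>i. coord_deriv z (coneB D) i P p = w p $ i) \<and> euler_B P p = 2 * P p)"

text \<open>
  A section \<open>s\<close> of \<open>F\<^sup>3\<close> is flat for the connection induced by \<open>F\<^sup>3 \<cong> \<V>/U\<^sub>2\<close> iff its class in
  \<open>\<V>/U\<^sub>2\<close> is flat, i.e. iff \<open>\<nabla>s\<close> has values in \<open>U\<^sub>2\<close>.
\<close>

definition PU2 ::
  "('n::finite, 'm::finite) vhf \<Rightarrow> (complex^'n \<Rightarrow> (complex^'m) set)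
     \<Rightarrow> (complex^'m) \<times> (complex^'n) \<Rightarrow> (complex^'m) \<times> (complex^'n)" where
  "PU2 D E p =
     (THE \<mu>. \<exists>s. local_section D (fil D 3) (base D) s \<and> (\<forall>x\<in>base D. \<forall>i. cov D i s x \<in> E x) \<and>
               s (snd p) = fst p \<and> s (bpt D) = \<mu>,
      snd p)"

text \<open>The \<open>\<nabla>\<close>-flat shift of \<open>\<delta> \<in> \<V>\<^sub>b\<close> to \<open>\<V>\<^sub>0\<close>.\<close>

definition flat_shift ::
  "('n::finite, 'm::finite) vhf \<Rightarrow> (complex^'m) \<times> (complex^'n) \<Rightarrow> complex^'m" where
  "flat_shift D p = (THE \<mu>. \<exists>s. flat_section D s \<and> s (snd p) = fst p \<and> s (bpt D) = \<mu>)"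


section \<open>Flat structures\<close>

text \<open>
  A flat structure on \<open>X\<close> is represented by its sheaf of flat (locally affine linear) functions, as
  the set of pairs of an open subset of \<open>X\<close> and such a function on it.  Here the structure is
  pulled back from a vector space along \<open>dev\<close>; \<open>L\<close> is the set of linear forms on that space.
\<close>

definition flat_structure ::
  "'p::topological_space set \<Rightarrow> ('p \<Rightarrow> 'v) \<Rightarrow> ('v \<Rightarrow> complex) set \<Rightarrow> ('p set \<times> ('p \<Rightarrow> complex)) set" where
  "flat_structure X dev L =
     {(W, f). openin (top_of_set X) W \<and>
        (\<forall>x\<in>W. \<exists>N. openin (top_of_set X) N \<and> x \<in> N \<and> N \<subseteq> W \<and>
            (\<exists>l\<in>L. \<exists>c. \<forall>y\<in>N. f y = c + l (dev y)))}"

definition flat_structure_coord ::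
  "(complex^'n::finite) set \<Rightarrow> (complex^'n \<Rightarrow> complex^'n) \<Rightarrow> ((complex^'n) set \<times> (complex^'n \<Rightarrow> complex)) set" where
  "flat_structure_coord X t = flat_structure X t {l. Vector_Spaces.linear (*s) (*) l}"

text \<open>
  \<open>\<nabla>\<^bsup>U\<^sub>1\<^esup>\<close>: linear forms on \<open>\<V>\<^sub>0/(U\<^sub>1)\<^sub>0\<close> are the linear forms on \<open>\<V>\<^sub>0\<close> which vanish on \<open>(U\<^sub>1)\<^sub>0\<close>.
\<close>

definition flat_structure_B ::
  "('n::finite, 'm::finite) vhf \<Rightarrow> (complex^'n \<Rightarrow> (complex^'m) set)
     \<Rightarrow> (((complex^'m) \<times> (complex^'n)) set \<times> ((complex^'m) \<times> (complex^'n) \<Rightarrow> complex)) set" where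
  "flat_structure_B D E = flat_structure (coneB D) (flat_shift D)
     {l. Vector_Spaces.linear (*s) (*) l \<and> (\<forall>u\<in>E (bpt D). l u = 0)}"

text \<open>The flat structure inherited along an embedding \<open>\<iota>\<close>: its flat functions are locally the pullbacks of flat functions.\<close>

definition inherited_flat_structure ::
  "'q::topological_space set \<Rightarrow> ('q \<Rightarrow> 'p) \<Rightarrow> ('p set \<times> ('p \<Rightarrow> complex)) set
     \<Rightarrow> ('q set \<times> ('q \<Rightarrow> complex)) set" where
  "inherited_flat_structure X \<iota> \<F> =
     {(W, f). openin (top_of_set X) W \<and>
        (\<forall>x\<in>W. \<exists>N. openin (top_of_set X) N \<and> x \<in> N \<and> N \<subseteq> W \<and>
            (\<exists>(W', g)\<in>\<F>. \<iota> ` N \<subseteq> W' \<and> (\<forall>y\<in>N. f y = g (\<iota> y))))}"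

text \<open>
  Holomorphic embeddings into \<open>\<complex>\<^sup>m \<times> \<complex>\<^sup>n\<close>, in which \<open>B\<close> is a locally closed complex submanifold.
\<close>

definition holo_embedding ::
  "(complex^'n::finite) set \<Rightarrow> (complex^'n \<Rightarrow> (complex^'m::finite) \<times> (complex^'n)) \<Rightarrow> bool" where
  "holo_embedding X \<iota> \<longleftrightarrow>
     vholo_on (\<lambda>x. fst (\<iota> x)) X \<and> vholo_on (\<lambda>x. snd (\<iota> x)) X \<and>
     (\<forall>x\<in>X. \<forall>h. (\<Sum>i\<in>UNIV. h $ i *s vpd i (\<lambda>y. fst (\<iota> y)) x) = 0 \<and>
                 (\<Sum>i\<in>UNIV. h $ i *s vpd i (\<lambda>y. snd (\<iota> y)) x) = 0 \<longrightarrow> h = 0) \<and>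
     (\<exists>\<kappa>. homeomorphism X (\<iota> ` X) \<iota> \<kappa>)"

definition hyperplane_z1 ::
  "('n::finite, 'm::finite) vhf \<Rightarrow> ((complex^'m) \<times> (complex^'n) \<Rightarrow> complex^('n option))
     \<Rightarrow> ((complex^'m) \<times> (complex^'n)) set" where
  "hyperplane_z1 D z = {p \<in> coneB D. z p $ None = 1}"

definition hyperplane_emb ::
  "('n::finite, 'm::finite) vhf \<Rightarrow> ((complex^'m) \<times> (complex^'n) \<Rightarrow> complex^('n option))
     \<Rightarrow> complex^'n \<Rightarrow> (complex^'m) \<times> (complex^'n)" where
  "hyperplane_emb D z b = (THE p. p \<in> hyperplane_z1 D z \<and> snd p = b)"

end

theory Submission
  imports Defs "HOL-Complex_Analysis.Cauchy_Integral_Formula"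
begin

text \<open>
  The proof is a computation in the flat frame \<open>v\<^sup>0\<close>.  The pairing of two flat sections is constant, so the
  Gram matrix of \<open>v\<^sup>0\<close> is everywhere that of the adapted basis at the base point, and it splits \<open>v\<^sup>0\<close> into
  two dual halves \<open>a\<close> and \<open>b\<close>.  With respect to such a frame (locale \<open>symplectic_frame\<close>) coefficients are
  pairings: this gives expansions, linear independence and holomorphic dependence of coefficients at once,
  and no parallel transport has to be constructed.

  That \<open>\<nabla>\<^sup>U\<close> annihilates the adapted basis leaves only \<open>C\<^sup>U\<close> in the derivatives of that basis: the last section is
  \<open>\<nabla>\<close>-flat, the derivatives of the sections in \<open>F\<^sup>1 \<inter> U\<^sub>1\<close> are multiples of the last one, and those of
  \<open>v\<^sub>1\<close> lie in \<open>U\<^sub>2\<close>.  Integrating the first two facts by means of the pairing shows that \<open>b\<close> spans \<open>U\<^sub>1\<close>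
  (\<open>span_fb\<close>).  The third says that \<open>v\<^sub>1\<close> is flat modulo \<open>U\<^sub>2\<close>, whence
  \<open>P\<^bsup>U\<^sub>2\<^esup>(c v\<^sub>1(x), x) = (c \<lambda>\<^sub>0, x)\<close> (\<open>PU2_eq\<close>).

  Since \<open>v\<^sub>1\<close> spans \<open>F\<^sup>3\<close>, the points of \<open>B\<close> are the \<open>(c v\<^sub>1(x), x)\<close> with \<open>c \<noteq> 0\<close>.  The formula that defines
  \<open>t\<close> and \<open>\<Psi>\<close> is an expansion of \<open>v\<^sub>1\<close> in \<open>a\<close> and \<open>b\<close>, so that on \<open>B\<close>
  \<open>z = c (1, t)\<close> and \<open>w = c (2 \<Psi> - \<Sum> t\<^sub>k \<partial>\<^sub>k\<Psi>, \<partial>\<Psi>)\<close> (\<open>zw_cone\<close>).  Thus \<open>z\<^sub>1 = 1\<close> is the graph of \<open>v\<^sub>1\<close>, on which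
  \<open>z\<close> restricts to \<open>t\<close>, and the flat structures agree.  The field \<open>\<epsilon>\<close> is the Euler field of the
  coordinates \<open>z\<close>, so a prepotential is \<open>(\<Sum> z\<^sub>i w\<^sub>i) / 2\<close>, and for \<open>c = 1\<close> this is \<open>\<Psi>\<close>
  (\<open>restricted_prepotential\<close>).

  The Frobenius manifold depends on its potential through third derivatives only, and these do not see
  polynomials of degree at most two.  The multiplication is well defined because third derivatives are linear
  in each direction, for which the partial derivatives of a holomorphic function have to be differentiable
  again (\<open>holo_on_pd\<close>), and because the metric is nondegenerate.  Adding a quadratic form to the
  prepotential amounts to changing each \<open>a\<^sub>i\<close> by a combination of the \<open>b\<^sub>j\<close>
  (\<open>prepotential_add_quadratic\<close>), and quadratic forms in \<open>z\<close> restrict on \<open>z\<^sub>1 = 1\<close> to precisely the polynomials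
  of degree at most two in \<open>t\<close>.
\<close>

section \<open>Holomorphic functions of several variables\<close>

lemma bounded_linear_smult_left: "bounded_linear (\<lambda>c::complex. c *s (v :: complex^'k))"
  by (intro linear_conv_bounded_linear[THEN iffD1] linearI) (vector algebra_simps)+

text \<open>A real differential that commutes with complex scalars is complex linear, hence given by its values on
  the unit vectors.  In this form the closure properties of holomorphic functions follow from those of
  differentiable ones.\<close>

lemma holo_onI:
  assumes "\<And>x. x \<in> S \<Longrightarrow> \<exists>L. (f has_derivative L) (at x) \<and> (\<forall>c h. L (c *s h) = c * L h)"
  shows "holo_on f S"
  unfolding holo_on_def
proof
  fix x assume "x \<in> S"
  then obtain L where L: "(f has_derivative L) (at x)" and hom: "\<And>c h. L (c *s h) = c * L h"
    using assms by blast
  interpret bounded_linear L by (rule has_derivative_bounded_linear[OF L])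
  have "L h = (\<Sum>i\<in>UNIV. L (axis i 1) * h $ i)" for h
  proof -
    have "L h = L (\<Sum>i\<in>UNIV. h $ i *s axis i 1)" by (simp add: basis_expansion)
    also have "\<dots> = (\<Sum>i\<in>UNIV. L (axis i 1) * h $ i)" by (simp add: sum hom mult.commute)
    finally show ?thesis .
  qed
  then have "L = (\<lambda>h. \<Sum>i\<in>UNIV. L (axis i 1) * h $ i)" by blast
  with L show "\<exists>a. (f has_derivative (\<lambda>h. \<Sum>i\<in>UNIV. a i * h $ i)) (at x)"
    by (intro exI[of _ "\<lambda>i. L (axis i 1)"]) simp
qed

lemma holo_onE:
  assumes "holo_on f S" "x \<in> S"
  obtains L where "(f has_derivative L) (at x)" "\<And>c h. L (c *s h) = c * L h"
proof -
  obtain a where "(f has_derivative (\<lambda>h. \<Sum>i\<in>UNIV. a i * h $ i)) (at x)"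
    using assms unfolding holo_on_def by blast
  then show thesis by (rule that) (simp add: sum_distrib_left mult_ac)
qed

lemma pd_slice:
  fixes f :: "complex^'k::finite \<Rightarrow> complex"
  assumes "(f has_derivative (\<lambda>h. \<Sum>i\<in>UNIV. a i * h $ i)) (at (x + c0 *s axis i 1))"
  shows "((\<lambda>c. f (x + c *s axis i 1)) has_field_derivative a i) (at c0)"
proof -
  have "((\<lambda>c. x + c *s axis i 1) has_derivative (\<lambda>c. c *s axis i 1)) (at c0)"
    by (rule has_derivative_eq_rhs, rule has_derivative_add, rule has_derivative_const,
        rule bounded_linear.has_derivative[OF bounded_linear_smult_left], rule has_derivative_ident) simp
  from diff_chain_at[OF this assms] show ?thesis
    unfolding has_field_derivative_def
    by (auto simp: o_def axis_def if_distrib[of "\<lambda>x. _ * x"] cong: if_cong)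
qed

lemma pd_eqI:
  assumes "(f has_derivative (\<lambda>h. \<Sum>i\<in>UNIV. a i * h $ i)) (at x)"
  shows "pd i f x = a i"
  unfolding pd_def by (rule DERIV_imp_deriv, rule pd_slice) (simp add: assms)

lemma holo_on_has_derivative:
  assumes "holo_on f S" "x \<in> S"
  shows "(f has_derivative (\<lambda>h. \<Sum>i\<in>UNIV. pd i f x * h $ i)) (at x)"
proof -
  obtain a where a: "(f has_derivative (\<lambda>h. \<Sum>i\<in>UNIV. a i * h $ i)) (at x)"
    using assms unfolding holo_on_def by blast
  show ?thesis using a pd_eqI[OF a] by simp
qed

lemma pd_derivative_axis:
  assumes "(f has_derivative L) (at x)" "\<And>c h. L (c *s h) = c * L h"
  shows "pd i f x = L (axis i 1)"
proof -
  have "holo_on f {x}" by (rule holo_onI) (use assms in auto)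
  from holo_on_has_derivative[OF this, of x] assms(1)
  have "L = (\<lambda>h. \<Sum>i\<in>UNIV. pd i f x * h $ i)" by (intro has_derivative_unique[of f _ x]) auto
  then show ?thesis by (simp add: axis_def if_distrib[of "\<lambda>x. _ * x"] cong: if_cong)
qed

lemma holo_on_slice:
  assumes "holo_on f S" "x + c *s axis i 1 \<in> S"
  shows "((\<lambda>c. f (x + c *s axis i 1)) has_field_derivative pd i f (x + c *s axis i 1)) (at c)"
  by (rule pd_slice[OF holo_on_has_derivative[OF assms]])

lemma holo_on_continuous: "holo_on f S \<Longrightarrow> continuous_on S f"
  by (blast intro: continuous_at_imp_continuous_on has_derivative_continuous holo_on_has_derivative)

lemma holo_on_subset: "holo_on f S \<Longrightarrow> T \<subseteq> S \<Longrightarrow> holo_on f T"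
  by (auto simp: holo_on_def)

lemma holo_on_cong:
  assumes "holo_on f S" "open S" "\<And>x. x \<in> S \<Longrightarrow> f x = g x"
  shows "holo_on g S"
  using assms has_derivative_transform_within_open[of f _ _ UNIV S g]
  unfolding holo_on_def by blast

lemma pd_cong:
  assumes "open S" "x \<in> S" "\<And>y. y \<in> S \<Longrightarrow> f y = g y"
  shows "pd i f x = pd i g x"
  unfolding pd_def
proof (rule deriv_cong_ev[OF _ refl])
  let ?g = "\<lambda>c. x + c *s axis i 1"
  have "isCont ?g 0"
    by (intro continuous_intros bounded_linear.continuous[OF bounded_linear_smult_left])
  then have "(?g \<longlongrightarrow> ?g 0) (nhds 0)"
    unfolding isCont_def by (subst (asm) tendsto_at_iff_tendsto_nhds)
  then have "(?g \<longlongrightarrow> x) (nhds 0)" by simp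
  from topological_tendstoD[OF this assms(1,2)]
  show "\<forall>\<^sub>F c in nhds 0. f (x + c *s axis i 1) = g (x + c *s axis i 1)"
    by eventually_elim (use assms(3) in auto)
qed

lemma vpd_cong:
  assumes "open S" "x \<in> S" "\<And>y. y \<in> S \<Longrightarrow> f y = g y"
  shows "vpd i f x = vpd i g x"
  unfolding vpd_def using assms(3) by (auto intro!: pd_cong[OF assms(1,2)] simp: vec_eq_iff)

lemma holo_on_const: "holo_on (\<lambda>x. c) S"
  by (rule holo_onI) (use has_derivative_const in fastforce)

lemma holo_on_nth: "holo_on (\<lambda>x. x $ i) S"
  by (rule holo_onI, rule exI[of _ "\<lambda>h. h $ i"])
    (auto intro!: bounded_linear.has_derivative[OF bounded_linear_vec_nth])

lemma holo_on_add:
  assumes "holo_on f S" "holo_on g S" shows "holo_on (\<lambda>x. f x + g x) S"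
proof (rule holo_onI)
  fix x assume x: "x \<in> S"
  obtain L where L: "(f has_derivative L) (at x)" "\<And>c h. L (c *s h) = c * L h"
    using holo_onE[OF assms(1) x] by blast
  obtain M where M: "(g has_derivative M) (at x)" "\<And>c h. M (c *s h) = c * M h"
    using holo_onE[OF assms(2) x] by blast
  show "\<exists>L. ((\<lambda>x. f x + g x) has_derivative L) (at x) \<and> (\<forall>c h. L (c *s h) = c * L h)"
    using has_derivative_add[OF L(1) M(1)] by (intro exI[of _ "\<lambda>h. L h + M h"]) (simp add: L M distrib_left)
qed

lemma holo_on_mult:
  assumes "holo_on f S" "holo_on g S" shows "holo_on (\<lambda>x. f x * g x) S"
proof (rule holo_onI)
  fix x assume x: "x \<in> S"
  obtain L where L: "(f has_derivative L) (at x)" "\<And>c h. L (c *s h) = c * L h"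
    using holo_onE[OF assms(1) x] by blast
  obtain M where M: "(g has_derivative M) (at x)" "\<And>c h. M (c *s h) = c * M h"
    using holo_onE[OF assms(2) x] by blast
  show "\<exists>L. ((\<lambda>x. f x * g x) has_derivative L) (at x) \<and> (\<forall>c h. L (c *s h) = c * L h)"
    using has_derivative_mult[OF L(1) M(1)]
    by (intro exI[of _ "\<lambda>h. f x * M h + L h * g x"]) (simp add: L M algebra_simps)
qed

lemma holo_on_compose_field:
  assumes f: "holo_on f S" and g: "\<And>x. x \<in> S \<Longrightarrow> \<exists>d. (g has_field_derivative d) (at (f x))"
  shows "holo_on (\<lambda>x. g (f x)) S"
proof (rule holo_onI)
  fix x assume x: "x \<in> S"
  obtain L where L: "(f has_derivative L) (at x)" "\<And>c h. L (c *s h) = c * L h"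
    using holo_onE[OF f x] by blast
  obtain d where "(g has_field_derivative d) (at (f x))" using g x by blast
  from diff_chain_at[OF L(1) this[unfolded has_field_derivative_def]]
  show "\<exists>L. ((\<lambda>x. g (f x)) has_derivative L) (at x) \<and> (\<forall>c h. L (c *s h) = c * L h)"
    by (intro exI[of _ "\<lambda>h. d * L h"]) (simp add: L o_def algebra_simps)
qed

lemma holo_on_minus: "holo_on f S \<Longrightarrow> holo_on (\<lambda>x. - f x) S"
  using holo_on_mult[OF holo_on_const[of "-1"]] by simp

lemma holo_on_diff: "holo_on f S \<Longrightarrow> holo_on g S \<Longrightarrow> holo_on (\<lambda>x. f x - g x) S"
  using holo_on_add[OF _ holo_on_minus] by simp

lemma holo_on_divide:
  assumes "holo_on f S" "holo_on g S" "\<And>x. x \<in> S \<Longrightarrow> g x \<noteq> 0"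
  shows "holo_on (\<lambda>x. f x / g x) S"
proof -
  have "holo_on (\<lambda>x. inverse (g x)) S"
    by (rule holo_on_compose_field[OF assms(2)]) (use assms(3) DERIV_inverse in blast)
  from holo_on_mult[OF assms(1) this] show ?thesis by (simp add: divide_inverse)
qed

lemma holo_on_sum:
  assumes "\<And>i. i \<in> I \<Longrightarrow> holo_on (f i) S" shows "holo_on (\<lambda>x. \<Sum>i\<in>I. f i x) S"
  using assms by (induction I rule: infinite_finite_induct) (auto intro: holo_on_const holo_on_add)

lemma holo_on_power: "holo_on f S \<Longrightarrow> holo_on (\<lambda>x. f x ^ n) S"
  by (induction n) (auto intro: holo_on_const holo_on_mult)

lemmas holo_intros = holo_on_const holo_on_nth holo_on_add holo_on_mult holo_on_minus
  holo_on_diff holo_on_sum holo_on_power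

lemma vholo_onD: "vholo_on f S \<Longrightarrow> holo_on (\<lambda>x. f x $ j) S"
  by (simp add: vholo_on_def)

lemma vholo_on_subset: "vholo_on f S \<Longrightarrow> T \<subseteq> S \<Longrightarrow> vholo_on f T"
  by (auto simp: vholo_on_def intro: holo_on_subset)

lemma vholo_on_has_derivative:
  fixes f :: "complex^'k::finite \<Rightarrow> complex^'l::finite"
  assumes "vholo_on f S" "x \<in> S"
  shows "(f has_derivative (\<lambda>h. \<Sum>i\<in>UNIV. h $ i *s vpd i f x)) (at x)"
proof -
  have *: "((\<lambda>x. f x $ j) has_derivative (\<lambda>h. (\<Sum>i\<in>UNIV. h $ i *s vpd i f x) $ j)) (at x)" for j
    using holo_on_has_derivative[OF vholo_onD[OF assms(1), of j] assms(2)]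
    by (simp add: vpd_def mult.commute)
  have "(f has_derivative (\<lambda>h. \<chi> j. (\<Sum>i\<in>UNIV. h $ i *s vpd i f x) $ j)) (at x)"
  proof (subst has_derivative_componentwise_within, intro ballI)
    fix b :: "complex^'l" assume "b \<in> Basis"
    then obtain j u where b: "b = axis j u" "u \<in> Basis" by (auto simp: Basis_vec_def)
    show "((\<lambda>x. f x \<bullet> b) has_derivative (\<lambda>h. (\<chi> j. (\<Sum>i\<in>UNIV. h $ i *s vpd i f x) $ j) \<bullet> b)) (at x)"
      unfolding b inner_axis vec_lambda_beta
      by (rule bounded_linear.has_derivative[OF bounded_linear_inner_left *])
  qed
  then show ?thesis by (simp only: vec_lambda_eta)
qed

lemma vholo_on_continuous: "vholo_on f S \<Longrightarrow> continuous_on S f"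
  by (blast intro: continuous_at_imp_continuous_on has_derivative_continuous vholo_on_has_derivative)

text \<open>The chain rule together with the complex homogeneity that \<open>holo_onI\<close> asks for.\<close>

lemma holo_chain:
  assumes f: "holo_on f T" and g: "vholo_on g S" and x: "x \<in> S" and gx: "g x \<in> T"
  defines "L \<equiv> \<lambda>h. \<Sum>j\<in>UNIV. pd j f (g x) * (\<Sum>i\<in>UNIV. h $ i *s vpd i g x) $ j"
  shows "((\<lambda>x. f (g x)) has_derivative L) (at x)" and "L (c *s h) = c * L h"
proof -
  show "((\<lambda>x. f (g x)) has_derivative L) (at x)"
    using diff_chain_at[OF vholo_on_has_derivative[OF g x] holo_on_has_derivative[OF f gx]]
    unfolding L_def o_def .
  have "(\<Sum>i\<in>UNIV. (c *s h) $ i *s vpd i g x) = c *s (\<Sum>i\<in>UNIV. h $ i *s vpd i g x)"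
    by (simp only: vec.scale_sum_right vector_smult_component vec.scale_scale)
  then show "L (c *s h) = c * L h"
    by (simp only: L_def vector_smult_component[of c "\<Sum>i\<in>UNIV. h $ i *s vpd i g x"]
        sum_distrib_left mult.left_commute[of _ c])
qed

lemma holo_on_compose:
  assumes "holo_on f T" "vholo_on g S" "g ` S \<subseteq> T"
  shows "holo_on (\<lambda>x. f (g x)) S"
proof (rule holo_onI)
  fix x assume "x \<in> S"
  then have "g x \<in> T" using assms(3) by blast
  from holo_chain[OF assms(1,2) \<open>x \<in> S\<close> this]
  show "\<exists>L. ((\<lambda>x. f (g x)) has_derivative L) (at x) \<and> (\<forall>c h. L (c *s h) = c * L h)"
    by (intro exI conjI allI)
qed

lemma vholo_on_compose:
  assumes "vholo_on f T" "vholo_on g S" "g ` S \<subseteq> T" shows "vholo_on (\<lambda>x. f (g x)) S"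
  unfolding vholo_on_def
proof
  fix j show "holo_on (\<lambda>x. f (g x) $ j) S"
    using holo_on_compose[OF vholo_onD[OF assms(1), of j] assms(2,3)] .
qed

lemma pd_const [simp]: "pd i (\<lambda>x. c) x = 0"
  by (simp add: pd_def)

lemma pd_nth [simp]: "pd i (\<lambda>x. x $ j) x = (if i = j then 1 else 0)"
  by (subst pd_derivative_axis[where L="\<lambda>h. h $ j"])
    (auto intro!: bounded_linear.has_derivative[OF bounded_linear_vec_nth] simp: axis_def)

lemma pd_add:
  assumes "holo_on f S" "holo_on g S" "x \<in> S"
  shows "pd i (\<lambda>x. f x + g x) x = pd i f x + pd i g x"
proof (rule pd_eqI)
  show "((\<lambda>x. f x + g x) has_derivative (\<lambda>h. \<Sum>i\<in>UNIV. (pd i f x + pd i g x) * h $ i)) (at x)"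
    unfolding distrib_right sum.distrib
    by (intro has_derivative_add holo_on_has_derivative[OF assms(1,3)] holo_on_has_derivative[OF assms(2,3)])
qed

lemma pd_mult:
  assumes "holo_on f S" "holo_on g S" "x \<in> S"
  shows "pd i (\<lambda>x. f x * g x) x = pd i f x * g x + f x * pd i g x"
proof (rule pd_eqI)
  have eq: "(\<Sum>i\<in>UNIV. (pd i f x * g x + f x * pd i g x) * h $ i)
      = f x * (\<Sum>i\<in>UNIV. pd i g x * h $ i) + (\<Sum>i\<in>UNIV. pd i f x * h $ i) * g x" for h
    unfolding sum_distrib_left sum_distrib_right sum.distrib[symmetric]
    by (intro sum.cong refl) (simp add: algebra_simps)
  show "((\<lambda>x. f x * g x) has_derivative (\<lambda>h. \<Sum>i\<in>UNIV. (pd i f x * g x + f x * pd i g x) * h $ i)) (at x)"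
    unfolding eq
    by (intro has_derivative_mult holo_on_has_derivative[OF assms(1,3)] holo_on_has_derivative[OF assms(2,3)])
qed

lemma pd_cmult: "holo_on f S \<Longrightarrow> x \<in> S \<Longrightarrow> pd i (\<lambda>x. c * f x) x = c * pd i f x"
  using pd_mult[OF holo_on_const, of f S x i c] by simp

lemma pd_sum:
  assumes "\<And>k. k \<in> I \<Longrightarrow> holo_on (f k) S" "x \<in> S"
  shows "pd i (\<lambda>x. \<Sum>k\<in>I. f k x) x = (\<Sum>k\<in>I. pd i (f k) x)"
  using assms(1)
proof (induction I rule: infinite_finite_induct)
  case (insert k I)
  then show ?case by (simp add: pd_add[where S=S] holo_on_sum assms(2))
qed auto

lemma holo_on_pd_zero_imp_const:
  assumes "open S" "connected S" "holo_on f S" "\<And>x i. x \<in> S \<Longrightarrow> pd i f x = 0" "x \<in> S" "y \<in> S"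
  shows "f x = f y"
  by (rule has_derivative_zero_unique_connected[OF assms(1,2) _ assms(5,6)])
    (use holo_on_has_derivative[OF assms(3)] assms(4) in simp)

lemma norm_smult_axis [simp]: "norm (c *s axis i (1::complex)) = norm c"
  by (simp add: axis_def norm_vec_def L2_set_def power_mult_distrib if_distrib[of norm]
      if_distrib[of "\<lambda>x. x\<^sup>2"] if_distrib[of "\<lambda>x. c * x"] vector_scalar_mult_def cong: if_cong)

lemma add_smult_axis_in_cball:
  assumes "y \<in> cball x r" "norm c \<le> s"
  shows "y + c *s axis i (1::complex) \<in> cball x (r + s)"
  using assms norm_triangle_ineq[of "y - x" "c *s axis i 1"]
  by (simp add: dist_norm norm_minus_commute[of x] algebra_simps)

lemma holo_slice_holomorphic:
  assumes "holo_on f S" "\<And>c. c \<in> A \<Longrightarrow> y + c *s axis i 1 \<in> S"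
  shows "(\<lambda>c. f (y + c *s axis i 1)) holomorphic_on A"
  unfolding holomorphic_on_def field_differentiable_def
  using holo_on_slice[OF assms(1)] assms(2) has_field_derivative_at_within by blast

text \<open>Cauchy's estimate in one variable bounds the variation of a partial derivative by the variation
  of the function on a compact set, where the function is uniformly continuous.\<close>

lemma pd_continuous:
  assumes f: "holo_on f S" and S: "open S"
  shows "continuous_on S (pd i f)"
proof (rule continuous_at_imp_continuous_on, rule ballI)
  fix x assume "x \<in> S"
  then obtain R0 where "R0 > 0" "cball x R0 \<subseteq> S"
    using S open_contains_cball by blast
  define R where "R = R0 / 2"
  have R: "R > 0" "cball x (R + R) \<subseteq> S" using \<open>R0 > 0\<close> \<open>cball x R0 \<subseteq> S\<close> by (auto simp: R_def)
  have unif: "uniformly_continuous_on (cball x (R + R)) f"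
    using holo_on_continuous[OF f] R(2) by (intro compact_uniformly_continuous) (auto intro: continuous_on_subset)
  show "isCont (pd i f) x"
    unfolding continuous_at_eps_delta
  proof (intro allI impI)
    fix e :: real assume "e > 0"
    then have "e / 2 * R > 0" using R by simp
    with unif obtain d where d: "d > 0"
      "\<And>u v. u \<in> cball x (R + R) \<Longrightarrow> v \<in> cball x (R + R) \<Longrightarrow> dist v u < d \<Longrightarrow> dist (f v) (f u) < e / 2 * R"
      unfolding uniformly_continuous_on_def by metis
    show "\<exists>d>0. \<forall>y. dist y x < d \<longrightarrow> dist (pd i f y) (pd i f x) < e"
    proof (intro exI[of _ "min d R"] conjI allI impI)
      show "min d R > 0" using d R by simp
      fix y assume y: "dist y x < min d R"
      have in_ball: "u + c *s axis i 1 \<in> cball x (R + R)" if "u \<in> {x, y}" "norm c \<le> R" for u c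
        using that y R by (intro add_smult_axis_in_cball) (auto simp: dist_commute)
      let ?g = "\<lambda>c. f (y + c *s axis i 1) - f (x + c *s axis i 1)"
      have holo: "?g holomorphic_on cball 0 R"
        using in_ball R(2) by (intro holomorphic_intros holo_slice_holomorphic[OF f]) (auto simp: subset_iff)
      have "norm ((deriv ^^ 1) ?g 0) \<le> fact 1 * (e / 2 * R) / R ^ 1"
      proof (rule Cauchy_inequality)
        show "?g holomorphic_on ball 0 R" using holo holomorphic_on_subset ball_subset_cball by blast
        show "continuous_on (cball 0 R) ?g" using holo by (rule holomorphic_on_imp_continuous_on)
        show "R > 0" by fact
        fix c :: complex assume "norm (0 - c) = R"
        then have "dist (f (y + c *s axis i 1)) (f (x + c *s axis i 1)) < e / 2 * R"
          using y by (intro d in_ball) auto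
        then show "norm (?g c) \<le> e / 2 * R" by (simp add: dist_norm)
      qed
      moreover have "deriv ?g 0 = pd i f y - pd i f x"
        using in_ball[of y 0] in_ball[of x 0] R
          holo_on_slice[OF f, of y 0 i] holo_on_slice[OF f, of x 0 i]
        by (intro DERIV_imp_deriv derivative_intros) (auto simp: subset_iff)
      ultimately show "dist (pd i f y) (pd i f x) < e"
        using R \<open>e > 0\<close> by (simp add: dist_norm)
    qed
  qed
qed

text \<open>The one-variable Cauchy formula on the circle of radius \<open>r\<close> around \<open>y\<close> in direction \<open>i\<close>, written as an
  integral over the fixed interval \<open>[0, 1]\<close>, so that \<open>y\<close> may be varied under the integral sign.\<close>

lemma pd_Cauchy_formula:
  assumes f: "holo_on f S" and "r > 0" and sub: "\<And>c. norm c \<le> r \<Longrightarrow> y + c *s axis i 1 \<in> S"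
  defines "E \<equiv> \<lambda>t::real. of_real r * exp (2 * of_real pi * \<i> * of_real t)"
  shows "((\<lambda>t. f (y + E t *s axis i 1) * inverse (E t)) has_integral pd i f y) {0..1}"
proof -
  let ?g = "\<lambda>c. f (y + c *s axis i 1)"
  have cp: "circlepath 0 r t = E t" for t
    by (simp add: circlepath E_def)
  have vd: "vector_derivative (circlepath 0 r) (at t) = 2 * pi * \<i> * E t" for t
    by (simp add: vector_derivative_circlepath E_def)
  have holo: "?g holomorphic_on cball 0 r"
    by (rule holo_slice_holomorphic[OF f]) (use sub in auto)
  have "((\<lambda>u. ?g u / (u - 0) ^ Suc 1) has_contour_integral (2 * pi * \<i>) / fact 1 * (deriv ^^ 1) ?g 0) (circlepath 0 r)"
    using holo holomorphic_on_subset[OF holo ball_subset_cball] \<open>r > 0\<close>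
    by (intro Cauchy_has_contour_integral_higher_derivative_circlepath holomorphic_on_imp_continuous_on) auto
  then have "((\<lambda>t. ?g (E t) / (E t)\<^sup>2 * (2 * pi * \<i> * E t)) has_integral (2 * pi * \<i>) * pd i f y) {0..1}"
    unfolding has_contour_integral vd cp by (simp add: pd_def power2_eq_square)
  from has_integral_mult_right[OF this, of "1 / (2 * pi * \<i>)"] show ?thesis
    using \<open>r > 0\<close> by (simp add: E_def field_simps power2_eq_square)
qed

text \<open>A partial derivative is a Cauchy integral of the function over a circle.  Since the integrand
  depends holomorphically on the centre, with continuous derivatives, one may differentiate under the integral.\<close>

theorem holo_on_pd:
  assumes f: "holo_on f S" and S: "open S"
  shows "holo_on (pd i f) S"
proof (rule holo_onI)
  fix x assume "x \<in> S"
  then obtain R0 where "R0 > 0" "cball x R0 \<subseteq> S"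
    using S open_contains_cball by blast
  \<comment> \<open>half the radius, so that circles of radius \<open>r\<close> around points of the ball stay inside \<open>S\<close>\<close>
  define r where "r = R0 / 2"
  have r: "r > 0" "cball x (r + r) \<subseteq> S" using \<open>R0 > 0\<close> \<open>cball x R0 \<subseteq> S\<close> by (auto simp: r_def)
  define E where "E = (\<lambda>t::real. of_real r * exp (2 * of_real pi * \<i> * of_real t))"
  have E: "norm (E t) = r" "E t \<noteq> 0" for t
    using r by (auto simp: E_def norm_mult)
  have contE: "continuous_on A E" for A unfolding E_def by (intro continuous_intros)
  let ?e = "axis i 1"
  let ?U = "ball x r"
  have in_S: "y + c *s ?e \<in> S" if "y \<in> ?U" "norm c \<le> r" for y c
    using add_smult_axis_in_cball[of y x r c r i] that r by (auto simp: subset_iff)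
  define fx :: "complex^'a \<Rightarrow> real \<Rightarrow> (complex^'a) \<Rightarrow>\<^sub>L complex" where
    "fx = (\<lambda>y t. \<Sum>j\<in>UNIV. blinfun_mult_right (inverse (E t) * pd j f (y + E t *s ?e)) o\<^sub>L Blinfun (\<lambda>h. h $ j))"
  have fx: "blinfun_apply (fx y t) h = (\<Sum>j\<in>UNIV. pd j f (y + E t *s ?e) * h $ j) * inverse (E t)" for y t h
    by (simp add: fx_def blinfun.sum_left bounded_linear_Blinfun_apply bounded_linear_vec_nth
        sum_distrib_right sum_distrib_left mult_ac blinfun_mult_right.rep_eq)
  have cont_line: "continuous_on (?U \<times> cbox 0 1) (\<lambda>p. fst p + E (snd p) *s ?e)"
    by (intro continuous_intros bounded_linear.continuous_on[OF bounded_linear_smult_left]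
        continuous_on_compose2[OF contE[of UNIV]]) auto
  have "continuous_on (?U \<times> cbox 0 1) (\<lambda>p. fx (fst p) (snd p))"
    unfolding fx_def using in_S E
    by (intro continuous_intros bounded_linear.continuous_on[OF bounded_linear_blinfun_mult_right]
        continuous_on_compose2[OF contE[of UNIV]] continuous_on_compose2[OF pd_continuous[OF f S] cont_line]) auto
  then have cont_fx: "continuous_on (?U \<times> cbox 0 1) (\<lambda>(y, t). fx y t)"
    by (simp add: case_prod_unfold)
  let ?F = "\<lambda>y t. f (y + E t *s ?e) * inverse (E t)"
  have der: "((\<lambda>y. ?F y t) has_derivative blinfun_apply (fx y t)) (at y within ?U)" if "y \<in> ?U" for y t
  proof -
    have "y + E t *s ?e \<in> S" using that E by (intro in_S) auto
    then have "((\<lambda>y. f (y + E t *s ?e)) has_derivative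
        (\<lambda>h. \<Sum>j\<in>UNIV. pd j f (y + E t *s ?e) * h $ j)) (at y)"
      using diff_chain_at[OF has_derivative_add[OF has_derivative_ident has_derivative_const]
          holo_on_has_derivative[OF f], of y "E t *s ?e"]
      by (simp add: o_def)
    note D = has_derivative_at_withinI[OF has_derivative_mult_left[OF this, of "inverse (E t)"]]
    have "blinfun_apply (fx y t)
        = (\<lambda>h. (\<Sum>j\<in>UNIV. pd j f (y + E t *s ?e) * h $ j) * inverse (E t))"
      by (rule ext) (rule fx)
    then show ?thesis by (simp only: D)
  qed
  have has_int: "(?F y has_integral pd i f y) (cbox 0 1)" if "y \<in> ?U" for y
    using pd_Cauchy_formula[OF f r(1) in_S[OF that]] unfolding E_def box_real .
  note int = integral_unique[OF has_int] has_integral_integrable[OF has_int]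
  have x: "x \<in> ?U" using r by simp
  have "((\<lambda>y. integral (cbox 0 1) (?F y)) has_derivative integral (cbox 0 1) (fx x)) (at x within ?U)"
    by (rule leibniz_rule[OF der int(2) cont_fx x convex_ball])
  then have "((\<lambda>y. integral (cbox 0 1) (?F y)) has_derivative integral (cbox 0 1) (fx x)) (at x)"
    unfolding at_within_open[OF x open_ball] .
  then have D: "(pd i f has_derivative integral (cbox 0 1) (fx x)) (at x)"
    by (rule has_derivative_transform_within_open[OF _ open_ball x int(1)])
  have "continuous_on (cbox 0 1) (fx x)"
    using continuous_on_compose2[OF cont_fx, of "cbox 0 1" "\<lambda>t. (x, t)"] x
    by (simp add: continuous_on_Pair continuous_on_const continuous_on_id image_subset_iff)
  then have "fx x integrable_on cbox 0 1" by (rule integrable_continuous)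
  then have I: "blinfun_apply (integral (cbox 0 1) (fx x)) h = integral (cbox 0 1) (\<lambda>t. fx x t h)" for h
    by (rule blinfun_apply_integral)
  have "blinfun_apply (integral (cbox 0 1) (fx x)) (c *s h) = c * blinfun_apply (integral (cbox 0 1) (fx x)) h" for c h
    unfolding I by (simp add: fx sum_distrib_left[symmetric] mult.left_commute[of _ c] mult.assoc)
  with D show "\<exists>L. (pd i f has_derivative L) (at x) \<and> (\<forall>c h. L (c *s h) = c * L h)" by blast
qed

lemma sum_option: "(\<Sum>i\<in>UNIV. f i) = f None + (\<Sum>i\<in>UNIV. f (Some i))" for f :: "'n::finite option \<Rightarrow> 'a::comm_monoid_add"
  by (simp add: UNIV_option_conv sum.reindex)

lemma UNIV_idx: "UNIV = insert I1 (insert Last (range Mid \<union> range Dual))"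
proof -
  have "x \<in> insert I1 (insert Last (range Mid \<union> range Dual))" for x :: "'a idx"
    by (cases x) auto
  then show ?thesis by blast
qed

lemma sum_idx: "(\<Sum>\<alpha>\<in>UNIV. f \<alpha>) = f I1 + (\<Sum>i\<in>UNIV. f (Mid i)) + (\<Sum>i\<in>UNIV. f (Dual i)) + f Last"
  for f :: "'n::finite idx \<Rightarrow> 'a::comm_monoid_add"
proof -
  have "(\<Sum>\<alpha>\<in>range Mid \<union> range Dual. f \<alpha>) = (\<Sum>i\<in>UNIV. f (Mid i)) + (\<Sum>i\<in>UNIV. f (Dual i))"
    by (subst sum.union_disjoint) (auto simp: sum.reindex inj_def)
  then show ?thesis
    unfolding UNIV_idx by (subst sum.insert, simp, force)+ (simp add: ac_simps)
qed

lemma card_idx: "CARD('n::finite idx) = 2 * CARD('n option)"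
  using sum_idx[where f="\<lambda>_ :: 'n idx. 1 :: nat"] by simp

section \<open>Symplectic frames\<close>

locale symplectic_form =
  fixes B :: "complex^'m::finite \<Rightarrow> complex^'m \<Rightarrow> complex"
  assumes linear_right: "Vector_Spaces.linear (*s) (*) (B u)"
    and antisym: "B u v = - B v u"
begin

lemma add_right: "B u (v + w) = B u v + B u w"
  and scale_right: "B u (c *s v) = c * B u v"
  using linear_right[of u] by (auto simp: Vector_Spaces.linear_iff)

lemma add_left: "B (v + w) u = B v u + B w u"
  and scale_left: "B (c *s v) u = c * B v u"
  by (simp_all add: antisym[of _ u] add_right scale_right)

lemma zero_right [simp]: "B u 0 = 0" and zero_left [simp]: "B 0 u = 0"
  using scale_right[of u 0 0] scale_left[of 0 0 u] by simp_all

lemma minus_right: "B u (- v) = - B u v" and minus_left: "B (- u) v = - B u v"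
  using scale_right[of u "-1" v] scale_left[of "-1" u v] by simp_all

lemma sum_right: "B u (\<Sum>i\<in>I. f i) = (\<Sum>i\<in>I. B u (f i))"
  by (induction I rule: infinite_finite_induct) (auto simp: add_right)

lemma sum_left: "B (\<Sum>i\<in>I. f i) u = (\<Sum>i\<in>I. B (f i) u)"
  by (induction I rule: infinite_finite_induct) (auto simp: add_left)

lemmas bilin = add_right scale_right add_left scale_left minus_right minus_left sum_right sum_left

lemma self_zero [simp]: "B u u = 0"
  using antisym[of u u] by simp

lemma form_components: "B u v = (\<Sum>k\<in>UNIV. \<Sum>l\<in>UNIV. u $ k * v $ l * B (axis k 1) (axis l 1))"
proof -
  have "B u v = B (\<Sum>k\<in>UNIV. u $ k *s axis k 1) v"
    by (simp only: basis_expansion)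
  also have "\<dots> = (\<Sum>k\<in>UNIV. u $ k * B (axis k 1) v)"
    by (simp only: sum_left scale_left)
  also have "\<dots> = (\<Sum>k\<in>UNIV. u $ k * B (axis k 1) (\<Sum>l\<in>UNIV. v $ l *s axis l 1))"
    by (simp only: basis_expansion)
  also have "\<dots> = (\<Sum>k\<in>UNIV. \<Sum>l\<in>UNIV. u $ k * v $ l * B (axis k 1) (axis l 1))"
    by (simp only: sum_right scale_right sum_distrib_left mult.assoc)
  finally show ?thesis .
qed

end

text \<open>The two halves are dual to each other, so the coefficients of a vector are its pairings with the frame.
  The dimension is a hypothesis because duality alone gives only independence.\<close>

locale symplectic_frame = symplectic_form B
  for B :: "complex^'m::finite \<Rightarrow> complex^'m \<Rightarrow> complex" +
  fixes a b :: "'i::finite \<Rightarrow> complex^'m"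
  assumes ab: "B (a i) (b j) = (if i = j then 1 else 0)"
    and aa: "B (a i) (a j) = 0" and bb: "B (b i) (b j) = 0"
    and card_eq: "CARD('m) = 2 * CARD('i)"
begin

lemma coefficients:
  assumes "u = (\<Sum>i\<in>UNIV. x i *s a i) + (\<Sum>i\<in>UNIV. y i *s b i)"
  shows "B u (b j) = x j" and "B (a j) u = y j"
  by (simp_all add: assms bilin ab aa bb if_distrib[of "\<lambda>c. _ * c"] cong: if_cong)

lemma inj_a: "inj a" and inj_b: "inj b" and disjoint: "range a \<inter> range b = {}"
proof -
  show "inj a" by (rule injI) (metis ab zero_neq_one)
  show "inj b" by (rule injI) (metis ab zero_neq_one)
  show "range a \<inter> range b = {}" using ab bb by (auto, metis zero_neq_one)
qed

lemma sum_range: "(\<Sum>v\<in>range a \<union> range b. f v) = (\<Sum>i\<in>UNIV. f (a i)) + (\<Sum>i\<in>UNIV. f (b i))"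
  by (subst sum.union_disjoint) (auto simp: disjoint sum.reindex inj_a inj_b)

lemma independent: "vec.independent (range a \<union> range b)"
proof (rule vec.independent_if_scalars_zero)
  fix f v assume 0: "(\<Sum>x\<in>range a \<union> range b. f x *s x) = 0" and v: "v \<in> range a \<union> range b"
  have "0 = (\<Sum>i\<in>UNIV. f (a i) *s a i) + (\<Sum>i\<in>UNIV. f (b i) *s b i)"
    using 0 by (simp add: sum_range)
  from coefficients[OF this] v show "f v = 0" by auto
qed simp

lemma span: "vec.span (range a \<union> range b) = UNIV"
proof -
  have "card (range a \<union> range b) = CARD('m)"
    by (simp add: card_Un_disjoint disjoint card_image inj_a inj_b card_eq)
  then have "UNIV \<subseteq> vec.span (range a \<union> range b)"
    by (intro vec.card_ge_dim_independent[OF _ independent]) (simp_all only: vec_dim_card subset_UNIV order_refl)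
  then show ?thesis by blast
qed

lemma expansion: "u = (\<Sum>i\<in>UNIV. B u (b i) *s a i) + (\<Sum>i\<in>UNIV. B (a i) u *s b i)"
proof -
  have "u \<in> vec.span (range a \<union> range b)" by (simp add: span)
  then obtain f where u: "u = (\<Sum>v\<in>range a \<union> range b. f v *s v)"
    by (subst (asm) vec.span_finite) auto
  then have "u = (\<Sum>i\<in>UNIV. f (a i) *s a i) + (\<Sum>i\<in>UNIV. f (b i) *s b i)"
    by (simp add: sum_range)
  from coefficients[OF this] this show ?thesis by simp
qed

lemma eqI: "(\<And>i. B u (b i) = B v (b i)) \<Longrightarrow> (\<And>i. B (a i) u = B (a i) v) \<Longrightarrow> u = v"
  using expansion[of u] expansion[of v] by simp

lemma sum_in_span: "(\<Sum>i\<in>UNIV. x i *s e i) \<in> vec.span (range e)"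
  by (intro vec.span_sum vec.span_scale vec.span_base) auto

lemma in_span_b: "(\<And>i. B u (b i) = 0) \<Longrightarrow> u \<in> vec.span (range b)"
  using expansion[of u] sum_in_span[of "\<lambda>i. B (a i) u" b] by simp

lemma in_span_a: "(\<And>i. B (a i) u = 0) \<Longrightarrow> u \<in> vec.span (range a)"
  using expansion[of u] sum_in_span[of "\<lambda>i. B u (b i)" a] by simp

lemma dim_span_b: "vec.dim (vec.span (range b)) = CARD('i)"
  using vec.independent_mono[OF independent, of "range b"]
  by (simp add: vec.dim_eq_card_independent card_image inj_b vec.dim_span)

end


section \<open>The potential of a Frobenius manifold\<close>

text \<open>The derivative in the constant direction \<open>V\<close>: a flat vector field in flat coordinates.\<close>

definition ddir :: "complex^'k \<Rightarrow> (complex^'k::finite \<Rightarrow> complex) \<Rightarrow> complex^'k \<Rightarrow> complex" where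
  "ddir V f y = (\<Sum>\<alpha>\<in>UNIV. V $ \<alpha> * pd \<alpha> f y)"

lemma ddir_cong:
  "open S \<Longrightarrow> y \<in> S \<Longrightarrow> (\<And>y. y \<in> S \<Longrightarrow> f y = g y) \<Longrightarrow> ddir V f y = ddir V g y"
  unfolding ddir_def by (intro sum.cong refl arg_cong2[where f="(*)"] pd_cong)

lemma holo_on_ddir: "holo_on f S \<Longrightarrow> open S \<Longrightarrow> holo_on (ddir V f) S"
  unfolding ddir_def by (intro holo_on_sum holo_on_mult holo_on_const holo_on_pd)

lemma ddir_add: "holo_on f S \<Longrightarrow> holo_on g S \<Longrightarrow> y \<in> S \<Longrightarrow> ddir V (\<lambda>y. f y + g y) y = ddir V f y + ddir V g y"
  unfolding ddir_def by (simp add: pd_add[where S=S] distrib_left sum.distrib)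

lemma ddir_linear_combination:
  assumes "\<And>k. k \<in> I \<Longrightarrow> holo_on (f k) S" "y \<in> S"
  shows "ddir V (\<lambda>y. \<Sum>k\<in>I. c k * f k y) y = (\<Sum>k\<in>I. c k * ddir V (f k) y)"
proof -
  have "pd \<alpha> (\<lambda>y. \<Sum>k\<in>I. c k * f k y) y = (\<Sum>k\<in>I. c k * pd \<alpha> (f k) y)" for \<alpha>
    by (subst pd_sum[where S=S]) (auto simp: assms pd_cmult[where S=S] intro!: holo_on_mult holo_on_const sum.cong)
  then show ?thesis
    unfolding ddir_def by (simp only: sum_distrib_left) (subst sum.swap, simp only: mult.left_commute)
qed

lemma ddir_affine: "ddir V (\<lambda>y. a + (\<Sum>k\<in>UNIV. b k * y $ k)) y = (\<Sum>k\<in>UNIV. V $ k * b k)"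
proof -
  have "pd \<alpha> (\<lambda>y. a + (\<Sum>k\<in>UNIV. b k * y $ k)) y = b \<alpha>" for \<alpha>
    by (subst pd_add[where S=UNIV], auto intro!: holo_intros,
        subst pd_sum[where S=UNIV], auto intro!: holo_intros)
      (simp add: pd_cmult[OF holo_on_nth[of _ UNIV]] if_distrib[of "\<lambda>c. _ * c"] cong: if_cong)
  then show ?thesis by (simp add: ddir_def)
qed

lemma pd_quadratic:
  "pd i (\<lambda>x. \<Sum>k\<in>UNIV. \<Sum>l\<in>UNIV. m k l * x $ k * x $ l) x = (\<Sum>j\<in>UNIV. (m i j + m j i) * x $ j)"
proof -
  have holo: "holo_on (\<lambda>x. m k l * x $ k * x $ l) UNIV" for k l
    by (intro holo_intros)
  have monomial: "pd i (\<lambda>x. m k l * x $ k * x $ l) x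
      = (if i = k then m k l * x $ l else 0) + (if i = l then m k l * x $ k else 0)" for k l
    using pd_mult[OF holo_on_mult[OF holo_on_const holo_on_nth] holo_on_nth UNIV_I, of i "m k l" k l x]
    by (simp add: pd_cmult[OF holo_on_nth UNIV_I])
  have "pd i (\<lambda>x. \<Sum>k\<in>UNIV. \<Sum>l\<in>UNIV. m k l * x $ k * x $ l) x
      = (\<Sum>k\<in>UNIV. \<Sum>l\<in>UNIV. (if i = k then m k l * x $ l else 0) + (if i = l then m k l * x $ k else 0))"
    using holo by (simp only: pd_sum[where S=UNIV] holo_on_sum monomial UNIV_I)
  also have "\<dots> = (\<Sum>l\<in>UNIV. m i l * x $ l) + (\<Sum>k\<in>UNIV. m k i * x $ k)"
  proof -
    have "(\<Sum>k\<in>UNIV. \<Sum>l\<in>UNIV. if i = k then m k l * x $ l else 0) = (\<Sum>l\<in>UNIV. m i l * x $ l)"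
      by (subst sum.swap) simp
    then show ?thesis by (simp add: sum.distrib)
  qed
  finally show ?thesis by (simp add: distrib_right sum.distrib)
qed

lemma poly_le2_holo: "q \<in> poly_le2 \<Longrightarrow> holo_on q S"
  unfolding poly_le2_def by (auto intro!: holo_intros)

text \<open>Each derivative in a constant direction lowers the degree by one.\<close>

lemma poly_le2_third_derivative:
  assumes "q \<in> poly_le2"
  shows "ddir X (ddir Y (ddir Z q)) y = 0"
proof -
  obtain c l m where q: "q = (\<lambda>x. (c + (\<Sum>i\<in>UNIV. l i * x $ i)) + (\<Sum>i\<in>UNIV. \<Sum>j\<in>UNIV. m i j * x $ i * x $ j))"
    using assms unfolding poly_le2_def by blast
  have "ddir Z q x = (\<Sum>k\<in>UNIV. Z $ k * l k) + (\<Sum>k\<in>UNIV. (\<Sum>i\<in>UNIV. Z $ i * (m i k + m k i)) * x $ k)" for x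
  proof -
    have "ddir Z q x = (\<Sum>k\<in>UNIV. Z $ k * l k) + ddir Z (\<lambda>x. \<Sum>i\<in>UNIV. \<Sum>j\<in>UNIV. m i j * x $ i * x $ j) x"
      unfolding q by (subst ddir_add[where S=UNIV]) (auto intro!: holo_intros simp: ddir_affine)
    also have "ddir Z (\<lambda>x. \<Sum>i\<in>UNIV. \<Sum>j\<in>UNIV. m i j * x $ i * x $ j) x
        = (\<Sum>k\<in>UNIV. (\<Sum>i\<in>UNIV. Z $ i * (m i k + m k i)) * x $ k)"
      unfolding ddir_def pd_quadratic sum_distrib_left sum_distrib_right
      by (subst sum.swap) (simp add: mult_ac)
    finally show ?thesis .
  qed
  then have 1: "ddir Z q = (\<lambda>x. (\<Sum>k\<in>UNIV. Z $ k * l k) + (\<Sum>k\<in>UNIV. (\<Sum>i\<in>UNIV. Z $ i * (m i k + m k i)) * x $ k))"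
    by blast
  have "ddir Y (ddir Z q) = (\<lambda>x. \<Sum>k\<in>UNIV. Y $ k * (\<Sum>i\<in>UNIV. Z $ i * (m i k + m k i)))"
    unfolding 1 by (rule ext) (rule ddir_affine)
  then show ?thesis by (simp add: ddir_def)
qed

lemma flat_field_ddir: "flat_field \<phi> M V f p = ddir V (\<lambda>y. f (inv_into M \<phi> y)) (\<phi> p)"
  by (simp add: flat_field_def coord_deriv_def ddir_def)

text \<open>Iterated flat fields are iterated directional derivatives of the function transported to the coordinate
  domain; the domain must be open for the inner derivatives to be transported too.\<close>

lemma flat_field_triple:
  assumes op: "open (\<phi> ` M)" and p: "p \<in> M"
  shows "flat_field \<phi> M X (flat_field \<phi> M Y (flat_field \<phi> M Z f)) p
    = ddir X (ddir Y (ddir Z (\<lambda>y. f (inv_into M \<phi> y)))) (\<phi> p)"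
proof -
  have inv: "flat_field \<phi> M V g (inv_into M \<phi> y) = ddir V (\<lambda>y. g (inv_into M \<phi> y)) y"
    if "y \<in> \<phi> ` M" for V g y
    using f_inv_into_f[OF that] by (simp add: flat_field_ddir)
  have "flat_field \<phi> M Y (flat_field \<phi> M Z f) (inv_into M \<phi> y)
      = ddir Y (ddir Z (\<lambda>y. f (inv_into M \<phi> y))) y" if y: "y \<in> \<phi> ` M" for y
    unfolding inv[OF y] by (rule ddir_cong[OF op y]) (rule inv)
  then show ?thesis
    unfolding flat_field_ddir[of _ _ X] using p by (intro ddir_cong[OF op]) auto
qed

text \<open>The metric pairs \<open>1\<close> with \<open>2n + 2\<close> and \<open>i\<close> with \<open>n + i\<close>, so the vector representing a linear form is
  obtained by exchanging its coefficients accordingly.\<close>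

lemma frob_metric_represents:
  fixes l :: "'n::finite idx \<Rightarrow> complex"
  shows "\<exists>!W. \<forall>V. frob_metric W V = (\<Sum>\<alpha>\<in>UNIV. V $ \<alpha> * l \<alpha>)"
proof (rule ex1I)
  let ?W = "\<chi> \<alpha>. case \<alpha> of I1 \<Rightarrow> l Last | Mid i \<Rightarrow> l (Dual i) | Dual i \<Rightarrow> l (Mid i) | Last \<Rightarrow> l I1"
  show "\<forall>V. frob_metric ?W V = (\<Sum>\<alpha>\<in>UNIV. V $ \<alpha> * l \<alpha>)"
    by (simp add: frob_metric_def sum_idx sum.distrib mult.commute)
  fix W assume W: "\<forall>V. frob_metric W V = (\<Sum>\<alpha>\<in>UNIV. V $ \<alpha> * l \<alpha>)"
  have l: "frob_metric W (axis \<beta> 1) = l \<beta>" for \<beta>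
  proof -
    have "(\<Sum>\<alpha>\<in>UNIV. axis \<beta> 1 $ \<alpha> * l \<alpha>) = (\<Sum>\<alpha>\<in>UNIV. if \<alpha> = \<beta> then l \<alpha> else 0)"
      by (intro sum.cong) (auto simp: axis_def)
    then show ?thesis using W by simp
  qed
  have "W $ \<alpha> = ?W $ \<alpha>" for \<alpha>
    using l[of I1] l[of Last] l[of "Dual _"] l[of "Mid _"]
    by (cases \<alpha>) (simp_all add: frob_metric_def axis_def if_distrib[of "\<lambda>c. _ * c"] cong: if_cong)
  then show "W = ?W" by (intro vec_eq_iff[THEN iffD2] allI)
qed

context
  fixes X :: "(complex^'n::finite) set" and t :: "complex^'n \<Rightarrow> complex^'n" and \<Psi> :: "complex^'n \<Rightarrow> complex"
  assumes t: "coordinates_on X t" and \<Psi>: "holo_on \<Psi> X"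
begin

lemma frob_coord_inj: "inj_on (frob_coord t) (frob_space X)"
proof (rule inj_onI)
  fix p q assume pq: "p \<in> frob_space X" "q \<in> frob_space X" "frob_coord t p = frob_coord t q"
  obtain c b s c' b' s' where p: "p = (c, b, s)" and q: "q = (c', b', s')" by (metis prod_cases3)
  have eq: "frob_coord t p $ \<alpha> = frob_coord t q $ \<alpha>" for \<alpha> using pq(3) by simp
  have "t b = t b'" using eq[of "Mid _"] by (simp add: frob_coord_def p q vec_eq_iff)
  then have "b = b'" using pq(1,2) t by (auto simp: frob_space_def p q coordinates_on_def inj_on_def)
  moreover have "c = c'" using eq[of I1] by (simp add: frob_coord_def p q)
  moreover have "s $ i = s' $ i" for i
    using eq[of Last] eq[of "Dual _"] by (cases i) (simp_all add: frob_coord_def p q)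
  then have "s = s'" by (simp add: vec_eq_iff)
  ultimately show "p = q" by (simp add: p q)
qed

abbreviation "midpart y \<equiv> (\<chi> i. y $ Mid i) :: complex^'n"

lemma frob_coord_image: "frob_coord t ` frob_space X = {y. midpart y \<in> t ` X}"
  and frob_coord_inv: "midpart y \<in> t ` X \<Longrightarrow> inv_into (frob_space X) (frob_coord t) y
    = (y $ I1, inv_into X t (midpart y), \<chi> i. case i of None \<Rightarrow> y $ Last | Some k \<Rightarrow> y $ Dual k)"
proof -
  let ?p = "\<lambda>y :: complex^('n idx). (y $ I1, inv_into X t (midpart y),
      \<chi> i. case i of None \<Rightarrow> y $ Last | Some k \<Rightarrow> y $ Dual k) :: 'n fpoint"
  have p: "?p y \<in> frob_space X" "frob_coord t (?p y) = y" if "midpart y \<in> t ` X" for y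
  proof -
    show "?p y \<in> frob_space X" using that by (simp add: frob_space_def inv_into_into)
    have "t (inv_into X t (midpart y)) $ i = y $ Mid i" for i
      using f_inv_into_f[OF that] by (simp add: vec_eq_iff)
    then have "frob_coord t (?p y) $ \<alpha> = y $ \<alpha>" for \<alpha>
      by (cases \<alpha>) (simp_all add: frob_coord_def)
    then show "frob_coord t (?p y) = y" by (intro vec_eq_iff[THEN iffD2] allI)
  qed
  have mid: "midpart (frob_coord t q) = t (fst (snd q))" for q
    by (cases q) (simp add: frob_coord_def vec_eq_iff)
  show "frob_coord t ` frob_space X = {y. midpart y \<in> t ` X}"
  proof (intro set_eqI iffI)
    fix y assume "y \<in> frob_coord t ` frob_space X"
    then obtain q where "q \<in> frob_space X" "y = frob_coord t q" by blast
    then show "y \<in> {y. midpart y \<in> t ` X}" by (auto simp: mid frob_space_def)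
  next
    fix y assume "y \<in> {y. midpart y \<in> t ` X}"
    then have "midpart y \<in> t ` X" by simp
    from p[OF this] show "y \<in> frob_coord t ` frob_space X" by (metis imageI)
  qed
  show "inv_into (frob_space X) (frob_coord t) y = ?p y" if "midpart y \<in> t ` X"
    using inv_into_f_f[OF frob_coord_inj p(1)[OF that]] unfolding p(2)[OF that] .
qed

lemma frob_coord_open: "open (frob_coord t ` frob_space X)"
proof -
  have "vholo_on (\<lambda>y :: complex^('n idx). midpart y) UNIV" by (simp add: vholo_on_def holo_on_nth)
  then have "open ((\<lambda>y :: complex^('n idx). midpart y) -` (t ` X))"
    using t by (intro open_vimage vholo_on_continuous) (simp add: coordinates_on_def)
  then show ?thesis unfolding frob_coord_image vimage_def .
qed

lemma frob_potential_holo: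
  "holo_on (\<lambda>y. frob_potential t \<Psi> (inv_into (frob_space X) (frob_coord t) y)) (frob_coord t ` frob_space X)"
proof -
  let ?S = "frob_coord t ` frob_space X"
  have mid: "vholo_on (\<lambda>y :: complex^('n idx). midpart y) ?S" by (simp add: vholo_on_def holo_on_nth)
  have inv: "vholo_on (inv_into X t) (t ` X)" using t by (simp add: coordinates_on_def)
  have b: "vholo_on (\<lambda>y. inv_into X t (midpart y)) ?S"
    by (rule vholo_on_compose[OF inv mid]) (auto simp: frob_coord_image)
  have "holo_on (\<lambda>y. \<Psi> (inv_into X t (midpart y)) + y $ I1 ^ 2 * y $ Last * (1 / 2)
      + y $ I1 * (\<Sum>i\<in>UNIV. y $ Mid i * y $ Dual i)) ?S"
    by (intro holo_intros holo_on_compose[OF \<Psi> b]) (auto simp: frob_coord_image inv_into_into)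
  then show ?thesis
  proof (rule holo_on_cong[OF _ frob_coord_open])
    fix y assume "y \<in> ?S"
    then have y: "midpart y \<in> t ` X" by (simp add: frob_coord_image)
    have "t (inv_into X t (midpart y)) = midpart y" by (rule f_inv_into_f[OF y])
    then show "\<Psi> (inv_into X t (midpart y)) + y $ I1 ^ 2 * y $ Last * (1 / 2)
      + y $ I1 * (\<Sum>i\<in>UNIV. y $ Mid i * y $ Dual i)
      = frob_potential t \<Psi> (inv_into (frob_space X) (frob_coord t) y)"
      by (simp add: frob_coord_inv[OF y] frob_potential_def)
  qed
qed

abbreviation "third \<Phi> A B C p \<equiv> flat_field (frob_coord t) (frob_space X) A
  (flat_field (frob_coord t) (frob_space X) B (flat_field (frob_coord t) (frob_space X) C \<Phi>)) p"

lemma third_add_poly: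
  assumes q: "q \<in> poly_le2" and p: "p \<in> frob_space X"
  shows "third (\<lambda>p. frob_potential t \<Psi> p + q (frob_coord t p)) A B C p = third (frob_potential t \<Psi>) A B C p"
proof -
  let ?S = "frob_coord t ` frob_space X"
  let ?F = "\<lambda>y. frob_potential t \<Psi> (inv_into (frob_space X) (frob_coord t) y)"
  note op = frob_coord_open and F = frob_potential_holo and Q = poly_le2_holo[OF q]
  have y: "frob_coord t p \<in> ?S" using p by (rule imageI)
  have 1: "ddir C (\<lambda>y. ?F y + q (frob_coord t (inv_into (frob_space X) (frob_coord t) y))) y
      = ddir C ?F y + ddir C q y" if "y \<in> ?S" for y
  proof -
    have "ddir C (\<lambda>y. ?F y + q (frob_coord t (inv_into (frob_space X) (frob_coord t) y))) y
        = ddir C (\<lambda>y. ?F y + q y) y"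
      by (rule ddir_cong[OF op that]) (simp add: f_inv_into_f)
    then show ?thesis by (simp add: ddir_add[OF F Q that])
  qed
  have 2: "ddir B (ddir C (\<lambda>y. ?F y + q (frob_coord t (inv_into (frob_space X) (frob_coord t) y)))) y
      = ddir B (ddir C ?F) y + ddir B (ddir C q) y" if "y \<in> ?S" for y
    using ddir_cong[OF op that 1] ddir_add[OF holo_on_ddir[OF F op] holo_on_ddir[OF Q op] that] by simp
  show ?thesis
    unfolding flat_field_triple[OF op p]
    using ddir_cong[OF op y 2] poly_le2_third_derivative[OF q]
      ddir_add[OF holo_on_ddir[OF holo_on_ddir[OF F op] op] holo_on_ddir[OF holo_on_ddir[OF Q op] op] y]
    by simp
qed

text \<open>Linearity of the third derivatives in the last direction holds because all lower derivatives of the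
  holomorphic potential are differentiable.\<close>

lemma frob_mult_exists:
  assumes p: "p \<in> frob_space X"
  shows "\<exists>!W. \<forall>C. frob_metric W C = third (frob_potential t \<Psi>) A B C p"
proof -
  let ?S = "frob_coord t ` frob_space X"
  let ?F = "\<lambda>y. frob_potential t \<Psi> (inv_into (frob_space X) (frob_coord t) y)"
  note op = frob_coord_open and F = frob_potential_holo
  have y: "frob_coord t p \<in> ?S" using p by (rule imageI)
  have pdF: "holo_on (pd \<gamma> ?F) ?S" for \<gamma> by (rule holo_on_pd[OF F op])
  have "third (frob_potential t \<Psi>) A B C p
      = (\<Sum>\<gamma>\<in>UNIV. C $ \<gamma> * ddir A (ddir B (pd \<gamma> ?F)) (frob_coord t p))" for C
  proof -
    have 2: "ddir B (ddir C ?F) y = (\<Sum>\<gamma>\<in>UNIV. C $ \<gamma> * ddir B (pd \<gamma> ?F) y)" if "y \<in> ?S" for y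
      unfolding ddir_def[of C] by (rule ddir_linear_combination[OF pdF that])
    have "ddir A (ddir B (ddir C ?F)) (frob_coord t p)
        = ddir A (\<lambda>y. \<Sum>\<gamma>\<in>UNIV. C $ \<gamma> * ddir B (pd \<gamma> ?F) y) (frob_coord t p)"
      by (rule ddir_cong[OF op y 2])
    also have "\<dots> = (\<Sum>\<gamma>\<in>UNIV. C $ \<gamma> * ddir A (ddir B (pd \<gamma> ?F)) (frob_coord t p))"
      by (rule ddir_linear_combination[OF holo_on_ddir[OF pdF op] y])
    finally show ?thesis unfolding flat_field_triple[OF op p] .
  qed
  then show ?thesis using frob_metric_represents by simp
qed

theorem frobenius_manifold_add_poly:
  assumes q: "q \<in> poly_le2"
  shows "frobenius_manifold X t (\<lambda>p. frob_potential t \<Psi> p + q (frob_coord t p))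
      = frobenius_manifold X t (frob_potential t \<Psi>)"
  unfolding frobenius_manifold_def Let_def
  by (intro arg_cong2[where f="\<lambda>m e. \<lparr>fpts = _, fcoord = _, fmet = _, fmult = m, funit = _, feuler = e\<rparr>"] refl ext)
    (simp add: third_add_poly[OF q])

theorem frobenius_potential_of_add_poly:
  assumes q: "q \<in> poly_le2"
  shows "frobenius_potential_of (frobenius_manifold X t (frob_potential t \<Psi>))
    (\<lambda>p. frob_potential t \<Psi> p + q (frob_coord t p))"
proof -
  let ?R = "frobenius_manifold X t (frob_potential t \<Psi>)"
  let ?S = "frob_coord t ` frob_space X"
  have R: "fpts ?R = frob_space X" "fcoord ?R = frob_coord t" "fmet ?R = frob_metric"
    by (simp_all add: frobenius_manifold_def Let_def)
  have mult: "frob_metric (fmult ?R p A B) C = third (frob_potential t \<Psi>) A B C p"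
    if "p \<in> frob_space X" for p A B C
    using theI'[OF frob_mult_exists[OF that, of A B]] that
    by (simp add: frobenius_manifold_def Let_def)
  have "holo_on (\<lambda>y. frob_potential t \<Psi> (inv_into (frob_space X) (frob_coord t) y)
      + q (frob_coord t (inv_into (frob_space X) (frob_coord t) y))) ?S"
    by (rule holo_on_cong[OF holo_on_add[OF frob_potential_holo poly_le2_holo[OF q]] frob_coord_open])
      (simp add: f_inv_into_f)
  then show ?thesis
    unfolding frobenius_potential_of_def R by (simp add: mult third_add_poly[OF q])
qed

end

section \<open>Bundles with connection\<close>

lemma holo_subbundle_subspace:
  assumes "holo_subbundle X E" "x \<in> X" shows "vec.subspace (E x)"
  using assms vec.subspace_span unfolding holo_subbundle_def by metis

lemma cov_cong:
  assumes "open N" "x \<in> N" "\<And>y. y \<in> N \<Longrightarrow> s y = s' y"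
  shows "cov D i s x = cov D i s' x"
  using vpd_cong[OF assms] assms by (simp add: cov_def)

lemma cov_zero [simp]: "cov D i (\<lambda>y. 0) x = 0"
  by (simp add: cov_def vpd_def vec_eq_iff)

lemma cov_add:
  assumes "vholo_on s N" "vholo_on s' N" "x \<in> N"
  shows "cov D i (\<lambda>y. s y + s' y) x = cov D i s x + cov D i s' x"
  using pd_add[OF vholo_onD[OF assms(1)] vholo_onD[OF assms(2)] assms(3)]
  by (simp add: cov_def vpd_def vec_eq_iff matrix_vector_right_distrib)

lemma cov_smult:
  assumes "holo_on g N" "vholo_on s N" "x \<in> N"
  shows "cov D i (\<lambda>y. g y *s s y) x = pd i g x *s s x + g x *s cov D i s x"
  using pd_mult[OF assms(1) vholo_onD[OF assms(2)] assms(3)]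
  by (simp add: cov_def vpd_def vec_eq_iff vec.scale algebra_simps)

lemma vholo_on_add: "vholo_on s N \<Longrightarrow> vholo_on s' N \<Longrightarrow> vholo_on (\<lambda>y. s y + s' y) N"
  by (simp add: vholo_on_def holo_on_add)

lemma vholo_on_smult: "holo_on g N \<Longrightarrow> vholo_on s N \<Longrightarrow> vholo_on (\<lambda>y. g y *s s y) N"
  by (simp add: vholo_on_def holo_on_mult)

lemma vholo_on_sum: "(\<And>k. k \<in> I \<Longrightarrow> vholo_on (s k) N) \<Longrightarrow> vholo_on (\<lambda>y. \<Sum>k\<in>I. s k y) N"
  by (simp add: vholo_on_def holo_on_sum)

lemma cov_sum:
  assumes "\<And>k. k \<in> I \<Longrightarrow> vholo_on (s k) N" "x \<in> N"
  shows "cov D i (\<lambda>y. \<Sum>k\<in>I. s k y) x = (\<Sum>k\<in>I. cov D i (s k) x)"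
  using assms(1)
  by (induction I rule: infinite_finite_induct)
    (auto simp: cov_add[where N=N] vholo_on_sum assms(2))

lemma flat_section_vholo: "flat_section D s \<Longrightarrow> vholo_on s (base D)"
  and flat_section_cov: "flat_section D s \<Longrightarrow> x \<in> base D \<Longrightarrow> cov D i s x = 0"
  by (auto simp: flat_section_def)

lemma flat_section_smult: "flat_section D s \<Longrightarrow> flat_section D (\<lambda>y. c *s s y)"
  by (auto simp: flat_section_def cov_smult[where N="base D"] holo_on_const vholo_on_smult)

lemma flat_section_add: "flat_section D s \<Longrightarrow> flat_section D s' \<Longrightarrow> flat_section D (\<lambda>y. s y + s' y)"
  by (auto simp: flat_section_def cov_add[where N="base D"] vholo_on_add)

lemma flat_section_sum: "(\<And>k. k \<in> I \<Longrightarrow> flat_section D (s k)) \<Longrightarrow> flat_section D (\<lambda>y. \<Sum>k\<in>I. s k y)"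
  by (auto simp: flat_section_def cov_sum[where N="base D"] vholo_on_sum)

lemma flat_section_minus: "flat_section D s \<Longrightarrow> flat_section D (\<lambda>y. - s y)"
  using flat_section_smult[of D s "-1"] by simp

locale vhl =
  fixes D :: "('n::finite, 'm::finite) vhf"
  assumes variation: "variation_hodge_like D"
begin

lemma open_base: "open (base D)" and connected_base: "connected (base D)"
  and bpt: "bpt D \<in> base D" and flat_pair: "flat_pairing D"
  using variation by (auto simp: variation_hodge_like_def)

lemma pair_form: "x \<in> base D \<Longrightarrow> symplectic_form (pair D x)"
  using flat_pair unfolding flat_pairing_def symplectic_form_def by blast

lemma pair_holo:
  assumes "open N" "N \<subseteq> base D" "vholo_on s N" "vholo_on s' N"
  shows "holo_on (\<lambda>y. pair D y (s y) (s' y)) N"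
proof -
  have "holo_on (\<lambda>y. pair D y (axis k 1) (axis l 1)) N" for k l
    using flat_pair assms(2) unfolding flat_pairing_def by (blast intro: holo_on_subset)
  then have "holo_on (\<lambda>y. \<Sum>k\<in>UNIV. \<Sum>l\<in>UNIV. s y $ k * s' y $ l * pair D y (axis k 1) (axis l 1)) N"
    by (intro holo_intros vholo_onD[OF assms(3)] vholo_onD[OF assms(4)])
  then show ?thesis
    by (rule holo_on_cong[OF _ assms(1)])
      (use symplectic_form.form_components[OF pair_form] assms(2) in auto)
qed

end

section \<open>Adapted bases and their flat extensions\<close>

text \<open>The half of a frame that becomes \<open>a\<^sub>1, \<dots>, a\<^sub>n\<^sub>+\<^sub>1\<close>.\<close>

definition pos_half :: "('n idx \<Rightarrow> 'v) \<Rightarrow> 'n option \<Rightarrow> 'v" where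
  "pos_half e i = (case i of None \<Rightarrow> e I1 | Some k \<Rightarrow> e (Mid k))"

text \<open>The half that becomes \<open>b\<^sub>1, \<dots>, b\<^sub>n\<^sub>+\<^sub>1\<close>; the sign turns \<open>S(v\<^sub>1, v\<^sub>2\<^sub>n\<^sub>+\<^sub>2) = -1\<close> into \<open>S(a\<^sub>1, b\<^sub>1) = 1\<close>.\<close>

definition neg_half :: "('n idx \<Rightarrow> 'v::uminus) \<Rightarrow> 'n option \<Rightarrow> 'v" where
  "neg_half e i = (case i of None \<Rightarrow> - e Last | Some k \<Rightarrow> e (Dual k))"

lemma half_simps [simp]:
  "pos_half e None = e I1" "pos_half e (Some k) = e (Mid k)"
  "neg_half e None = - e Last" "neg_half e (Some k) = e (Dual k)"
  by (simp_all add: pos_half_def neg_half_def)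

lemma (in symplectic_form) frame_of_gram:
  fixes e :: "'n::finite idx \<Rightarrow> complex^'m"
  assumes "B (e I1) (e Last) = -1"
    and "\<And>k \<beta>. B (e (Mid k)) (e \<beta>) = (if \<beta> = Dual k then 1 else 0)"
    and "\<And>k. B (e I1) (e (Dual k)) = 0"
    and "\<And>k l. B (e (Dual k)) (e (Dual l)) = 0" and "\<And>k. B (e (Dual k)) (e Last) = 0"
    and "CARD('m) = CARD('n idx)"
  shows "symplectic_frame B (pos_half e) (neg_half e)"
proof unfold_locales
  fix i j :: "'n option"
  show "B (pos_half e i) (neg_half e j) = (if i = j then 1 else 0)"
    by (cases i; cases j) (simp_all add: minus_right assms(1-3))
  show "B (pos_half e i) (pos_half e j) = 0"
    by (cases i; cases j) (simp_all add: antisym[of "e I1" "e (Mid _)"] assms(2))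
  show "B (neg_half e i) (neg_half e j) = 0"
    by (cases i; cases j) (simp_all add: minus_right minus_left antisym[of "e Last" "e (Dual _)"] assms(4,5))
  show "CARD('m) = 2 * CARD('n option)"
    using assms(6) by (simp only: card_idx)
qed

lemma int_step_mono:
  assumes "\<And>p. S p \<subseteq> S (p + 1)" "p \<le> q" shows "S p \<subseteq> S (q :: int)"
  using assms(2) by (induction rule: int_ge_induct) (use assms(1) in blast)+

context vhl
begin

lemma fil_perp:
  assumes "x \<in> base D" "u \<in> fil D p x" "w \<in> fil D q x" "p + q = 4"
  shows "pair D x u w = 0"
proof -
  have q: "q = 4 - p" using assms(4) by simp
  have "\<forall>p. \<forall>x\<in>base D. \<forall>u\<in>fil D p x. \<forall>v\<in>fil D (4 - p) x. pair D x u v = 0"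
    using variation unfolding variation_hodge_like_def by (elim conjE)
  with assms(1-3) show ?thesis unfolding q by blast
qed

lemma fil_anti:
  assumes x: "x \<in> base D" and "p \<le> q" shows "fil D q x \<subseteq> fil D p x"
proof -
  have "fil D (- r) x \<subseteq> fil D (- (r + 1)) x" for r
  proof -
    have "fil D (- (r + 1) + 1) x \<subseteq> fil D (- (r + 1)) x"
      using variation x by (simp only: variation_hodge_like_def)
    then show ?thesis by simp
  qed
  from int_step_mono[of "\<lambda>r. fil D (- r) x", OF this, of "- q" "- p"] assms(2) show ?thesis by simp
qed

lemma fil_subspace: "x \<in> base D \<Longrightarrow> vec.subspace (fil D p x)"
  using variation by (auto simp: variation_hodge_like_def intro: holo_subbundle_subspace)

lemma fil_transversal:
  assumes "vholo_on s (base D)" "\<And>x. x \<in> base D \<Longrightarrow> s x \<in> fil D p x" "x \<in> base D"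
  shows "cov D i s x \<in> fil D (p - 1) x"
proof -
  have "local_section D (fil D p) (base D) s" using assms open_base by (simp add: local_section_def)
  moreover have "\<forall>p N s i. local_section D (fil D p) N s \<longrightarrow> (\<forall>x\<in>N. cov D i s x \<in> fil D (p - 1) x)"
    using variation unfolding variation_hodge_like_def by (elim conjE)
  ultimately show ?thesis using assms(3) by blast
qed

lemma pair_deriv:
  assumes "open N" "N \<subseteq> base D" "vholo_on s N" "vholo_on s' N" "x \<in> N"
  shows "pd i (\<lambda>y. pair D y (s y) (s' y)) x = pair D x (cov D i s x) (s' x) + pair D x (s x) (cov D i s' x)"
proof -
  have "\<forall>N s s' i. open N \<and> N \<subseteq> base D \<and> vholo_on s N \<and> vholo_on s' N \<longrightarrow>
      (\<forall>x\<in>N. pd i (\<lambda>y. pair D y (s y) (s' y)) x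
        = pair D x (cov D i s x) (s' x) + pair D x (s x) (cov D i s' x))"
    using flat_pair unfolding flat_pairing_def by (elim conjE)
  with assms show ?thesis by simp
qed

text \<open>Leibniz' rule for the flat pairing, integrated over the connected base.  It serves as the substitute for
  solving the linear differential equations of parallel transport.\<close>

lemma pair_const:
  assumes "vholo_on s (base D)" "vholo_on s' (base D)"
    and "\<And>x i. x \<in> base D \<Longrightarrow> pair D x (cov D i s x) (s' x) + pair D x (s x) (cov D i s' x) = 0"
    and "x \<in> base D" "y \<in> base D"
  shows "pair D x (s x) (s' x) = pair D y (s y) (s' y)"
  by (rule holo_on_pd_zero_imp_const[OF open_base connected_base pair_holo[OF open_base order_refl assms(1,2)] _ assms(4,5)])
    (simp add: pair_deriv[OF open_base order_refl assms(1,2)] assms(3))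

lemma flat_pair_const:
  assumes "flat_section D s" "flat_section D s'" "x \<in> base D" "y \<in> base D"
  shows "pair D x (s x) (s' x) = pair D y (s y) (s' y)"
proof (rule pair_const[OF flat_section_vholo[OF assms(1)] flat_section_vholo[OF assms(2)] _ assms(3,4)])
  fix x i assume x: "x \<in> base D"
  interpret symplectic_form "pair D x" by (rule pair_form[OF x])
  show "pair D x (cov D i s x) (s' x) + pair D x (s x) (cov D i s' x) = 0"
    by (simp add: flat_section_cov assms(1,2) x)
qed

end

locale adapted_vhl = vhl D for D :: "('n::finite, 'm::finite) vhf" +
  fixes U :: "int \<Rightarrow> complex^'n \<Rightarrow> (complex^'m) set"
    and v v0 :: "'n idx \<Rightarrow> complex^'n \<Rightarrow> complex^'m"
  assumes CY: "CY_condition D" and opp: "opposite_filtration D U"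
    and adapted: "adapted_basis D U v" and extension: "flat_extension D v v0"
begin

abbreviation "va x \<equiv> pos_half (\<lambda>\<alpha>. v \<alpha> x)"
abbreviation "vb x \<equiv> neg_half (\<lambda>\<alpha>. v \<alpha> x)"
abbreviation "fa x \<equiv> pos_half (\<lambda>\<alpha>. v0 \<alpha> x)"
abbreviation "fb x \<equiv> neg_half (\<lambda>\<alpha>. v0 \<alpha> x)"

lemma v_holo: "vholo_on (v \<alpha>) (base D)"
  using adapted unfolding adapted_basis_def by blast

lemma v_type:
  assumes "x \<in> base D"
  shows "v I1 x \<in> fil D 3 x" "v (Mid k) x \<in> fil D 2 x" "v (Mid k) x \<in> U 2 x"
    "v (Dual k) x \<in> fil D 1 x" "v (Dual k) x \<in> U 1 x" "v Last x \<in> U 0 x"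
    "covU D U i (v \<alpha>) x = 0"
  using adapted assms unfolding adapted_basis_def by simp_all

lemma U_perp:
  assumes "x \<in> base D" "u \<in> U p x" "w \<in> U q x" "p + q = 2"
  shows "pair D x u w = 0"
proof -
  have q: "q = 2 - p" using assms(4) by simp
  have "\<forall>p. \<forall>x\<in>base D. \<forall>u\<in>U p x. \<forall>v\<in>U (2 - p) x. pair D x u v = 0"
    using opp unfolding opposite_filtration_def by (elim conjE)
  with assms(1-3) show ?thesis unfolding q by blast
qed

lemma U_mono: "x \<in> base D \<Longrightarrow> p \<le> q \<Longrightarrow> U p x \<subseteq> U q x"
  by (rule int_step_mono[of "\<lambda>p. U p x"]) (use opp in \<open>simp_all add: opposite_filtration_def\<close>)

lemma U_flat: "flat_subbundle D (U p)"
  using opp by (simp add: opposite_filtration_def)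

lemma U_subspace: "x \<in> base D \<Longrightarrow> vec.subspace (U p x)"
  by (rule holo_subbundle_subspace) (use U_flat in \<open>auto simp: flat_subbundle_def\<close>)

lemma U_cov:
  assumes "vholo_on s (base D)" "\<And>x. x \<in> base D \<Longrightarrow> s x \<in> U p x" "x \<in> base D"
  shows "cov D i s x \<in> U p x"
proof -
  have "local_section D (U p) (base D) s" using assms(1,2) open_base by (simp add: local_section_def)
  moreover have "\<forall>N s i. local_section D (U p) N s \<longrightarrow> (\<forall>x\<in>N. cov D i s x \<in> U p x)"
    using U_flat[of p] unfolding flat_subbundle_def by (elim conjE)
  ultimately show ?thesis using assms(3) by blast
qed

lemma fil_bounds: "x \<in> base D \<Longrightarrow> fil D 4 x = {0}" "x \<in> base D \<Longrightarrow> fil D 0 x = UNIV"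
  using CY by (simp_all add: CY_condition_def)

lemma card_m: "CARD('m) = CARD('n idx)"
proof -
  let ?R = "range (\<lambda>\<alpha>. v \<alpha> (bpt D))"
  have R: "inj (\<lambda>\<alpha>. v \<alpha> (bpt D))" "vec.independent ?R" "vec.span ?R = UNIV"
    using adapted bpt by (simp_all add: adapted_basis_def)
  have "CARD('m) = vec.dim (vec.span ?R)" by (simp only: R(3) vec_dim_card)
  also have "\<dots> = card ?R" by (simp only: vec.dim_span vec.dim_eq_card_independent[OF R(2)])
  also have "\<dots> = CARD('n idx)" by (rule card_image[OF R(1)])
  finally show ?thesis .
qed

lemma v_gram:
  assumes x: "x \<in> base D"
  shows "pair D x (v I1 x) (v Last x) = -1"
    and "pair D x (v (Mid k) x) (v \<beta> x) = (if \<beta> = Dual k then 1 else 0)"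
    and "pair D x (v I1 x) (v (Dual k) x) = 0"
    and "pair D x (v (Dual k) x) (v (Dual l) x) = 0"
    and "pair D x (v (Dual k) x) (v Last x) = 0"
proof -
  show "pair D x (v I1 x) (v Last x) = -1"
    and "pair D x (v (Mid k) x) (v \<beta> x) = (if \<beta> = Dual k then 1 else 0)"
    using adapted x by (simp_all add: adapted_basis_def)
  have "v Last x \<in> U 1 x" using v_type(6)[OF x] U_mono[OF x, of 0 1] by auto
  then show "pair D x (v I1 x) (v (Dual k) x) = 0"
    and "pair D x (v (Dual k) x) (v (Dual l) x) = 0"
    and "pair D x (v (Dual k) x) (v Last x) = 0"
    using fil_perp[OF x v_type(1,4)[OF x]] U_perp[OF x v_type(5)[OF x]] v_type(5)[OF x] by simp_all
qed

lemma v_frame: "x \<in> base D \<Longrightarrow> symplectic_frame (pair D x) (va x) (vb x)"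
  by (rule symplectic_form.frame_of_gram[OF pair_form]) (simp_all only: v_gram card_m)

lemma v0_flat: "flat_section D (v0 \<alpha>)" and v0_bpt: "v0 \<alpha> (bpt D) = v \<alpha> (bpt D)"
  using extension unfolding flat_extension_def by blast+

lemma v0_frame: 
  assumes "x \<in> base D" shows "symplectic_frame (pair D x) (fa x) (fb x)"
proof -
  have "pair D x (v0 \<alpha> x) (v0 \<beta> x) = pair D (bpt D) (v \<alpha> (bpt D)) (v \<beta> (bpt D))" for \<alpha> \<beta>
    using flat_pair_const[OF v0_flat v0_flat assms bpt] by (simp only: v0_bpt)
  then show ?thesis
    by (intro symplectic_form.frame_of_gram[OF pair_form[OF assms]]) (simp_all only: v_gram bpt card_m)
qed

lemma halves_flat: "flat_section D (\<lambda>x. fa x i)" "flat_section D (\<lambda>x. fb x i)"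
  by (cases i; simp add: v0_flat flat_section_minus)+

text \<open>A flat section is determined by its pairings with the flat frame, which are constant.\<close>

lemma flat_section_eq:
  assumes "flat_section D s" "flat_section D s'" "s y = s' y" "y \<in> base D" "x \<in> base D"
  shows "s x = s' x"
proof -
  interpret symplectic_frame "pair D x" "fa x" "fb x" by (rule v0_frame) fact
  show ?thesis
  proof (rule eqI)
    fix i
    show "pair D x (s x) (fb x i) = pair D x (s' x) (fb x i)"
      using flat_pair_const[OF assms(1) halves_flat(2) assms(5,4), of i]
        flat_pair_const[OF assms(2) halves_flat(2) assms(5,4), of i] assms(3) by simp
    show "pair D x (fa x i) (s x) = pair D x (fa x i) (s' x)"
      using flat_pair_const[OF halves_flat(1) assms(1) assms(5,4), of i]
        flat_pair_const[OF halves_flat(1) assms(2) assms(5,4), of i] assms(3) by simp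
  qed
qed

section \<open>Filtrations in terms of the adapted basis\<close>

lemma vb_in_U1: "x \<in> base D \<Longrightarrow> vb x i \<in> U 1 x"
  using v_type[of x] U_mono[of x 0 1] U_subspace[of x 1] by (cases i) (auto simp: vec.subspace_neg)

lemma va_in_F2: "x \<in> base D \<Longrightarrow> va x i \<in> fil D 2 x"
  using v_type[of x] fil_anti[of x 2 3] by (cases i) auto

lemma U1_expansion:
  assumes x: "x \<in> base D" and u: "u \<in> U 1 x"
  shows "u = (\<Sum>i\<in>UNIV. pair D x (va x i) u *s vb x i)"
proof -
  interpret symplectic_frame "pair D x" "va x" "vb x" by (rule v_frame[OF x])
  show ?thesis using expansion[of u] U_perp[OF x u vb_in_U1[OF x]] by simp
qed

lemma F2_expansion:
  assumes x: "x \<in> base D" and u: "u \<in> fil D 2 x"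
  shows "u = (\<Sum>i\<in>UNIV. pair D x u (vb x i) *s va x i)"
proof -
  interpret symplectic_frame "pair D x" "va x" "vb x" by (rule v_frame[OF x])
  show ?thesis using expansion[of u] fil_perp[OF x va_in_F2[OF x] u] by simp
qed

lemma F3_expansion:
  assumes x: "x \<in> base D" and u: "u \<in> fil D 3 x"
  shows "u = - pair D x u (v Last x) *s v I1 x"
proof -
  interpret symplectic_frame "pair D x" "va x" "vb x" by (rule v_frame[OF x])
  have "u \<in> fil D 2 x" using u fil_anti[OF x, of 2 3] by auto
  from F2_expansion[OF x this] fil_perp[OF x u v_type(4)[OF x]] show ?thesis
    by (simp add: sum_option minus_right)
qed

text \<open>The components of a vector vanish in degrees above \<open>3\<close>, where \<open>F\<close> is zero, and lie in \<open>U\<^sub>3\<close> otherwise.\<close>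

lemma U3: assumes x: "x \<in> base D" shows "U 3 x = UNIV"
proof -
  have "u \<in> U 3 x" for u
  proof -
    obtain d where d: "splits D U x u d"
      using opp x unfolding opposite_filtration_def by blast
    have "d p \<in> U 3 x" for p
    proof (cases "p \<le> 3")
      case True
      then show ?thesis using d U_mono[OF x True] unfolding splits_def by blast
    next
      case False
      then have "d p \<in> fil D 4 x" using d fil_anti[OF x, of 4 p] unfolding splits_def by auto
      then show ?thesis using fil_bounds(1)[OF x] U_subspace[OF x] by (simp add: vec.subspace_0)
    qed
    then have "(\<Sum>p | d p \<noteq> 0. d p) \<in> U 3 x" by (intro vec.subspace_sum[OF U_subspace[OF x]])
    then show ?thesis using d unfolding splits_def by simp
  qed
  then show ?thesis by blast
qed

lemma proj_sum:
  assumes x: "x \<in> base D" and "finite P" and d: "\<And>p. p \<in> P \<Longrightarrow> d p \<in> fil D p x \<inter> U p x"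
  shows "proj D U q x (\<Sum>p\<in>P. d p) = (if q \<in> P then d q else 0)"
proof -
  let ?d = "\<lambda>p. if p \<in> P then d p else 0"
  have "(\<Sum>p | ?d p \<noteq> 0. ?d p) = (\<Sum>p\<in>P. d p)"
    by (rule sum.mono_neutral_cong_left) (use \<open>finite P\<close> in auto)
  moreover have "finite {p. ?d p \<noteq> 0}"
    by (rule finite_subset[OF _ \<open>finite P\<close>]) auto
  ultimately have "splits D U x (\<Sum>p\<in>P. d p) ?d"
    unfolding splits_def using d vec.subspace_0[OF fil_subspace[OF x]] vec.subspace_0[OF U_subspace[OF x]] by simp
  moreover have "\<exists>!d'. splits D U x (\<Sum>p\<in>P. d p) d'"
    using opp x by (simp add: opposite_filtration_def)
  ultimately have "(THE d'. splits D U x (\<Sum>p\<in>P. d p) d') = ?d"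
    by (simp add: the1_equality)
  then show ?thesis by (simp add: proj_def)
qed

lemma proj_component:
  assumes "x \<in> base D" "u \<in> fil D p x" "u \<in> U p x"
  shows "proj D U q x u = (if q = p then u else 0)"
  using proj_sum[OF assms(1), of "{p}" "\<lambda>_. u" q] assms by simp

text \<open>On sections of a single summand \<open>F\<^sup>p \<inter> U\<^sub>p\<close> the connection \<open>\<nabla>\<^sup>U\<close> is the \<open>p\<close>-component of \<open>\<nabla>\<close>.\<close>

lemma covU_component:
  assumes x: "x \<in> base D" and p: "p \<in> {0..3}"
    and s: "\<And>y. y \<in> base D \<Longrightarrow> s y \<in> fil D p y \<and> s y \<in> U p y"
  shows "covU D U i s x = proj D U p x (cov D i s x)"
proof -
  have "proj D U q x (cov D i (\<lambda>y. proj D U q y (s y)) x)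
      = (if q = p then proj D U p x (cov D i s x) else 0)" for q
  proof -
    have "cov D i (\<lambda>y. proj D U q y (s y)) x = cov D i (if q = p then s else (\<lambda>y. 0)) x"
    proof (rule cov_cong[OF open_base x])
      fix y assume y: "y \<in> base D"
      show "proj D U q y (s y) = (if q = p then s else (\<lambda>y. 0)) y"
        using proj_component[OF y, of "s y" p q] s[OF y] by simp
    qed
    then show ?thesis
      using proj_sum[OF x, of "{}" _ q] by auto
  qed
  then show ?thesis using p by (simp add: covU_def)
qed

text \<open>\<open>U\<^sub>0\<close> is flat and coincides with its own component \<open>F\<^sup>0 \<inter> U\<^sub>0\<close>, so here \<open>\<nabla>\<close> and \<open>\<nabla>\<^sup>U\<close> agree.\<close>

lemma cov_v_Last: assumes x: "x \<in> base D" shows "cov D i (v Last) x = 0"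
proof -
  have s: "v Last y \<in> fil D 0 y \<and> v Last y \<in> U 0 y" if "y \<in> base D" for y
    using that v_type fil_bounds by simp
  then have "cov D i (v Last) x \<in> U 0 x" by (intro U_cov v_holo x) auto
  then have "proj D U 0 x (cov D i (v Last) x) = cov D i (v Last) x"
    using proj_component[OF x, of _ 0] fil_bounds[OF x] by simp
  then show ?thesis using covU_component[OF x, of 0 "v Last" i] s v_type(7)[OF x] by simp
qed

text \<open>The derivative stays in the flat bundle \<open>U\<^sub>1\<close>, and its component in \<open>F\<^sup>1 \<inter> U\<^sub>1\<close> is \<open>\<nabla>\<^sup>U v = 0\<close>; only
  the multiples of the last basis section remain.\<close>

lemma cov_v_Dual: assumes x: "x \<in> base D" shows "\<exists>c. cov D i (v (Dual k)) x = c *s v Last x"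
proof -
  let ?w = "cov D i (v (Dual k)) x"
  have s: "v (Dual k) y \<in> fil D 1 y \<and> v (Dual k) y \<in> U 1 y" if "y \<in> base D" for y
    using that v_type by simp
  then have w: "?w \<in> U 1 x" by (intro U_cov v_holo x) auto
  define d where "d = (\<lambda>p::int. if p = 1 then \<Sum>l\<in>UNIV. pair D x (v (Mid l) x) ?w *s v (Dual l) x
      else - pair D x (v I1 x) ?w *s v Last x)"
  have eq: "?w = (\<Sum>p\<in>{0,1}. d p)"
    using U1_expansion[OF x w] by (simp add: sum_option d_def)
  have "d p \<in> fil D p x \<inter> U p x" if "p \<in> {0,1}" for p
    using that v_type[OF x] fil_bounds[OF x] fil_subspace[OF x, of 1] U_subspace[OF x]
    by (auto simp: d_def intro!: vec.subspace_sum vec.subspace_scale vec.subspace_neg)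
  from proj_sum[OF x _ this, of "{0,1}" 1] eq have "proj D U 1 x ?w = d 1" by simp
  then have "d 1 = 0" using covU_component[OF x, of 1 "v (Dual k)" i] s v_type(7)[OF x] by simp
  then show ?thesis using eq unfolding d_def by (intro exI[of _ "- pair D x (v I1 x) ?w"]) simp
qed

text \<open>Griffiths transversality puts the derivative into \<open>F\<^sup>2\<close>, and its component in \<open>F\<^sup>3 \<inter> U\<^sub>3\<close> is
  \<open>\<nabla>\<^sup>U v\<^sub>1 = 0\<close>.\<close>

lemma cov_v_I1: assumes x: "x \<in> base D" shows "cov D i (v I1) x \<in> U 2 x"
proof -
  let ?w = "cov D i (v I1) x"
  have s: "v I1 y \<in> fil D 3 y \<and> v I1 y \<in> U 3 y" if "y \<in> base D" for y
    using that v_type U3 by simp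
  then have w: "?w \<in> fil D 2 x" using fil_transversal[OF v_holo _ x, of I1 3 i] by simp
  define d where "d = (\<lambda>p::int. if p = 2 then \<Sum>l\<in>UNIV. pair D x ?w (v (Dual l) x) *s v (Mid l) x
      else pair D x ?w (- v Last x) *s v I1 x)"
  have eq: "?w = (\<Sum>p\<in>{3,2}. d p)"
    using F2_expansion[OF x w] by (simp add: sum_option d_def)
  have d: "d p \<in> fil D p x \<inter> U p x" if "p \<in> {3,2}" for p
    using that v_type[OF x] U3[OF x] fil_subspace[OF x] U_subspace[OF x, of 2]
    by (auto simp: d_def intro!: vec.subspace_sum vec.subspace_scale)
  from proj_sum[OF x _ this, of "{3,2}" 3] eq have "proj D U 3 x ?w = d 3" by simp
  then have "d 3 = 0" using covU_component[OF x, of 3 "v I1" i] s v_type(7)[OF x] by simp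
  then show ?thesis using eq d[of 2] by simp
qed

lemma v_Last_eq: assumes "x \<in> base D" shows "v Last x = v0 Last x"
  by (rule flat_section_eq[OF _ v0_flat _ bpt assms])
    (simp_all add: flat_section_def v_holo cov_v_Last v0_bpt)

text \<open>The pairings of a flat section \<open>v\<^sup>0\<^sub>n\<^sub>+\<^sub>k\<close> with the adapted basis of \<open>U\<^sub>1\<close> satisfy a triangular system:
  that with the flat last section is constant, hence zero as at the base point, and then so are the others.
  Since \<open>U\<^sub>1\<close> is its own orthogonal complement, the section lies in \<open>U\<^sub>1\<close>.\<close>

lemma fb_in_U1: assumes x: "x \<in> base D" shows "fb x i \<in> U 1 x"
proof (cases i)
  case None
  then show ?thesis using v_Last_eq[OF x] vb_in_U1[OF x, of None] by simp
next
  case (Some k)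
  have hol: "vholo_on (v0 (Dual k)) (base D)" by (rule flat_section_vholo[OF v0_flat])
  have Last: "pair D y (v0 (Dual k) y) (v Last y) = 0" if y: "y \<in> base D" for y
    using flat_pair_const[OF v0_flat v0_flat y bpt] v_gram(5)[OF bpt] by (simp add: v_Last_eq y v0_bpt)
  have Dual: "pair D y (v0 (Dual k) y) (v (Dual l) y) = 0" if y: "y \<in> base D" for y l
  proof -
    have "pair D y (v0 (Dual k) y) (v (Dual l) y) = pair D (bpt D) (v0 (Dual k) (bpt D)) (v (Dual l) (bpt D))"
    proof (rule pair_const[OF hol v_holo _ y bpt])
      fix x j assume x: "x \<in> base D"
      interpret symplectic_form "pair D x" by (rule pair_form[OF x])
      obtain c where "cov D j (v (Dual l)) x = c *s v Last x" using cov_v_Dual[OF x] by blast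
      then show "pair D x (cov D j (v0 (Dual k)) x) (v (Dual l) x)
          + pair D x (v0 (Dual k) x) (cov D j (v (Dual l)) x) = 0"
        by (simp add: flat_section_cov[OF v0_flat x] bilin Last[OF x])
    qed
    then show ?thesis by (simp add: v0_bpt v_gram(4)[OF bpt])
  qed
  interpret symplectic_frame "pair D x" "va x" "vb x" by (rule v_frame[OF x])
  have "pair D x (v0 (Dual k) x) (vb x j) = 0" for j
    by (cases j) (simp_all add: Last[OF x] Dual[OF x] minus_right)
  then have "v0 (Dual k) x \<in> vec.span (range (vb x))" by (rule in_span_b)
  also have "\<dots> \<subseteq> U 1 x" using vb_in_U1[OF x] U_subspace[OF x] by (intro vec.span_minimal) auto
  finally show ?thesis using Some by simp
qed

text \<open>\<open>U\<^sub>1\<close> is isotropic, so its elements pair to zero with \<open>b\<close> and have no components along \<open>a\<close>.\<close>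

lemma span_fb: assumes x: "x \<in> base D" shows "vec.span (range (fb x)) = U 1 x"
proof
  show "vec.span (range (fb x)) \<subseteq> U 1 x"
    using fb_in_U1[OF x] U_subspace[OF x] by (intro vec.span_minimal) auto
  interpret symplectic_frame "pair D x" "fa x" "fb x" by (rule v0_frame[OF x])
  show "U 1 x \<subseteq> vec.span (range (fb x))"
    using U_perp[OF x _ fb_in_U1[OF x]] by (auto intro: in_span_b)
qed

theorem opposite_subbundle_U1: "opposite_subbundle D (U 1)"
  unfolding opposite_subbundle_def
proof (intro conjI ballI allI)
  fix x assume x: "x \<in> base D"
  interpret v0: symplectic_frame "pair D x" "fa x" "fb x" by (rule v0_frame[OF x])
  interpret v: symplectic_frame "pair D x" "va x" "vb x" by (rule v_frame[OF x])
  show "vec.dim (U 1 x) = CARD('n) + 1"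
    using v0.dim_span_b by (simp add: span_fb[OF x])
  show "pair D x u w = 0" if "u \<in> U 1 x" "w \<in> U 1 x" for u w
    using U_perp[OF x that] by simp
  show "fil D 2 x \<inter> U 1 x = {0}"
  proof (intro equalityI subsetI; (elim IntE)?)
    fix u assume u: "u \<in> fil D 2 x" "u \<in> U 1 x"
    show "u \<in> {0}"
      using F2_expansion[OF x u(1)] U_perp[OF x u(2) vb_in_U1[OF x]] by simp
  qed (use vec.subspace_0[OF fil_subspace[OF x]] vec.subspace_0[OF U_subspace[OF x]] in auto)
  fix u
  show "\<exists>f\<in>fil D 2 x. \<exists>w\<in>U 1 x. u = f + w"
  proof (intro bexI)
    show "u = (\<Sum>i\<in>UNIV. pair D x u (vb x i) *s va x i) + (\<Sum>i\<in>UNIV. pair D x (va x i) u *s vb x i)"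
      by (rule v.expansion)
    show "(\<Sum>i\<in>UNIV. pair D x (va x i) u *s vb x i) \<in> U 1 x"
      by (intro vec.subspace_sum vec.subspace_scale U_subspace[OF x] vb_in_U1[OF x])
    show "(\<Sum>i\<in>UNIV. pair D x u (vb x i) *s va x i) \<in> fil D 2 x"
      by (intro vec.subspace_sum vec.subspace_scale fil_subspace[OF x] va_in_F2[OF x])
  qed
qed (rule U_flat)

end

section \<open>The flat symplectic basis and the cone \<open>B\<close>\<close>

lemma flat_symplectic_basisI:
  assumes "\<And>i. flat_section D (a i)" "\<And>i. flat_section D (b i)"
    and frame: "\<And>x. x \<in> base D \<Longrightarrow> symplectic_frame (pair D x) (\<lambda>i. a i x) (\<lambda>i. b i x)"
  shows "flat_symplectic_basis D a b"
  unfolding flat_symplectic_basis_def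
proof (intro conjI allI ballI)
  fix x assume "x \<in> base D"
  then interpret symplectic_frame "pair D x" "\<lambda>i. a i x" "\<lambda>i. b i x" by (rule frame)
  show "inj (\<lambda>i. a i x)" by (rule inj_a)
  show "inj (\<lambda>i. b i x)" by (rule inj_b)
  show "range (\<lambda>i. a i x) \<inter> range (\<lambda>i. b i x) = {}" by (rule disjoint)
  show "vec.independent (range (\<lambda>i. a i x) \<union> range (\<lambda>i. b i x))" by (rule independent)
  show "vec.span (range (\<lambda>i. a i x) \<union> range (\<lambda>i. b i x)) = UNIV" by (rule span)
  fix i j
  show "pair D x (a i x) (b j x) = (if i = j then 1 else 0)" by (rule ab)
  show "pair D x (a i x) (a j x) = 0" by (rule aa)
  show "pair D x (b i x) (b j x) = 0" by (rule bb)
qed (use assms(1,2) in auto)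

context adapted_vhl
begin

theorem symplectic_basis: "flat_symplectic_basis D (\<lambda>i x. fa x i) (\<lambda>i x. fb x i)"
  by (rule flat_symplectic_basisI) (simp_all add: halves_flat v0_frame)

lemma span_fa_bpt: "vec.span (range (fa (bpt D))) = fil D 2 (bpt D)"
proof
  have eq: "fa (bpt D) = va (bpt D)" by (simp add: v0_bpt)
  show "vec.span (range (fa (bpt D))) \<subseteq> fil D 2 (bpt D)"
    unfolding eq using va_in_F2[OF bpt] fil_subspace[OF bpt] by (intro vec.span_minimal) auto
  interpret symplectic_frame "pair D (bpt D)" "va (bpt D)" "vb (bpt D)" by (rule v_frame[OF bpt])
  show "fil D 2 (bpt D) \<subseteq> vec.span (range (fa (bpt D)))"
    unfolding eq using fil_perp[OF bpt va_in_F2[OF bpt]] by (auto intro: in_span_a)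
qed

text \<open>The coefficients of a section of the span of a flat frame are holomorphic, so that the section is
  differentiated by differentiating its coefficients.\<close>

theorem flat_subbundle_fa: "flat_subbundle D (\<lambda>x. vec.span (range (fa x)))"
  unfolding flat_subbundle_def
proof (intro conjI allI impI ballI)
  obtain h :: "nat \<Rightarrow> 'n option" where h: "bij_betw h {..<CARD('n option)} UNIV"
    using ex_bij_betw_nat_finite[of "UNIV :: 'n option set"] by (auto simp: atLeast0LessThan)
  show "holo_subbundle (base D) (\<lambda>x. vec.span (range (fa x)))"
    unfolding holo_subbundle_def
  proof (intro ballI exI conjI allI impI)
    fix x assume "x \<in> base D"
    then show "x \<in> base D" .
    fix j show "vholo_on ((\<lambda>j x. fa x (h j)) j) (base D)"
      by (rule flat_section_vholo[OF halves_flat(1)])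
  next
    fix y assume "y \<in> base D"
    then interpret symplectic_frame "pair D y" "fa y" "fb y" by (rule v0_frame)
    have img: "(\<lambda>j. (\<lambda>j x. fa x (h j)) j y) ` {..<CARD('n option)} = range (fa y)"
      using bij_betw_imp_surj_on[OF h] by (metis image_image)
    show "vec.independent ((\<lambda>j. (\<lambda>j x. fa x (h j)) j y) ` {..<CARD('n option)})"
      unfolding img by (rule vec.independent_mono[OF independent]) auto
    show "vec.span ((\<lambda>j. (\<lambda>j x. fa x (h j)) j y) ` {..<CARD('n option)}) = vec.span (range (fa y))"
      unfolding img ..
    show "inj_on (\<lambda>j. (\<lambda>j x. fa x (h j)) j y) {..<CARD('n option)}"
      using inj_a bij_betw_imp_inj_on[OF h] by (simp add: inj_on_def inj_def)
  qed (auto intro: open_base)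
next
  fix N s i x assume s: "local_section D (\<lambda>x. vec.span (range (fa x))) N s" and x: "x \<in> N"
  then have N: "open N" "N \<subseteq> base D" "vholo_on s N" and mem: "\<And>y. y \<in> N \<Longrightarrow> s y \<in> vec.span (range (fa y))"
    by (auto simp: local_section_def)
  have f: "vholo_on (\<lambda>y. fa y j) N" "vholo_on (\<lambda>y. fb y j) N" for j
    using flat_section_vholo[OF halves_flat(1)] flat_section_vholo[OF halves_flat(2)] N(2) by (blast intro: vholo_on_subset)+
  let ?g = "\<lambda>j y. pair D y (s y) (fb y j)"
  have g: "holo_on (?g j) N" for j by (rule pair_holo[OF N f(2)])
  have eq: "s y = (\<Sum>j\<in>UNIV. ?g j y *s fa y j)" if y: "y \<in> N" for y
  proof -
    interpret symplectic_frame "pair D y" "fa y" "fb y" using N y by (intro v0_frame) auto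
    have "pair D y (fa y j) (s y) = 0" for j
      using mem[OF y]
      by (rule vec.span_induct) (auto simp: vec.subspace_def bilin aa)
    then show ?thesis using expansion[of "s y"] by simp
  qed
  have xb: "x \<in> base D" using N x by auto
  have "cov D i s x = cov D i (\<lambda>y. \<Sum>j\<in>UNIV. ?g j y *s fa y j) x"
    by (rule cov_cong[OF N(1) x eq])
  also have "\<dots> = (\<Sum>j\<in>UNIV. pd i (?g j) x *s fa x j)"
    by (simp add: cov_sum[where N=N] vholo_on_smult f g x cov_smult[OF g f(1) x]
        flat_section_cov[OF halves_flat(1) xb])
  also have "\<dots> \<in> vec.span (range (fa x))"
    by (intro vec.span_sum vec.span_scale vec.span_base) auto
  finally show "cov D i s x \<in> vec.span (range (fa x))" .
qed

lemma v_I1_nonzero: "x \<in> base D \<Longrightarrow> v I1 x \<noteq> 0"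
  using v_gram(1)[of x] symplectic_form.zero_left[OF pair_form[of x]] by force

lemma coneB_iff: "p \<in> coneB D \<longleftrightarrow> (\<exists>x\<in>base D. \<exists>c. c \<noteq> 0 \<and> p = (c *s v I1 x, x))"
proof
  assume "p \<in> coneB D"
  then obtain u x where p: "p = (u, x)" "x \<in> base D" "u \<in> fil D 3 x" "u \<noteq> 0"
    by (auto simp: coneB_def)
  then have "u = - pair D x u (v Last x) *s v I1 x" by (intro F3_expansion)
  with p show "\<exists>x\<in>base D. \<exists>c. c \<noteq> 0 \<and> p = (c *s v I1 x, x)"
    by (metis vector_smult_lzero)
next
  assume "\<exists>x\<in>base D. \<exists>c. c \<noteq> 0 \<and> p = (c *s v I1 x, x)"
  then show "p \<in> coneB D"
    using v_I1_nonzero v_type(1) fil_subspace by (auto simp: coneB_def vec.subspace_scale)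
qed

abbreviation "chart_dom N \<equiv> {x :: complex^('n option). x $ None \<noteq> 0 \<and> (\<chi> i. x $ Some i) \<in> N}"

lemma vholo_Some: "vholo_on (\<lambda>x :: complex^('n option). \<chi> i. x $ Some i) A"
  by (simp add: vholo_on_def holo_on_nth)

lemma open_chart_dom:
  assumes "open N" shows "open (chart_dom N)"
proof -
  have "open ((\<lambda>x :: complex^('n option). \<chi> i. x $ Some i) -` N)"
    by (rule open_vimage[OF assms vholo_on_continuous[OF vholo_Some]])
  moreover have "open ((\<lambda>x :: complex^('n option). x $ None) -` (- {0}))"
    by (rule open_vimage) (auto intro: holo_on_continuous holo_on_nth)
  ultimately have "open (((\<lambda>x :: complex^('n option). \<chi> i. x $ Some i) -` N) \<inter> ((\<lambda>x. x $ None) -` (- {0})))"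
    by (rule open_Int)
  also have "\<dots> = chart_dom N" by auto
  finally show ?thesis .
qed

text \<open>Any other trivialisation of \<open>F\<^sup>3\<close> differs from \<open>v\<^sub>1\<close> by a nowhere vanishing holomorphic factor,
  so holomorphy on \<open>B\<close> may be tested in the trivialisation by \<open>v\<^sub>1\<close> alone.\<close>

lemma holo_on_B_iff:
  "holo_on_B D f \<longleftrightarrow> holo_on (\<lambda>x. f (x $ None *s v I1 (\<chi> i. x $ Some i), \<chi> i. x $ Some i)) (chart_dom (base D))"
  (is "_ \<longleftrightarrow> holo_on ?f _")
proof
  assume "holo_on_B D f"
  moreover have "local_section D (fil D 3) (base D) (v I1)"
    by (simp add: local_section_def open_base v_holo v_type)
  ultimately show "holo_on ?f (chart_dom (base D))"
    using v_I1_nonzero by (simp only: holo_on_B_def) simp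
next
  assume f: "holo_on ?f (chart_dom (base D))"
  show "holo_on_B D f"
    unfolding holo_on_B_def
  proof (intro allI impI, elim conjE)
    fix N s assume s: "local_section D (fil D 3) N s" and nz: "\<forall>y\<in>N. s y \<noteq> 0"
    from s have N: "open N" "N \<subseteq> base D" "vholo_on s N" and mem: "\<And>y. y \<in> N \<Longrightarrow> s y \<in> fil D 3 y"
      by (auto simp: local_section_def)
    define g where "g = (\<lambda>y. - pair D y (s y) (v Last y))"
    have g: "holo_on g N"
      unfolding g_def by (intro holo_on_minus pair_holo N vholo_on_subset[OF v_holo])
    have eq: "s y = g y *s v I1 y" if "y \<in> N" for y
      unfolding g_def using that N(2) mem by (intro F3_expansion) auto
    have gnz: "g y \<noteq> 0" if "y \<in> N" for y
      using eq[OF that] nz that by auto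
    let ?\<pi> = "\<lambda>x :: complex^('n option). \<chi> i. x $ Some i"
    \<comment> \<open>the change of trivialisation from \<open>s = g v\<^sub>1\<close> to \<open>v\<^sub>1\<close>\<close>
    let ?h = "\<lambda>x :: complex^('n option). \<chi> i. case i of None \<Rightarrow> x $ None * g (?\<pi> x) | Some k \<Rightarrow> x $ Some k"
    have "holo_on (\<lambda>x. g (?\<pi> x)) (chart_dom N)"
      by (rule holo_on_compose[OF g vholo_Some]) auto
    then have "vholo_on ?h (chart_dom N)"
      unfolding vholo_on_def
      by (intro allI, rename_tac i, case_tac i) (simp_all add: holo_on_mult holo_on_nth)
    moreover have "?h ` chart_dom N \<subseteq> chart_dom (base D)"
      using gnz N(2) by auto
    ultimately have "holo_on (\<lambda>x. ?f (?h x)) (chart_dom N)"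
      by (rule holo_on_compose[OF f])
    then show "holo_on (\<lambda>x. f (x $ None *s s (?\<pi> x), ?\<pi> x)) (chart_dom N)"
      by (rule holo_on_cong[OF _ open_chart_dom[OF N(1)]]) (simp add: eq)
  qed
qed

lemma flat_shift_eq:
  assumes x: "x \<in> base D"
  shows "flat_shift D ((\<Sum>i\<in>UNIV. \<alpha> i *s fa x i) + (\<Sum>i\<in>UNIV. \<beta> i *s fb x i), x)
    = (\<Sum>i\<in>UNIV. \<alpha> i *s fa (bpt D) i) + (\<Sum>i\<in>UNIV. \<beta> i *s fb (bpt D) i)"
  unfolding flat_shift_def
proof (rule the_equality)
  let ?s = "\<lambda>y. (\<Sum>i\<in>UNIV. \<alpha> i *s fa y i) + (\<Sum>i\<in>UNIV. \<beta> i *s fb y i)"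
  have s: "flat_section D ?s"
    by (intro flat_section_add flat_section_sum flat_section_smult halves_flat)
  then show "\<exists>s. flat_section D s \<and> s (snd (?s x, x)) = fst (?s x, x) \<and> s (bpt D) = ?s (bpt D)"
    by (intro exI[of _ ?s]) simp
  fix \<mu> assume "\<exists>s. flat_section D s \<and> s (snd (?s x, x)) = fst (?s x, x) \<and> s (bpt D) = \<mu>"
  then obtain s' where s': "flat_section D s'" "s' x = ?s x" "s' (bpt D) = \<mu>" by auto
  show "\<mu> = ?s (bpt D)"
    using flat_section_eq[OF s'(1) s s'(2) x bpt] s'(3) by simp
qed

text \<open>A section \<open>g v\<^sub>1\<close> of \<open>F\<^sup>3\<close> is flat modulo \<open>U\<^sub>2\<close> exactly if \<open>g\<close> is constant.  The function \<open>g\<close> is seen by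
  pairing with the flat section \<open>v\<^sub>2\<^sub>n\<^sub>+\<^sub>2\<close> of \<open>U\<^sub>0\<close>, the orthogonal complement of \<open>U\<^sub>2\<close>.\<close>

lemma PU2_eq:
  assumes x: "x \<in> base D"
  shows "PU2 D (U 2) (c *s v I1 x, x) = (c *s v0 I1 (bpt D), x)"
proof -
  let ?P = "\<lambda>\<mu> s. local_section D (fil D 3) (base D) s \<and> (\<forall>y\<in>base D. \<forall>i. cov D i s y \<in> U 2 y)
    \<and> s (snd (c *s v I1 x, x)) = fst (c *s v I1 x, x) \<and> s (bpt D) = \<mu>"
  have "(THE \<mu>. \<exists>s. ?P \<mu> s) = c *s v0 I1 (bpt D)"
  proof (rule the_equality)
    have "?P (c *s v0 I1 (bpt D)) (\<lambda>y. c *s v I1 y)"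
      using vholo_on_smult[OF holo_on_const v_holo] v_type(1) fil_subspace U_subspace cov_v_I1
      by (simp add: local_section_def open_base v0_bpt vec.subspace_scale
          cov_smult[OF holo_on_const v_holo])
    then show "\<exists>s. ?P (c *s v0 I1 (bpt D)) s"
      by (rule exI[where P="?P (c *s v0 I1 (bpt D))" and x="\<lambda>y. c *s v I1 y"])
    fix \<mu> assume "\<exists>s. ?P \<mu> s"
    then obtain s where ls: "local_section D (fil D 3) (base D) s"
      and cov: "\<And>y i. y \<in> base D \<Longrightarrow> cov D i s y \<in> U 2 y" and sx: "s x = c *s v I1 x" and \<mu>: "s (bpt D) = \<mu>"
      by auto
    from ls have s: "vholo_on s (base D)" "\<And>y. y \<in> base D \<Longrightarrow> s y \<in> fil D 3 y"
      by (auto simp: local_section_def)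
    have "pair D (bpt D) (s (bpt D)) (v Last (bpt D)) = pair D x (s x) (v Last x)"
    proof (rule pair_const[OF s(1) v_holo _ bpt x])
      fix y i assume y: "y \<in> base D"
      interpret symplectic_form "pair D y" by (rule pair_form[OF y])
      show "pair D y (cov D i s y) (v Last y) + pair D y (s y) (cov D i (v Last) y) = 0"
        using U_perp[OF y cov[OF y] v_type(6)[OF y]] by (simp add: cov_v_Last[OF y])
    qed
    also have "\<dots> = - c"
      by (simp add: sx symplectic_form.scale_left[OF pair_form[OF x]] v_gram(1)[OF x])
    finally show "\<mu> = c *s v0 I1 (bpt D)"
      using F3_expansion[OF bpt s(2)[OF bpt]] \<mu> by (simp add: v0_bpt)
  qed
  then show ?thesis by (simp only: PU2_def snd_conv)
qed

end

section \<open>Special coordinates and the hyperplane \<open>z\<^sub>1 = 1\<close>\<close>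

locale special_vhl = adapted_vhl D U v v0
  for D :: "('n::finite, 'm::finite) vhf" and U v v0 +
  fixes t :: "complex^'n \<Rightarrow> complex^'n" and \<Psi> :: "complex^'n \<Rightarrow> complex"
    and z w :: "(complex^'m) \<times> (complex^'n) \<Rightarrow> complex^('n option)"
  assumes frob: "frobenius_data D v v0 t \<Psi>"
    and taut: "taut_expansion D (\<lambda>i x. fa x i) (\<lambda>i x. fb x i) z w"
begin

lemma t_holo: "vholo_on t (base D)" and t_inj: "inj_on t (base D)" and t_open: "open (t ` base D)"
  and t_inv_holo: "vholo_on (inv_into (base D) t) (t ` base D)" and \<Psi>_holo: "holo_on \<Psi> (base D)"
  using frob by (auto simp: frobenius_data_def coordinates_on_def)

text \<open>The coefficients of \<open>v\<^sub>1\<close> along \<open>a\<close>, that is, the special coordinates of the point \<open>(v\<^sub>1(x), x)\<close> of \<open>B\<close>.\<close>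

definition tz :: "complex^'n \<Rightarrow> complex^('n option)" where
  "tz x = (\<chi> i. case i of None \<Rightarrow> 1 | Some k \<Rightarrow> t x $ k)"

text \<open>The coefficients of \<open>v\<^sub>1\<close> along \<open>b\<close>; the sign of the first one comes from \<open>b\<^sub>1 = -v\<^sup>0\<^sub>2\<^sub>n\<^sub>+\<^sub>2\<close>.\<close>

definition tw :: "complex^'n \<Rightarrow> complex^('n option)" where
  "tw x = (\<chi> i. case i of
      None \<Rightarrow> 2 * \<Psi> x - (\<Sum>k\<in>UNIV. t x $ k * coord_deriv t (base D) k \<Psi> x)
    | Some k \<Rightarrow> coord_deriv t (base D) k \<Psi> x)"

lemma v_I1_expansion:
  assumes "x \<in> base D"
  shows "v I1 x = (\<Sum>i\<in>UNIV. tz x $ i *s fa x i) + (\<Sum>i\<in>UNIV. tw x $ i *s fb x i)"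
  using frob assms
  by (simp add: frobenius_data_def sum_option tz_def tw_def vec.scale_left_diff_distrib)

lemma zw_cone:
  assumes x: "x \<in> base D" and c: "c \<noteq> 0"
  shows "z (c *s v I1 x, x) = c *s tz x" and "w (c *s v I1 x, x) = c *s tw x"
proof -
  interpret symplectic_frame "pair D x" "fa x" "fb x" by (rule v0_frame[OF x])
  have "(c *s v I1 x, x) \<in> coneB D" using assms by (auto simp: coneB_iff)
  then have 1: "c *s v I1 x = (\<Sum>i\<in>UNIV. z (c *s v I1 x, x) $ i *s fa x i)
      + (\<Sum>i\<in>UNIV. w (c *s v I1 x, x) $ i *s fb x i)"
    using taut unfolding taut_expansion_def by force
  have 2: "c *s v I1 x = (\<Sum>i\<in>UNIV. (c *s tz x) $ i *s fa x i) + (\<Sum>i\<in>UNIV. (c *s tw x) $ i *s fb x i)"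
    by (subst v_I1_expansion[OF x])
      (simp only: vec.scale_right_distrib vec.scale_sum_right vec.scale_scale vector_smult_component)
  show "z (c *s v I1 x, x) = c *s tz x" "w (c *s v I1 x, x) = c *s tw x"
    using coefficients[OF 1] coefficients[OF 2] by (simp_all add: vec_eq_iff)
qed

text \<open>Since \<open>z = c (1, t)\<close> on \<open>B\<close>, the ratios of the special coordinates are \<open>t\<close>, and they determine the base
  point; a point of the coordinate space comes from \<open>B\<close> if its ratios come from \<open>B\<^sub>0\<close>.\<close>

definition ratio :: "complex^('n option) \<Rightarrow> complex^'n" where
  "ratio y = (\<chi> k. y $ Some k / y $ None)"

definition zdom :: "(complex^('n option)) set" where
  "zdom = {y. y $ None \<noteq> 0 \<and> ratio y \<in> t ` base D}"

definition zbase :: "complex^('n option) \<Rightarrow> complex^'n" where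
  "zbase y = inv_into (base D) t (ratio y)"

lemma ratio_tz: "c \<noteq> 0 \<Longrightarrow> ratio (c *s tz x) = t x"
  by (simp add: ratio_def tz_def vec_eq_iff)

lemma zbase_tz: "x \<in> base D \<Longrightarrow> c \<noteq> 0 \<Longrightarrow> zbase (c *s tz x) = x"
  by (simp add: zbase_def ratio_tz inv_into_f_f t_inj)

lemma zdom_iff: "y \<in> zdom \<longleftrightarrow> (\<exists>x\<in>base D. \<exists>c. c \<noteq> 0 \<and> y = c *s tz x)"
proof
  assume "y \<in> zdom"
  then obtain x where x: "x \<in> base D" "ratio y = t x" and 0: "y $ None \<noteq> 0"
    by (auto simp: zdom_def)
  have "y $ i = (y $ None *s tz x) $ i" for i
  proof (cases i)
    case (Some k)
    have "t x $ k = y $ Some k / y $ None" by (simp add: ratio_def flip: x(2))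
    then show ?thesis using Some 0 by (simp add: tz_def)
  qed (simp add: tz_def)
  then have "y = y $ None *s tz x" by (subst vec_eq_iff) (rule allI)
  with 0 have "\<exists>c. c \<noteq> 0 \<and> y = c *s tz x" by (intro exI conjI)
  with x(1) show "\<exists>x\<in>base D. \<exists>c. c \<noteq> 0 \<and> y = c *s tz x" by (rule bexI[rotated])
next
  assume "\<exists>x\<in>base D. \<exists>c. c \<noteq> 0 \<and> y = c *s tz x"
  then obtain x c where "x \<in> base D" "c \<noteq> 0" "y = c *s tz x" by blast
  then show "y \<in> zdom" by (simp add: zdom_def ratio_tz) (simp add: tz_def)
qed

lemma z_image: "z ` coneB D = zdom"
proof (intro set_eqI iffI)
  fix y assume "y \<in> z ` coneB D"
  then obtain x c where x: "x \<in> base D" "c \<noteq> 0" "y = z (c *s v I1 x, x)"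
    by (auto simp: coneB_iff)
  then have "y = c *s tz x" by (simp add: zw_cone)
  with x show "y \<in> zdom" unfolding zdom_iff by blast
next
  fix y assume "y \<in> zdom"
  then obtain x c where x: "x \<in> base D" "c \<noteq> 0" "y = c *s tz x" by (auto simp: zdom_iff)
  then have "y = z (c *s v I1 x, x)" by (simp add: zw_cone)
  moreover have "(c *s v I1 x, x) \<in> coneB D" using x by (auto simp: coneB_iff)
  ultimately show "y \<in> z ` coneB D" by (rule image_eqI)
qed

lemma z_inverse: 
  assumes "x \<in> base D" "c \<noteq> 0"
  shows "(zbase (z (c *s v I1 x, x)) = x)" "z (c *s v I1 x, x) $ None = c"
  using assms by (simp_all add: zw_cone zbase_tz) (simp add: tz_def)

lemma z_inj: "inj_on z (coneB D)"
proof (rule inj_onI)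
  fix p q assume "p \<in> coneB D" "q \<in> coneB D" and eq: "z p = z q"
  then obtain x c y d where p: "x \<in> base D" "c \<noteq> 0" "p = (c *s v I1 x, x)"
    and q: "y \<in> base D" "d \<noteq> 0" "q = (d *s v I1 y, y)" by (auto simp: coneB_iff)
  show "p = q"
    using z_inverse[OF p(1,2)] z_inverse[OF q(1,2)] eq by (simp add: p(3) q(3))
qed

lemma z_inv_eq: assumes "y \<in> zdom" shows "inv_into (coneB D) z y = (y $ None *s v I1 (zbase y), zbase y)"
proof -
  obtain x c where x: "x \<in> base D" "c \<noteq> 0" "y = c *s tz x" using assms by (auto simp: zdom_iff)
  then have y: "y = z (c *s v I1 x, x)" by (simp add: zw_cone)
  have "(c *s v I1 x, x) \<in> coneB D" using x by (auto simp: coneB_iff)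
  then have "inv_into (coneB D) z y = (c *s v I1 x, x)"
    unfolding y by (rule inv_into_f_f[OF z_inj])
  then show ?thesis using z_inverse[OF x(1,2)] by (simp add: y)
qed

lemma ratio_holo: "vholo_on ratio {y. y $ None \<noteq> 0}"
  unfolding vholo_on_def ratio_def vec_lambda_beta
  by (intro allI holo_on_divide holo_on_nth) simp

lemma zdom_open: "open zdom"
proof -
  have "open ((\<lambda>y :: complex^('n option). y $ None) -` (- {0}))"
    by (rule open_vimage) (auto intro: holo_on_continuous holo_on_nth)
  then have "open {y :: complex^('n option). y $ None \<noteq> 0}" by (simp add: vimage_def)
  from continuous_open_preimage[OF vholo_on_continuous[OF ratio_holo] this t_open]
  have "open ({y. y $ None \<noteq> 0} \<inter> ratio -` t ` base D)" .
  also have "{y. y $ None \<noteq> 0} \<inter> ratio -` t ` base D = zdom"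
    unfolding zdom_def by blast
  finally show ?thesis .
qed

lemma zbase_holo: "vholo_on zbase zdom"
  unfolding zbase_def
  by (rule vholo_on_compose[OF t_inv_holo vholo_on_subset[OF ratio_holo]]) (auto simp: zdom_def)

lemma zbase_in: "y \<in> zdom \<Longrightarrow> zbase y \<in> base D"
  by (auto simp: zdom_def zbase_def inv_into_into)

theorem coordinates_on_B_z: "coordinates_on_B D z"
  unfolding coordinates_on_B_def z_image
proof (intro conjI allI)
  fix i :: "'n option"
  have tS: "holo_on (\<lambda>x. t (\<chi> i. x $ Some i) $ k) (chart_dom (base D))" for k
    by (rule holo_on_compose[OF vholo_onD[OF t_holo] vholo_Some]) auto
  have "holo_on (\<lambda>x :: complex^('n option). x $ None * (case i of None \<Rightarrow> 1 | Some k \<Rightarrow> t (\<chi> i. x $ Some i) $ k))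
      (chart_dom (base D))"
    by (cases i) (simp_all add: holo_on_nth holo_on_mult tS)
  then show "holo_on_B D (\<lambda>p. z p $ i)"
    unfolding holo_on_B_iff
    by (rule holo_on_cong[OF _ open_chart_dom[OF open_base]]) (simp add: zw_cone tz_def)
  show "vholo_on (\<lambda>y. fst (inv_into (coneB D) z y)) zdom"
    unfolding vholo_on_def
  proof
    fix j
    have "holo_on (\<lambda>y. y $ None * v I1 (zbase y) $ j) zdom"
      by (intro holo_on_mult holo_on_nth holo_on_compose[OF vholo_onD[OF v_holo] zbase_holo])
        (use zbase_in in auto)
    then show "holo_on (\<lambda>y. fst (inv_into (coneB D) z y) $ j) zdom"
      by (rule holo_on_cong[OF _ zdom_open]) (simp add: z_inv_eq)
  qed
  show "vholo_on (\<lambda>y. snd (inv_into (coneB D) z y)) zdom"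
    unfolding vholo_on_def
    by (intro allI holo_on_cong[OF vholo_onD[OF zbase_holo] zdom_open]) (simp add: z_inv_eq)
qed (rule z_inj zdom_open)+

lemma hyperplane_eq: "hyperplane_z1 D z = (\<lambda>x. (v I1 x, x)) ` base D"
proof (intro set_eqI iffI)
  fix p assume "p \<in> hyperplane_z1 D z"
  then show "p \<in> (\<lambda>x. (v I1 x, x)) ` base D"
    by (auto simp: hyperplane_z1_def coneB_iff z_inverse)
next
  fix p assume "p \<in> (\<lambda>x. (v I1 x, x)) ` base D"
  then obtain x where x: "x \<in> base D" "p = (1 *s v I1 x, x)" by auto
  then have "p \<in> coneB D" unfolding coneB_iff using one_neq_zero by blast
  then show "p \<in> hyperplane_z1 D z"
    using z_inverse(2)[OF x(1) one_neq_zero] x(2) by (simp add: hyperplane_z1_def)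
qed

lemma hyperplane_emb_eq: "x \<in> base D \<Longrightarrow> hyperplane_emb D z x = (v I1 x, x)"
  unfolding hyperplane_emb_def hyperplane_eq by (rule the_equality) auto

lemma emb_continuous: "continuous_on (base D) (hyperplane_emb D z)"
proof -
  have "continuous_on (base D) (\<lambda>x. (v I1 x, x))"
    by (intro continuous_on_Pair vholo_on_continuous[OF v_holo] continuous_on_id)
  then show ?thesis by (rule continuous_on_eq) (simp add: hyperplane_emb_eq)
qed

text \<open>On \<open>(c v\<^sub>1(x), x)\<close> both conditions say that \<open>c = 1\<close>.\<close>

lemma PU2_preimage:
  assumes "v0 I1 (bpt D) = lam0" "lam0 \<noteq> 0"
  shows "{p \<in> coneB D. PU2 D (U 2) p \<in> {lam0} \<times> base D} = hyperplane_z1 D z"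
proof -
  have "(PU2 D (U 2) p \<in> {lam0} \<times> base D) = (z p $ None = 1)" if p: "p \<in> coneB D" for p
  proof -
    obtain x c where x: "x \<in> base D" "c \<noteq> 0" "p = (c *s v I1 x, x)"
      using p by (auto simp: coneB_iff)
    have "c *s lam0 = lam0 \<longleftrightarrow> c = 1"
      using vec.scale_cancel_right[of c lam0 1] assms(2) by simp
    then show ?thesis using x by (simp add: PU2_eq z_inverse assms(1))
  qed
  then show ?thesis unfolding hyperplane_z1_def by (intro Collect_cong conj_cong refl)
qed

text \<open>The embedding is the graph of \<open>v\<^sub>1\<close>, with the bundle projection as left inverse.\<close>

theorem hyperplane_embedding:
  shows "bij_betw snd (hyperplane_z1 D z) (base D)"
    and "hyperplane_emb D z ` base D = hyperplane_z1 D z"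
    and "\<forall>x\<in>base D. snd (hyperplane_emb D z x) = x"
    and "holo_embedding (base D) (hyperplane_emb D z)"
proof -
  let ?\<iota> = "hyperplane_emb D z"
  have eq: "?\<iota> x = (v I1 x, x)" if "x \<in> base D" for x by (rule hyperplane_emb_eq[OF that])
  show "bij_betw snd (hyperplane_z1 D z) (base D)"
    unfolding hyperplane_eq bij_betw_def by (auto simp: inj_on_def image_image)
  show img: "?\<iota> ` base D = hyperplane_z1 D z"
    unfolding hyperplane_eq by (rule image_cong) (simp_all add: eq)
  show snd: "\<forall>x\<in>base D. snd (?\<iota> x) = x" by (simp add: eq)
  show "holo_embedding (base D) ?\<iota>"
    unfolding holo_embedding_def
  proof (intro conjI ballI allI impI)
    show "vholo_on (\<lambda>x. fst (?\<iota> x)) (base D)"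
      unfolding vholo_on_def
      by (intro allI holo_on_cong[OF vholo_onD[OF v_holo] open_base]) (simp add: eq)
    show "vholo_on (\<lambda>x. snd (?\<iota> x)) (base D)"
      unfolding vholo_on_def
      by (intro allI holo_on_cong[OF holo_on_nth open_base]) (simp add: eq)
    fix x h assume x: "x \<in> base D"
      and h: "(\<Sum>i\<in>UNIV. h $ i *s vpd i (\<lambda>y. fst (?\<iota> y)) x) = 0 \<and>
         (\<Sum>i\<in>UNIV. h $ i *s vpd i (\<lambda>y. snd (?\<iota> y)) x) = 0"
    have "vpd i (\<lambda>y. snd (?\<iota> y)) x = vpd i (\<lambda>y. y) x" for i
      by (rule vpd_cong[OF open_base x]) (simp add: eq)
    also have "vpd i (\<lambda>y. y) x = axis i 1" for i
      by (auto simp: vpd_def axis_def vec_eq_iff)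
    finally have "(\<Sum>i\<in>UNIV. h $ i *s axis i 1) = 0" using h by simp
    then show "h = 0" by (simp only: basis_expansion)
  next
    note emb_continuous
    then show "\<exists>\<kappa>. homeomorphism (base D) (?\<iota> ` base D) ?\<iota> \<kappa>"
      by (intro exI[of _ snd] homeomorphismI) (auto simp: eq intro: continuous_intros)
  qed
qed

lemma z_emb: "x \<in> base D \<Longrightarrow> z (hyperplane_emb D z x) = tz x"
  and w_emb: "x \<in> base D \<Longrightarrow> w (hyperplane_emb D z x) = tw x"
  using zw_cone[of x 1] by (simp_all add: hyperplane_emb_eq)

lemma emb_in_cone: "x \<in> base D \<Longrightarrow> hyperplane_emb D z x \<in> coneB D"
  using hyperplane_embedding(2) by (auto simp: hyperplane_z1_def)

end

section \<open>Flat structures and prepotentials\<close>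

lemma linear_formI:
  fixes l :: "complex^'k::finite \<Rightarrow> complex"
  assumes "\<And>u v. l (u + v) = l u + l v" "\<And>c u. l (c *s u) = c * l u"
  shows "Vector_Spaces.linear (*s) (*) l"
  using assms by (simp add: Vector_Spaces.linear_iff vec.vector_space_axioms
      vector_space_over_itself.vector_space_axioms)

lemma linear_form_add: "Vector_Spaces.linear (*s) (*) l \<Longrightarrow> l (u + v) = l u + l v"
  and linear_form_scale: "Vector_Spaces.linear (*s) (*) l \<Longrightarrow> l (c *s u) = c * l u"
  for l :: "complex^'k::finite \<Rightarrow> complex"
  by (auto simp: Vector_Spaces.linear_iff)

lemma linear_form_sum:
  fixes l :: "complex^'k::finite \<Rightarrow> complex"
  assumes l: "Vector_Spaces.linear (*s) (*) l"
  shows "l (\<Sum>i\<in>I. c i *s u i) = (\<Sum>i\<in>I. c i * l (u i))"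
proof -
  have "l 0 = 0" using linear_form_scale[OF l, of 0 0] by simp
  then show ?thesis
    by (induction I rule: infinite_finite_induct) (simp_all add: linear_form_add[OF l] linear_form_scale[OF l])
qed

lemma flat_structure_iff:
  "(W, f) \<in> flat_structure X dev L \<longleftrightarrow> openin (top_of_set X) W \<and>
     (\<forall>x\<in>W. \<exists>N. openin (top_of_set X) N \<and> x \<in> N \<and> N \<subseteq> W \<and> (\<exists>l\<in>L. \<exists>c. \<forall>y\<in>N. f y = c + l (dev y)))"
  by (simp add: flat_structure_def)

lemma flat_structure_global: "l \<in> L \<Longrightarrow> (X, \<lambda>x. c + l (dev x)) \<in> flat_structure X dev L"
  unfolding flat_structure_iff using openin_subtopology_self by blast

text \<open>The affine chart of projective space, in which quadratic forms become the polynomials of degree at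
  most two.\<close>

definition affine_point :: "complex^'n \<Rightarrow> complex^('n option)" where
  "affine_point x = (\<chi> i. case i of None \<Rightarrow> 1 | Some k \<Rightarrow> x $ k)"

lemma affine_point_nth [simp]: "affine_point x $ None = 1" "affine_point x $ Some k = x $ k"
  by (simp_all add: affine_point_def)

lemma quadratic_affine_point:
  "(\<Sum>i\<in>UNIV. \<Sum>j\<in>UNIV. m i j * affine_point x $ i * affine_point x $ j)
    = m None None + (\<Sum>k\<in>UNIV. (m None (Some k) + m (Some k) None) * x $ k)
      + (\<Sum>i\<in>UNIV. \<Sum>j\<in>UNIV. m (Some i) (Some j) * x $ i * x $ j)"
  for x :: "complex^'n::finite"
  by (simp add: sum_option sum.distrib distrib_right add_ac)

lemma dehomogenize:
  fixes q :: "complex^('n::finite option) \<Rightarrow> complex"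
  assumes "q \<in> poly_hom2" shows "\<exists>q'\<in>poly_le2. \<forall>x. q (affine_point x) = q' x"
proof -
  obtain m where q: "q = (\<lambda>x. \<Sum>i\<in>UNIV. \<Sum>j\<in>UNIV. m i j * x $ i * x $ j)"
    using assms unfolding poly_hom2_def by blast
  let ?q = "\<lambda>x. m None None + (\<Sum>k\<in>UNIV. (m None (Some k) + m (Some k) None) * x $ k)
      + (\<Sum>i\<in>UNIV. \<Sum>j\<in>UNIV. m (Some i) (Some j) * x $ i * x $ j)"
  have "?q \<in> poly_le2"
    unfolding poly_le2_def by (intro CollectI exI) (rule refl)
  moreover have "\<forall>x. q (affine_point x) = ?q x"
    unfolding q by (intro allI quadratic_affine_point)
  ultimately show ?thesis by (intro bexI[of _ ?q])
qed

lemma homogenize: 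
  fixes q' :: "complex^'n::finite \<Rightarrow> complex"
  assumes "q' \<in> poly_le2" shows "\<exists>q\<in>poly_hom2. \<forall>x. q (affine_point x) = q' x"
proof -
  obtain c l m where q': "q' = (\<lambda>x. c + (\<Sum>i\<in>UNIV. l i * x $ i) + (\<Sum>i\<in>UNIV. \<Sum>j\<in>UNIV. m i j * x $ i * x $ j))"
    using assms unfolding poly_le2_def by blast
  define M :: "'n option \<Rightarrow> 'n option \<Rightarrow> complex" where
    "M = (\<lambda>i j. case i of None \<Rightarrow> (case j of None \<Rightarrow> c | Some k \<Rightarrow> l k)
        | Some k \<Rightarrow> (case j of None \<Rightarrow> 0 | Some k' \<Rightarrow> m k k'))"
  have "(\<Sum>i\<in>UNIV. \<Sum>j\<in>UNIV. M i j * affine_point x $ i * affine_point x $ j) = q' x" for x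
    unfolding quadratic_affine_point by (simp add: M_def q')
  then show ?thesis
    unfolding poly_hom2_def
    by (intro bexI[of _ "\<lambda>x. \<Sum>i\<in>UNIV. \<Sum>j\<in>UNIV. M i j * x $ i * x $ j"]) auto
qed

context special_vhl
begin

lemma tz_affine: "tz x = affine_point (t x)"
  by (simp add: tz_def affine_point_def)

lemma flat_shift_emb:
  assumes x: "x \<in> base D"
  shows "flat_shift D (hyperplane_emb D z x)
    = (\<Sum>i\<in>UNIV. tz x $ i *s fa (bpt D) i) + (\<Sum>i\<in>UNIV. tw x $ i *s fb (bpt D) i)"
  unfolding hyperplane_emb_eq[OF x] by (subst v_I1_expansion[OF x]) (rule flat_shift_eq[OF x])

text \<open>Flat linear functions on \<open>B\<close> annihilate \<open>U\<^sub>1\<close>, so on the hyperplane they only see the part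
  \<open>v\<^sub>1(0) + \<Sum> t\<^sub>k v\<^sub>k(0)\<close> of the shifted vector.\<close>

lemma form_flat_shift_emb:
  assumes x: "x \<in> base D" and l: "Vector_Spaces.linear (*s) (*) l" and l0: "\<forall>u\<in>U 1 (bpt D). l u = 0"
  shows "l (flat_shift D (hyperplane_emb D z x))
    = l (v0 I1 (bpt D)) + (\<Sum>k\<in>UNIV. t x $ k * l (v0 (Mid k) (bpt D)))"
proof -
  have "l (fb (bpt D) i) = 0" for i using l0 fb_in_U1[OF bpt] by blast
  moreover have "l (flat_shift D (hyperplane_emb D z x))
      = (\<Sum>i\<in>UNIV. tz x $ i * l (fa (bpt D) i)) + (\<Sum>i\<in>UNIV. tw x $ i * l (fb (bpt D) i))"
    by (simp only: flat_shift_emb[OF x] linear_form_add[OF l] linear_form_sum[OF l])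
  ultimately show ?thesis by (simp only: mult_zero_right sum.neutral_const) (simp add: sum_option tz_def)
qed

text \<open>On the hyperplane the flat functions of \<open>B\<close> are affine functions of \<open>t\<close>; conversely, every linear form
  in \<open>t\<close> extends to a linear form on \<open>\<V>\<^sub>0/(U\<^sub>1)\<^sub>0\<close>.\<close>

theorem flat_structures_agree:
  "flat_structure_coord (base D) t
    = inherited_flat_structure (base D) (hyperplane_emb D z) (flat_structure_B D (U 1))"
proof -
  let ?\<iota> = "hyperplane_emb D z"
  let ?L = "{l. Vector_Spaces.linear (*s) (*) l \<and> (\<forall>u\<in>U 1 (bpt D). l u = 0)}"
  let ?top = "top_of_set (base D)"
  interpret symplectic_frame "pair D (bpt D)" "fa (bpt D)" "fb (bpt D)" by (rule v0_frame[OF bpt])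
  define A where "A = (\<lambda>N f. \<exists>l\<in>{l. Vector_Spaces.linear (*s) (*) l}. \<exists>c. \<forall>y\<in>N. f y = c + l (t y))"
  define B where "B = (\<lambda>N f. \<exists>(W', g)\<in>flat_structure_B D (U 1). ?\<iota> ` N \<subseteq> W' \<and> (\<forall>y\<in>N. f y = g (?\<iota> y)))"
  have AB: "B N f" if N: "openin ?top N" and A: "A N f" for N f
  proof -
    from A[unfolded A_def]
    obtain l c where l: "Vector_Spaces.linear (*s) (*) l" and f: "\<And>y. y \<in> N \<Longrightarrow> f y = c + l (t y)"
      by blast
    have sub: "N \<subseteq> base D" using openin_imp_subset[OF N] .
    \<comment> \<open>pairing with \<open>v\<^sub>n\<^sub>+\<^sub>k(0)\<close> reads off the coefficient of \<open>v\<^sub>k(0)\<close>, so \<open>?l\<close> is \<open>l\<close> in those coordinates of \<open>\<V>\<^sub>0/(U\<^sub>1)\<^sub>0\<close>\<close>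
    let ?l = "\<lambda>u. l (\<chi> k. pair D (bpt D) u (v0 (Dual k) (bpt D)))"
    have vec: "(\<chi> k. pair D (bpt D) (u + u') (v0 (Dual k) (bpt D)))
        = (\<chi> k. pair D (bpt D) u (v0 (Dual k) (bpt D))) + (\<chi> k. pair D (bpt D) u' (v0 (Dual k) (bpt D)))"
      "(\<chi> k. pair D (bpt D) (a *s u) (v0 (Dual k) (bpt D)))
        = a *s (\<chi> k. pair D (bpt D) u (v0 (Dual k) (bpt D)))" for u u' a
      by (simp_all add: vec_eq_iff add_left scale_left)
    have "?l u = 0" if u: "u \<in> U 1 (bpt D)" for u
    proof -
      have "(\<chi> k. pair D (bpt D) u (v0 (Dual k) (bpt D))) = 0"
        using U_perp[OF bpt u fb_in_U1[OF bpt, of "Some _"]] by (simp add: vec_eq_iff)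
      then show ?thesis using linear_form_scale[OF l, of 0 0] by simp
    qed
    moreover have "Vector_Spaces.linear (*s) (*) ?l"
      by (rule linear_formI) (simp_all only: vec linear_form_add[OF l] linear_form_scale[OF l])
    ultimately have "?l \<in> ?L" by blast
    then have "(coneB D, \<lambda>p. c + ?l (flat_shift D p)) \<in> flat_structure_B D (U 1)"
      unfolding flat_structure_B_def by (rule flat_structure_global)
    moreover have "?\<iota> ` N \<subseteq> coneB D" using sub emb_in_cone by blast
    moreover have "f y = c + ?l (flat_shift D (?\<iota> y))" if y: "y \<in> N" for y
    proof -
      have yb: "y \<in> base D" using sub y by blast
      have "(\<chi> k. pair D (bpt D) (flat_shift D (?\<iota> y)) (v0 (Dual k) (bpt D))) $ k = t y $ k" for k
        using coefficients(1)[OF flat_shift_emb[OF yb], of "Some k"] by (simp add: tz_def)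
      then have "(\<chi> k. pair D (bpt D) (flat_shift D (?\<iota> y)) (v0 (Dual k) (bpt D))) = t y"
        by (intro vec_eq_iff[THEN iffD2] allI)
      then show ?thesis by (simp add: f[OF y])
    qed
    ultimately show ?thesis
      unfolding B_def by (intro bexI[of _ "(coneB D, \<lambda>p. c + ?l (flat_shift D p))"]) simp_all
  qed
  have BA: "\<exists>N'. openin ?top N' \<and> x \<in> N' \<and> N' \<subseteq> N \<and> A N' f"
    if N: "openin ?top N" "x \<in> N" and B: "B N f" for N x f
  proof -
    obtain W' g where g: "(W', g) \<in> flat_structure_B D (U 1)" "?\<iota> ` N \<subseteq> W'" "\<And>y. y \<in> N \<Longrightarrow> f y = g (?\<iota> y)"
      using B unfolding B_def by blast
    have "?\<iota> x \<in> W'" using g(2) N(2) by blast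
    moreover have "\<forall>p\<in>W'. \<exists>Q. openin (top_of_set (coneB D)) Q \<and> p \<in> Q \<and> Q \<subseteq> W' \<and>
        (\<exists>l\<in>?L. \<exists>c. \<forall>q\<in>Q. g q = c + l (flat_shift D q))"
      using g(1) unfolding flat_structure_B_def flat_structure_iff by (rule conjunct2)
    ultimately have "\<exists>Q. openin (top_of_set (coneB D)) Q \<and> ?\<iota> x \<in> Q \<and> Q \<subseteq> W' \<and>
        (\<exists>l\<in>?L. \<exists>c. \<forall>q\<in>Q. g q = c + l (flat_shift D q))"
      by (rule bspec[rotated])
    then obtain Q l c where Q: "openin (top_of_set (coneB D)) Q" "?\<iota> x \<in> Q"
      and "l \<in> ?L" and gQ: "\<And>q. q \<in> Q \<Longrightarrow> g q = c + l (flat_shift D q)"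
      by (elim exE conjE bexE) blast
    then have l: "Vector_Spaces.linear (*s) (*) l" "\<forall>u\<in>U 1 (bpt D). l u = 0" by auto
    have sub: "N \<subseteq> base D" using openin_imp_subset[OF N(1)] .
    have "openin ?top (base D \<inter> ?\<iota> -` Q)"
      using emb_in_cone by (intro continuous_openin_preimage[OF emb_continuous _ Q(1)]) auto
    then have op: "openin ?top (N \<inter> (base D \<inter> ?\<iota> -` Q))" by (rule openin_Int[OF N(1)])
    let ?l = "\<lambda>u :: complex^'n. \<Sum>k\<in>UNIV. u $ k * l (v0 (Mid k) (bpt D))"
    have lin: "Vector_Spaces.linear (*s) (*) ?l"
      by (rule linear_formI) (simp_all add: distrib_right sum.distrib sum_distrib_left mult.assoc)
    have "f y = (c + l (v0 I1 (bpt D))) + ?l (t y)" if "y \<in> N \<inter> (base D \<inter> ?\<iota> -` Q)" for y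
    proof -
      have y: "y \<in> N" "y \<in> base D" "?\<iota> y \<in> Q" using that by auto
      show ?thesis using g(3)[OF y(1)] gQ[OF y(3)] form_flat_shift_emb[OF y(2) l] by simp
    qed
    then have "A (N \<inter> (base D \<inter> ?\<iota> -` Q)) f"
      unfolding A_def using lin by (intro bexI[of _ ?l] exI[of _ "c + l (v0 I1 (bpt D))"]) simp_all
    moreover have "x \<in> N \<inter> (base D \<inter> ?\<iota> -` Q)" using N(2) sub Q(2) by blast
    ultimately show ?thesis using op by (intro exI[of _ "N \<inter> (base D \<inter> ?\<iota> -` Q)"]) simp
  qed
  have "(\<forall>x\<in>W. \<exists>N. openin ?top N \<and> x \<in> N \<and> N \<subseteq> W \<and> A N f)
      = (\<forall>x\<in>W. \<exists>N. openin ?top N \<and> x \<in> N \<and> N \<subseteq> W \<and> B N f)" for W f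
    by (intro ball_cong refl iffI) (meson AB BA subset_trans)+
  then show ?thesis
    by (simp only: flat_structure_coord_def flat_structure_def inherited_flat_structure_def A_def B_def)
qed

lemma z_inv_left: "p \<in> coneB D \<Longrightarrow> inv_into (coneB D) z (z p) = p"
  by (rule inv_into_f_f[OF z_inj])

lemma z_in_zdom: "p \<in> coneB D \<Longrightarrow> z p \<in> zdom"
  using z_image by blast

lemma z_homogeneous:
  assumes "p \<in> coneB D" "c \<noteq> 0"
  shows "(c *s fst p, snd p) \<in> coneB D" "z (c *s fst p, snd p) = c *s z p"
proof -
  obtain x d where x: "x \<in> base D" "d \<noteq> 0" "p = (d *s v I1 x, x)"
    using assms(1) by (auto simp: coneB_iff)
  have p: "(c *s fst p, snd p) = ((c * d) *s v I1 x, x)" by (simp add: x(3))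
  show "(c *s fst p, snd p) \<in> coneB D"
    unfolding p coneB_iff using x(1,2) assms(2) by (intro bexI[of _ x] exI[of _ "c * d"]) simp_all
  show "z (c *s fst p, snd p) = c *s z p"
    unfolding p using x(1,2) assms(2) by (simp add: zw_cone x(3))
qed

lemma coord_holo:
  assumes "holo_on_B D f"
  shows "holo_on (\<lambda>y. f (inv_into (coneB D) z y)) zdom"
proof -
  let ?\<pi> = "\<lambda>x :: complex^('n option). \<chi> i. x $ Some i"
  let ?f = "\<lambda>x. f (x $ None *s v I1 (?\<pi> x), ?\<pi> x)"
  let ?h = "\<lambda>y :: complex^('n option). \<chi> i. case i of None \<Rightarrow> y $ None | Some k \<Rightarrow> zbase y $ k"
  have "holo_on (\<lambda>y. ?h y $ i) zdom" for i
    by (cases i) (simp_all add: holo_on_nth vholo_onD[OF zbase_holo])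
  then have h: "vholo_on ?h zdom" unfolding vholo_on_def by blast
  have "?h ` zdom \<subseteq> chart_dom (base D)"
    using zbase_in by (auto simp: zdom_def)
  from holo_on_compose[OF assms[unfolded holo_on_B_iff] h this]
  show ?thesis
    by (rule holo_on_cong[OF _ zdom_open]) (simp add: z_inv_eq)
qed

text \<open>Special coordinates are linear along the fibres of \<open>B\<close>, so \<open>\<epsilon>\<close> is their Euler field.\<close>

lemma euler_coord:
  assumes f: "holo_on_B D f" and p: "p \<in> coneB D"
  shows "euler_B f p = (\<Sum>j\<in>UNIV. coord_deriv z (coneB D) j f p * z p $ j)"
proof -
  let ?F = "\<lambda>y. f (inv_into (coneB D) z y)"
  have "((\<lambda>c. c *s z p) has_derivative (\<lambda>c. c *s z p)) (at 1)"
    by (rule bounded_linear.has_derivative[OF bounded_linear_smult_left has_derivative_ident])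
  from diff_chain_at[OF this, of ?F "\<lambda>h. \<Sum>i\<in>UNIV. pd i ?F (z p) * h $ i"]
    holo_on_has_derivative[OF coord_holo[OF f] z_in_zdom[OF p]]
  have "((\<lambda>c. ?F (c *s z p)) has_derivative (\<lambda>c. \<Sum>i\<in>UNIV. pd i ?F (z p) * (c * z p $ i))) (at 1)"
    by (simp add: o_def)
  moreover have "(\<lambda>c. \<Sum>i\<in>UNIV. pd i ?F (z p) * (c * z p $ i)) = (*) (\<Sum>i\<in>UNIV. pd i ?F (z p) * z p $ i)"
    by (rule ext) (simp add: sum_distrib_left sum_distrib_right mult_ac)
  ultimately have "((\<lambda>c. ?F (c *s z p)) has_field_derivative (\<Sum>i\<in>UNIV. pd i ?F (z p) * z p $ i)) (at 1)"
    unfolding has_field_derivative_def by simp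
  then have "deriv (\<lambda>c. ?F (c *s z p)) 1 = (\<Sum>j\<in>UNIV. pd j ?F (z p) * z p $ j)"
    by (rule DERIV_imp_deriv)
  moreover have "deriv (\<lambda>c. f (c *s fst p, snd p)) 1 = deriv (\<lambda>c. ?F (c *s z p)) 1"
  proof (rule deriv_cong_ev[OF _ refl])
    have "eventually (\<lambda>c. c \<noteq> (0::complex)) (nhds 1)" by (rule t1_space_nhds) simp
    then show "\<forall>\<^sub>F c in nhds 1. f (c *s fst p, snd p) = ?F (c *s z p)"
    proof eventually_elim
      case (elim c)
      show ?case using z_inv_left[OF z_homogeneous(1)[OF p elim]] z_homogeneous(2)[OF p elim] by simp
    qed
  qed
  ultimately show ?thesis by (simp add: euler_B_def coord_deriv_def)
qed

lemma prepotential_quadratic: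
  assumes P: "prepotential D z w P" and p: "p \<in> coneB D"
  shows "2 * P p = (\<Sum>i\<in>UNIV. w p $ i * z p $ i)"
proof -
  have "holo_on_B D P" and w: "\<And>i. coord_deriv z (coneB D) i P p = w p $ i" and "euler_B P p = 2 * P p"
    using P p by (auto simp: prepotential_def)
  from euler_coord[OF this(1) p] this(3) show ?thesis by (simp add: w)
qed

text \<open>In \<open>\<Sum> z\<^sub>i w\<^sub>i = (2 \<Psi> - \<Sum> t\<^sub>k \<partial>\<^sub>k\<Psi>) + \<Sum> t\<^sub>k \<partial>\<^sub>k\<Psi>\<close> the derivatives cancel.\<close>

theorem restricted_prepotential:
  assumes "prepotential D z w P" and x: "x \<in> base D"
  shows "P (hyperplane_emb D z x) = \<Psi> x"
proof -
  have "2 * P (hyperplane_emb D z x) = (\<Sum>i\<in>UNIV. tw x $ i * tz x $ i)"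
    using prepotential_quadratic[OF assms(1) emb_in_cone[OF x]] by (simp add: z_emb x w_emb)
  also have "\<dots> = 2 * \<Psi> x"
    by (simp add: sum_option tz_def tw_def mult.commute)
  finally show ?thesis by simp
qed

text \<open>The prepotential changes by \<open>q\<close> if \<open>w\<close> changes by the gradient of \<open>q\<close>, which is linear in \<open>z\<close>.  With the
  same \<open>b\<close> and \<open>z\<close>, the tautological section keeps its value if \<open>a\<close> absorbs the opposite change.\<close>

theorem prepotential_add_quadratic:
  assumes P: "prepotential D z w P" and q: "q \<in> poly_hom2"
  shows "\<exists>a' w'. flat_symplectic_basis D a' (\<lambda>i x. fb x i) \<and> taut_expansion D a' (\<lambda>i x. fb x i) z w'
    \<and> prepotential D z w' (\<lambda>p. P p + q (z p))"
proof -
  obtain m where q: "q = (\<lambda>x. \<Sum>i\<in>UNIV. \<Sum>j\<in>UNIV. m i j * x $ i * x $ j)"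
    using q unfolding poly_hom2_def by blast
  define M where "M = (\<lambda>i j. m i j + m j i)"
  have M: "M i j = M j i" for i j by (simp add: M_def)
  \<comment> \<open>\<open>M\<close> is the Hessian of \<open>q\<close>; its symmetry keeps the span of \<open>a'\<close> isotropic\<close>
  define a' where "a' = (\<lambda>i x. fa x i + (\<Sum>j\<in>UNIV. - M i j *s fb x j))"
  define w' where "w' = (\<lambda>p. \<chi> i. w p $ i + (\<Sum>j\<in>UNIV. M i j * z p $ j))"
  have pd_q: "pd i q y = (\<Sum>j\<in>UNIV. M i j * y $ j)" for i y
    unfolding q M_def by (rule pd_quadratic)
  have q_holo: "holo_on q S" for S unfolding q by (intro holo_intros)
  have "flat_symplectic_basis D a' (\<lambda>i x. fb x i)"
  proof (rule flat_symplectic_basisI)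
    show "flat_section D (a' i)" for i
      unfolding a'_def by (intro flat_section_add flat_section_sum flat_section_smult halves_flat)
    show "flat_section D (\<lambda>x. fb x i)" for i by (rule halves_flat)
    fix x assume x: "x \<in> base D"
    interpret symplectic_frame "pair D x" "fa x" "fb x" by (rule v0_frame[OF x])
    have a'b: "pair D x (a' i x) (fb x j) = (if i = j then 1 else 0)" for i j
      by (simp add: a'_def bilin ab bb)
    have "pair D x (a' i x) (a' j x) = 0" for i j
    proof -
      let ?c = "\<lambda>i. \<Sum>k\<in>UNIV. - M i k *s fb x k"
      have "pair D x (fa x i) (?c j) = (\<Sum>k\<in>UNIV. if k = i then - M j k else 0)" for i j
        unfolding sum_right scale_right ab by (intro sum.cong) auto
      then have "pair D x (fa x i) (?c j) = - M j i" for i j by simp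
      moreover from this have "pair D x (?c i) (fa x j) = M i j"
        by (simp only: antisym[of _ "fa x j"] minus_minus)
      moreover have "pair D x (?c i) (?c j) = 0"
        by (simp only: sum_left sum_right scale_left scale_right bb mult_zero_right sum.neutral_const)
      ultimately show ?thesis
        by (simp only: a'_def add_left add_right aa) (simp add: M[of j i])
    qed
    then show "symplectic_frame (pair D x) (\<lambda>i. a' i x) (\<lambda>i. fb x i)"
      using a'b bb card_eq by unfold_locales auto
  qed
  moreover have "taut_expansion D a' (\<lambda>i x. fb x i) z w'"
    unfolding taut_expansion_def
  proof
    fix p assume "p \<in> coneB D"
    then have "fst p = (\<Sum>i\<in>UNIV. z p $ i *s fa (snd p) i) + (\<Sum>i\<in>UNIV. w p $ i *s fb (snd p) i)"
      using taut unfolding taut_expansion_def by blast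
    moreover have "(\<Sum>i\<in>UNIV. z p $ i *s (\<Sum>j\<in>UNIV. M i j *s fb (snd p) j))
        = (\<Sum>i\<in>UNIV. (\<Sum>j\<in>UNIV. M i j * z p $ j) *s fb (snd p) i)"
      unfolding vec.scale_sum_right vec.scale_sum_left vec.scale_scale
      by (subst sum.swap) (simp only: M[of _ "_"] mult.commute)
    ultimately show "fst p = (\<Sum>i\<in>UNIV. z p $ i *s a' i (snd p)) + (\<Sum>i\<in>UNIV. w' p $ i *s fb (snd p) i)"
      by (simp add: a'_def w'_def vec.scale_left_distrib vec.scale_right_distrib sum.distrib
          sum_negf vec.scale_right_diff_distrib sum_subtractf)
  qed
  moreover have "prepotential D z w' (\<lambda>p. P p + q (z p))"
  proof -
    have PB: "holo_on_B D P" using P by (simp add: prepotential_def)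
    let ?F = "\<lambda>y. P (inv_into (coneB D) z y)"
    have holo: "holo_on_B D (\<lambda>p. P p + q (z p))"
    proof -
      let ?c = "\<lambda>x :: complex^('n option). (x $ None *s v I1 (\<chi> i. x $ Some i), \<chi> i. x $ Some i)"
      have "vholo_on (\<lambda>x. z (?c x)) (chart_dom (base D))"
        using coordinates_on_B_z unfolding coordinates_on_B_def holo_on_B_iff vholo_on_def by blast
      from holo_on_compose[OF q_holo[of UNIV] this] PB
      show ?thesis unfolding holo_on_B_iff by (intro holo_on_add) auto
    qed
    have coord: "coord_deriv z (coneB D) i (\<lambda>p. P p + q (z p)) p = w' p $ i" if p: "p \<in> coneB D" for i p
    proof -
      have "pd i (\<lambda>y. ?F y + q (z (inv_into (coneB D) z y))) (z p) = pd i (\<lambda>y. ?F y + q y) (z p)"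
        by (rule pd_cong[OF zdom_open z_in_zdom[OF p]]) (simp add: f_inv_into_f z_image)
      also have "\<dots> = pd i ?F (z p) + pd i q (z p)"
        by (rule pd_add[OF coord_holo[OF PB] q_holo z_in_zdom[OF p]])
      also have "pd i ?F (z p) = w p $ i"
        using P p by (simp add: prepotential_def coord_deriv_def)
      finally show ?thesis by (simp add: coord_deriv_def w'_def pd_q)
    qed
    have "euler_B (\<lambda>p. P p + q (z p)) p = 2 * (P p + q (z p))" if p: "p \<in> coneB D" for p
    proof -
      have "(\<Sum>i\<in>UNIV. (\<Sum>j\<in>UNIV. M i j * z p $ j) * z p $ i) = 2 * q (z p)"
      proof -
        have "(\<Sum>i\<in>UNIV. \<Sum>j\<in>UNIV. m j i * z p $ j * z p $ i) = q (z p)"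
          unfolding q by (rule sum.swap)
        moreover have "(\<Sum>i\<in>UNIV. \<Sum>j\<in>UNIV. m i j * z p $ j * z p $ i) = q (z p)"
          unfolding q by (simp add: mult_ac)
        ultimately show ?thesis
          by (simp add: M_def sum_distrib_right distrib_right sum.distrib)
      qed
      then show ?thesis
        using euler_coord[OF holo p] prepotential_quadratic[OF P p]
        by (simp add: coord[OF p] w'_def distrib_right sum.distrib)
    qed
    with holo coord show ?thesis by (simp add: prepotential_def)
  qed
  ultimately show ?thesis by (intro exI[of _ a'] exI[of _ w']) simp
qed

theorem potential_class:
  assumes P: "prepotential D z w P"
  defines "M \<equiv> frob_space (base D)"
  shows "(\<lambda>P. restrict (frob_potential t (\<lambda>x. P (hyperplane_emb D z x))) M) ` {\<lambda>p. P p + q (z p) | q. q \<in> poly_hom2}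
    = (\<lambda>\<Phi>. restrict \<Phi> M) ` {\<lambda>p. frob_potential t \<Psi> p + q (t (fst (snd p))) | q. q \<in> poly_le2}"
proof -
  have eq: "restrict (frob_potential t (\<lambda>x. P (hyperplane_emb D z x) + q (z (hyperplane_emb D z x)))) M
      = restrict (\<lambda>p. frob_potential t \<Psi> p + q' (t (fst (snd p)))) M"
    if "\<forall>x. q (affine_point x) = q' x" for q q'
  proof (rule restrict_ext)
    fix p assume "p \<in> M"
    then obtain c x s where p: "p = (c, x, s)" and x: "x \<in> base D"
      by (cases p) (auto simp: M_def frob_space_def)
    show "frob_potential t (\<lambda>x. P (hyperplane_emb D z x) + q (z (hyperplane_emb D z x))) p
        = frob_potential t \<Psi> p + q' (t (fst (snd p)))"
      using that by (simp add: p frob_potential_def restricted_prepotential[OF P x] z_emb[OF x] tz_affine)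
  qed
  show ?thesis
  proof (intro equalityI subsetI; elim imageE CollectE exE conjE)
    fix R P' q assume "R = restrict (frob_potential t (\<lambda>x. P' (hyperplane_emb D z x))) M"
      "P' = (\<lambda>p. P p + q (z p))" and q: "q \<in> poly_hom2"
    moreover obtain q' where q': "q' \<in> poly_le2" "\<forall>x. q (affine_point x) = q' x"
      using dehomogenize[OF q] by blast
    ultimately have "R = restrict (\<lambda>p. frob_potential t \<Psi> p + q' (t (fst (snd p)))) M"
      using eq[OF q'(2)] by simp
    with q'(1) show "R \<in> (\<lambda>\<Phi>. restrict \<Phi> M) ` {\<lambda>p. frob_potential t \<Psi> p + q (t (fst (snd p))) | q. q \<in> poly_le2}"
      by blast
  next
    fix R \<Phi> q' assume "R = restrict \<Phi> M"
      "\<Phi> = (\<lambda>p. frob_potential t \<Psi> p + q' (t (fst (snd p))))" and q': "q' \<in> poly_le2"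
    moreover obtain q where q: "q \<in> poly_hom2" "\<forall>x. q (affine_point x) = q' x"
      using homogenize[OF q'] by blast
    ultimately have R: "R = restrict (frob_potential t (\<lambda>x. P (hyperplane_emb D z x) + q (z (hyperplane_emb D z x)))) M"
      using eq[OF q(2)] by simp
    show "R \<in> (\<lambda>P. restrict (frob_potential t (\<lambda>x. P (hyperplane_emb D z x))) M) ` {\<lambda>p. P p + q (z p) | q. q \<in> poly_hom2}"
      unfolding R by (rule image_eqI[where x="\<lambda>p. P p + q (z p)"]) (use q(1) in blast)+
  qed
qed

end

section \<open>Comparison of the Frobenius manifold with projective special geometry\<close>

theorem theorem5p3:
  fixes D :: "('n::finite, 'm::finite) vhf"
    and U :: "int \<Rightarrow> complex^'n \<Rightarrow> (complex^'m) set"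
    and lam0 :: "complex^'m"
    and v v0 :: "'n idx \<Rightarrow> complex^'n \<Rightarrow> complex^'m"
    and a b :: "'n option \<Rightarrow> complex^'n \<Rightarrow> complex^'m"
    and t :: "complex^'n \<Rightarrow> complex^'n"
    and \<Psi> :: "complex^'n \<Rightarrow> complex"
    and \<Phi> :: "'n fpoint \<Rightarrow> complex"
    and z w :: "(complex^'m) \<times> (complex^'n) \<Rightarrow> complex^('n option)"
    and \<Psi>U :: "(complex^'m) \<times> (complex^'n) \<Rightarrow> complex"
    and M :: "'n fpoint set"
    and \<iota> :: "complex^'n \<Rightarrow> (complex^'m) \<times> (complex^'n)"
  assumes "variation_hodge_like D" and "CY_condition D"
    and "opposite_filtration D U"
    and "lam0 \<in> fil D 3 (bpt D)" and "lam0 \<noteq> 0"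
    and "adapted_basis D U v" and "flat_extension D v v0" and "v0 I1 (bpt D) = lam0"
    and "\<And>x. a None x = v0 I1 x" and "\<And>i x. a (Some i) x = v0 (Mid i) x"
    and "\<And>x. b None x = - v0 Last x" and "\<And>i x. b (Some i) x = v0 (Dual i) x"
    and "frobenius_data D v v0 t \<Psi>" and "\<Phi> = frob_potential t \<Psi>"
    and "taut_expansion D a b z w" and "prepotential D z w \<Psi>U"
    and "M = frob_space (base D)" and "\<iota> = hyperplane_emb D z"
  shows
    \<comment> \<open>the symplectic basis and its special coordinates; then (a), (b), (c)\<close>
    "(flat_symplectic_basis D a b
      \<and> opposite_subbundle D (U 1) \<and> (\<forall>x\<in>base D. vec.span (range (\<lambda>i. b i x)) = U 1 x)
      \<and> flat_subbundle D (\<lambda>x. vec.span (range (\<lambda>i. a i x)))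
      \<and> vec.span (range (\<lambda>i. a i (bpt D))) = fil D 2 (bpt D)
      \<and> coordinates_on_B D z)
     \<and>
     ({p \<in> coneB D. PU2 D (U 2) p \<in> {lam0} \<times> base D} = hyperplane_z1 D z
      \<and> bij_betw snd (hyperplane_z1 D z) (base D)
      \<and> holo_embedding (base D) \<iota> \<and> \<iota> ` base D = hyperplane_z1 D z \<and> (\<forall>x\<in>base D. snd (\<iota> x) = x)
      \<and> flat_structure_coord (base D) t
          = inherited_flat_structure (base D) \<iota> (flat_structure_B D (U 1)))
     \<and>
     (\<forall>x\<in>base D. (\<forall>i. t x $ i = z (\<iota> x) $ Some i) \<and> \<Psi> x = \<Psi>U (\<iota> x))
     \<and>
     ((\<forall>q\<in>poly_le2.
         frobenius_manifold (base D) t (\<lambda>p. \<Phi> p + q (frob_coord t p)) = frobenius_manifold (base D) t \<Phi>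
         \<and> frobenius_potential_of (frobenius_manifold (base D) t \<Phi>) (\<lambda>p. \<Phi> p + q (frob_coord t p)))
      \<and> (\<forall>q\<in>poly_hom2. \<exists>a' w'. flat_symplectic_basis D a' b \<and> taut_expansion D a' b z w'
           \<and> prepotential D z w' (\<lambda>p. \<Psi>U p + q (z p)))
      \<and> (\<lambda>P. restrict (frob_potential t (\<lambda>x. P (\<iota> x))) M) ` {\<lambda>p. \<Psi>U p + q (z p) | q. q \<in> poly_hom2}
          = (\<lambda>\<Phi>'. restrict \<Phi>' M) ` {\<lambda>p. \<Phi> p + q (t (fst (snd p))) | q. q \<in> poly_le2})"
proof -
  have lam0: "v0 I1 (bpt D) = lam0" "lam0 \<noteq> 0" by fact+
  have a: "a = (\<lambda>i x. pos_half (\<lambda>\<alpha>. v0 \<alpha> x) i)"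
  proof (intro ext)
    fix i x show "a i x = pos_half (\<lambda>\<alpha>. v0 \<alpha> x) i" by (cases i) (simp_all add: assms(9,10))
  qed
  have b: "b = (\<lambda>i x. neg_half (\<lambda>\<alpha>. v0 \<alpha> x) i)"
  proof (intro ext)
    fix i x show "b i x = neg_half (\<lambda>\<alpha>. v0 \<alpha> x) i" by (cases i) (simp_all add: assms(11,12))
  qed
  interpret special_vhl D U v v0 t \<Psi> z w
    by unfold_locales (use assms(1-3,6,7,13,15) in \<open>simp_all only: a b\<close>)
  have t: "coordinates_on (base D) t"
    using frob by (simp add: frobenius_data_def)
  have A: "flat_symplectic_basis D a b
      \<and> opposite_subbundle D (U 1) \<and> (\<forall>x\<in>base D. vec.span (range (\<lambda>i. b i x)) = U 1 x)
      \<and> flat_subbundle D (\<lambda>x. vec.span (range (\<lambda>i. a i x)))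
      \<and> vec.span (range (\<lambda>i. a i (bpt D))) = fil D 2 (bpt D)
      \<and> coordinates_on_B D z"
    unfolding a b
    by (intro conjI ballI symplectic_basis opposite_subbundle_U1 span_fb flat_subbundle_fa span_fa_bpt
        coordinates_on_B_z)
  have B: "{p \<in> coneB D. PU2 D (U 2) p \<in> {lam0} \<times> base D} = hyperplane_z1 D z
      \<and> bij_betw snd (hyperplane_z1 D z) (base D)
      \<and> holo_embedding (base D) \<iota> \<and> \<iota> ` base D = hyperplane_z1 D z \<and> (\<forall>x\<in>base D. snd (\<iota> x) = x)
      \<and> flat_structure_coord (base D) t
          = inherited_flat_structure (base D) \<iota> (flat_structure_B D (U 1))"
    unfolding assms(18)
    by (intro conjI PU2_preimage[OF lam0] hyperplane_embedding flat_structures_agree)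
  have C: "\<forall>x\<in>base D. (\<forall>i. t x $ i = z (\<iota> x) $ Some i) \<and> \<Psi> x = \<Psi>U (\<iota> x)"
    unfolding assms(18) by (simp add: z_emb tz_def restricted_prepotential[OF assms(16)])
  have E: "\<forall>q\<in>poly_le2.
         frobenius_manifold (base D) t (\<lambda>p. \<Phi> p + q (frob_coord t p)) = frobenius_manifold (base D) t \<Phi>
         \<and> frobenius_potential_of (frobenius_manifold (base D) t \<Phi>) (\<lambda>p. \<Phi> p + q (frob_coord t p))"
    unfolding assms(14)
    by (intro ballI conjI frobenius_manifold_add_poly[OF t \<Psi>_holo] frobenius_potential_of_add_poly[OF t \<Psi>_holo])
  have F: "\<forall>q\<in>poly_hom2. \<exists>a' w'. flat_symplectic_basis D a' b \<and> taut_expansion D a' b z w'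
           \<and> prepotential D z w' (\<lambda>p. \<Psi>U p + q (z p))"
    unfolding b by (intro ballI prepotential_add_quadratic assms(16))
  have G: "(\<lambda>P. restrict (frob_potential t (\<lambda>x. P (\<iota> x))) M) ` {\<lambda>p. \<Psi>U p + q (z p) | q. q \<in> poly_hom2}
          = (\<lambda>\<Phi>'. restrict \<Phi>' M) ` {\<lambda>p. \<Phi> p + q (t (fst (snd p))) | q. q \<in> poly_le2}"
    unfolding assms(14,17,18) by (rule potential_class[OF assms(16)])
  show ?thesis by (rule conjI[OF A conjI[OF B conjI[OF C conjI[OF E conjI[OF F G]]]]])
qed

end
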